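(* Let $X=\{X_t:t\ge 0\}$ be a one-dimensional Lévy process with zero mean, diffusion coefficient $\sigma\ge 0$ and Lévy measure $\nu$ with $\int_{\mathbb R}(|y|\wedge|y|^2)\,\nu(dy)<\infty$, and suppose that for some $\alpha\in(1,2]$ and some function $b$ the Standing Condition (one-sided moment, fluctuation scale, local heavy tail) given in the context holds. Then for any constants $\theta,\delta_0>0$ and $K\ge 0$, as $t\to\infty$, $$\sup_{x\ge\theta t}\ \sup_{|y|\le Kb(x)}\ \sup_{\delta\in[\delta_0,\infty]}\ \sup_{0<s\le t}\left|\frac{\mathbf P\big(X_s\in x-y+\Delta_\delta\big)}{s\cdot\nu\big(x+\Delta_\delta\big)}-1\right|\to 0 .$$
   Context: Notation: $\Delta_\delta:=(0,\delta]$ for $\delta\in(0,\infty)$ and $\Delta_\infty:=(0,\infty)$; $x+\Delta_\delta:=(x,x+\delta]$ (and $(x,\infty)$ if $\delta=\infty$). $a^+:=a\vee 0$. Classes of non-negative functions $f$ (only the behaviour on the positive half-line matters): - $\mathcal{AD}$ (almost decreasing): there is $c>0$ with $f(x)\ge c f(y)$ for all large $y\ge x>0$. - $\mathcal Sd$ (subexponential): for all $y\in\mathbb R$, as $x\to\infty$, $\frac1{f(x)}\int_0^x f(x-z)f(z)\,dz\to 2\int_0^\infty f(z)\,dz<\infty$ and $f(x+y)\sim f(x)$. - $\mathcal{OR}$ (O-regularly varying): for all $\lambda\ge1$, $0<\liminf_{x\to\infty}\frac{f(\lambda x)}{f(x)}\le\limsup_{x\to\infty}\frac{f(\lambda x)}{f(x)}<\infty$.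 (Implicitly, functions appearing in denominators are positive for all large arguments.) Standing Condition, for some $\alpha\in(1,2]$: (1) $\mathbf E[(X_1^+)^\alpha]<\infty$ (equivalently $\int_1^\infty x^\alpha\,\nu(dx)<\infty$). (2) There is an eventually non-decreasing positive function $b\in\mathcal{OR}$ on $[0,\infty)$ with $\liminf_{t\to\infty}b(t)/t^{1/\alpha}>0$, $\limsup_{t\to\infty}b(t)/t=0$ and $\limsup_{K\to\infty}\limsup_{t\to\infty}\mathbf P(|X_t|\ge Kb(t))=0$. (3) For every real $\delta>0$: the function $x\mapsto\nu(x+\Delta_\delta)$ is in $\mathcal{AD}$, the function $x\mapsto x^\alpha\nu(x+\Delta_\delta)$ is in $\mathcal Sd\cup\mathcal{OR}$, and for every $K\ge0$, $\limsup_{x\to\infty}\sup_{|y|\le Kb(x)}\left|\frac{\nu(x-y+\Delta_\delta)}{\nu(x+\Delta_\delta)}-1\right|=0$. *)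

theory Defs
  imports "HOL-Probability.Probability" "HOL-Library.Landau_Symbols"
begin

section \<open>Levy processes\<close>

text \<open>Right-continuity with left limits and $X_0 = 0$ are required almost surely only.\<close>

locale levy_process = prob_space M for M :: "'a measure" +
  fixes X :: "real \<Rightarrow> 'a \<Rightarrow> real"
  assumes rv: "\<And>t. 0 \<le> t \<Longrightarrow> X t \<in> borel_measurable M"
    and start_zero: "AE \<omega> in M. X 0 \<omega> = 0"
    and indep_increments:
      "\<And>(n::nat) (t::nat \<Rightarrow> real).
         0 \<le> t 0 \<Longrightarrow> (\<And>i. i < n \<Longrightarrow> t i \<le> t (Suc i)) \<Longrightarrow>
         indep_vars (\<lambda>_. borel) (\<lambda>i \<omega>. X (t (Suc i)) \<omega> - X (t i) \<omega>) {..<n}"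
    and stationary_increments:
      "\<And>s t. 0 \<le> s \<Longrightarrow> 0 \<le> t \<Longrightarrow>
         distr M borel (\<lambda>\<omega>. X (s + t) \<omega> - X s \<omega>) = distr M borel (X t)"
    and cadlag:
      "AE \<omega> in M. (\<forall>t\<ge>0. ((\<lambda>s. X s \<omega>) \<longlongrightarrow> X t \<omega>) (at_right t)) \<and>
                  (\<forall>t>0. \<exists>l. ((\<lambda>s. X s \<omega>) \<longlongrightarrow> l) (at_left t))"

definition levy_measure :: "real measure \<Rightarrow> bool" where
  "levy_measure \<nu> \<longleftrightarrow>
     sets \<nu> = sets borel \<and> emeasure \<nu> {0} = 0 \<and> integrable \<nu> (\<lambda>y. min 1 (y\<^sup>2))"

text \<open>The drift \<open>\<gamma>\<close>, diffusion coefficient \<open>\<sigma>\<close> and Levy measure \<open>\<nu>\<close> are those of the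
  Levy--Khintchine formula with truncation function $y 1_{|y| \le 1}$; the Gaussian part at
  time $t$ has variance $\sigma^2 t$.\<close>

definition has_levy_triplet ::
  "'a measure \<Rightarrow> (real \<Rightarrow> 'a \<Rightarrow> real) \<Rightarrow> real \<Rightarrow> real \<Rightarrow> real measure \<Rightarrow> bool" where
  "has_levy_triplet M X \<gamma> \<sigma> \<nu> \<longleftrightarrow> 0 \<le> \<sigma> \<and> levy_measure \<nu> \<and>
     (\<forall>t\<ge>0. \<forall>u. char (distr M borel (X t)) u =
        exp (of_real t * (\<i> * of_real (\<gamma> * u) - of_real (\<sigma>\<^sup>2 * u\<^sup>2 / 2) +
          (LINT y|\<nu>. iexp (u * y) - 1 - \<i> * of_real (u * y * indicator {-1..1} y)))))"

definition zero_mean :: "'a measure \<Rightarrow> (real \<Rightarrow> 'a \<Rightarrow> real) \<Rightarrow> bool" where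
  "zero_mean M X \<longleftrightarrow> (\<forall>t\<ge>0. integrable M (X t) \<and> (LINT \<omega>|M. X t \<omega>) = 0)"

section \<open>Classes of functions\<close>

text \<open>Only the restriction of a function to the positive half-line is relevant. Where a function
  occurs as a denominator, it is required to be positive for all large arguments.\<close>

definition almost_decreasing :: "(real \<Rightarrow> real) set" where
  "almost_decreasing = {f. (\<forall>x>0. 0 \<le> f x) \<and>
     (\<exists>c>0. \<exists>x0>0. \<forall>x y. x0 \<le> x \<longrightarrow> x \<le> y \<longrightarrow> c * f y \<le> f x)}"

definition subexponential :: "(real \<Rightarrow> real) set" where
  "subexponential = {f. (\<forall>x>0. 0 \<le> f x) \<and> (\<forall>\<^sub>F x in at_top. 0 < f x) \<and>
     set_integrable lborel {0<..} f \<and>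
     ((\<lambda>x. (LINT z:{0<..<x}|lborel. f (x - z) * f z) / f x)
        \<longlongrightarrow> 2 * (LINT z:{0<..}|lborel. f z)) at_top \<and>
     (\<forall>y. (\<lambda>x. f (x + y)) \<sim>[at_top] f)}"

definition O_regularly_varying :: "(real \<Rightarrow> real) set" where
  "O_regularly_varying = {f. (\<forall>x>0. 0 \<le> f x) \<and> (\<forall>\<^sub>F x in at_top. 0 < f x) \<and>
     (\<forall>r\<ge>1. 0 < Liminf at_top (\<lambda>x. ereal (f (r * x) / f x)) \<and>
             Limsup at_top (\<lambda>x. ereal (f (r * x) / f x)) < \<infinity>)}"

section \<open>The standing condition\<close>

definition Delta :: "ereal \<Rightarrow> real set" where
  "Delta \<delta> = {z. 0 < z \<and> ereal z \<le> \<delta>}"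

definition shifted_Delta :: "real \<Rightarrow> ereal \<Rightarrow> real set" where
  "shifted_Delta x \<delta> = (\<lambda>z. x + z) ` Delta \<delta>"

lemma shifted_Delta_ereal: "shifted_Delta x (ereal d) = {x<..x + d}"
proof -
  have "r \<in> (\<lambda>z. x + z) ` A \<longleftrightarrow> r - x \<in> A" for r and A :: "real set"
    by (metis add.commute diff_add_cancel add_diff_cancel_left' image_iff)
  then show ?thesis by (auto simp: shifted_Delta_def Delta_def)
qed

lemma shifted_Delta_infinity: "shifted_Delta x \<infinity> = {x<..}"
proof -
  have "r \<in> (\<lambda>z. x + z) ` A \<longleftrightarrow> r - x \<in> A" for r and A :: "real set"
    by (metis add.commute diff_add_cancel add_diff_cancel_left' image_iff)
  then show ?thesis by (auto simp: shifted_Delta_def Delta_def)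
qed

definition one_sided_moment :: "'a measure \<Rightarrow> (real \<Rightarrow> 'a \<Rightarrow> real) \<Rightarrow> real \<Rightarrow> bool" where
  "one_sided_moment M X \<alpha> \<longleftrightarrow> integrable M (\<lambda>\<omega>. max (X 1 \<omega>) 0 powr \<alpha>)"

definition fluctuation_scale ::
  "'a measure \<Rightarrow> (real \<Rightarrow> 'a \<Rightarrow> real) \<Rightarrow> real \<Rightarrow> (real \<Rightarrow> real) \<Rightarrow> bool" where
  "fluctuation_scale M X \<alpha> b \<longleftrightarrow>
     (\<forall>t\<ge>0. 0 < b t) \<and> (\<exists>t0. mono_on {t0..} b) \<and> b \<in> O_regularly_varying \<and>
     0 < Liminf at_top (\<lambda>t. ereal (b t / t powr (1 / \<alpha>))) \<and>
     Limsup at_top (\<lambda>t. ereal (b t / t)) = 0 \<and>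
     Limsup at_top (\<lambda>K::real. Limsup at_top
       (\<lambda>t. ereal (measure M {\<omega> \<in> space M. K * b t \<le> \<bar>X t \<omega>\<bar>}))) = 0"

definition local_heavy_tail :: "real measure \<Rightarrow> real \<Rightarrow> (real \<Rightarrow> real) \<Rightarrow> bool" where
  "local_heavy_tail \<nu> \<alpha> b \<longleftrightarrow> (\<forall>\<delta>::real. 0 < \<delta> \<longrightarrow>
     (\<lambda>x. measure \<nu> (shifted_Delta x \<delta>)) \<in> almost_decreasing \<and>
     (\<lambda>x. x powr \<alpha> * measure \<nu> (shifted_Delta x \<delta>)) \<in> subexponential \<union> O_regularly_varying \<and>
     (\<forall>K\<ge>0. Limsup at_top (\<lambda>x. SUP y\<in>{y. \<bar>y\<bar> \<le> K * b x}.
        ereal \<bar>measure \<nu> (shifted_Delta (x - y) \<delta>) / measure \<nu> (shifted_Delta x \<delta>) - 1\<bar>) = 0))"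

definition standing_condition ::
  "'a measure \<Rightarrow> (real \<Rightarrow> 'a \<Rightarrow> real) \<Rightarrow> real measure \<Rightarrow> real \<Rightarrow> (real \<Rightarrow> real) \<Rightarrow> bool" where
  "standing_condition M X \<nu> \<alpha> b \<longleftrightarrow>
     one_sided_moment M X \<alpha> \<and> fluctuation_scale M X \<alpha> b \<and> local_heavy_tail \<nu> \<alpha> b"

end

theory Submission
  imports Defs
begin

text \<open>Write \<open>f x\<close> for the mass that $\nu$ gives to $(x, x + d]$ and put $q = -\ln f$. Cut the jumps at the level
  $h = \min(b(x), x / q(x))$: the law of $X_s$ is the convolution of a law $Z$ with jumps at most
  $h$ and a compound Poisson law carrying the jumps above $h$. Insensitivity forces
  $q(x) = O(x^{1 - 1/\alpha})$, hence $h^\alpha \ge c x \ge c \theta s$. Therefore the expected number of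
  large jumps tends to 0, and each of the two alternatives for $x^\alpha f(x)$ shows that two or
  more large jumps are negligible: the compound Poisson law gives $(y, y + d]$ asymptotically at most
  the mass $s f(y)$, for every $y \ge 0$. Tightness of $X_t / b(t)$ bounds the truncated variance at the
  scale $b$, which gives $Z$ exponential moments at the scale $b(x)$; this handles displacements of
  $Z$ up to $x / 2$, since $f(x - z) \le f(x) e^{1 + z / b(x)}$. Displacements beyond $x / 2$ have probability
  $o(f(x))$ by Chernoff's bound at the rate $8 q(x) / x$. Longer intervals, including half-lines, are
  cut into blocks of a small fixed length.\<close>

section \<open>Convolution powers and compound Poisson laws\<close>

text \<open>The weight x^\<alpha> in the class hypothesis absorbs time: two large jumps cost
  \<open>s\<close> times the integral of f(u) f(y - u) over u \<ge> h, and since s is at most a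
  multiple of h^\<alpha>, it can be moved inside as u^\<alpha>, where the class hypothesis makes the
  integral small. Three obstacles shape the rest. The error must be small relative to s f(x)
  uniformly down to s = 0, so every term of the upper bound has to carry a factor s. Negative jumps
  are only assumed integrable, so nothing exponential is available on the left; zero mean together
  with exponential moments on the right bounds E|Z| instead. The variance bound at the scale b is
  read off the characteristic function: its real part controls the even part of the jumps, its
  imaginary part only a signed integral, and the one-sided moment makes up for the sign. The
  analysis is done at one window length d, which finally depends on the prescribed error; this is
  how uniformity in \<delta> arises from hypotheses on each fixed \<delta>.\<close>

lemma real_distributionI:
  "prob_space M \<Longrightarrow> sets M = sets borel \<Longrightarrow> real_distribution M"
  by (simp add: real_distribution_def real_distribution_axioms_def)

lemma real_distribution_convolution:
  assumes "real_distribution M" "real_distribution N"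
  shows "real_distribution (M \<star> N)"
proof -
  interpret M: real_distribution M by fact
  interpret N: real_distribution N by fact
  interpret pair_prob_space M N ..
  show ?thesis unfolding convolution_def
    by (intro prob_space.real_distribution_distr) (auto intro: prob_space_axioms)
qed

lemma char_convolution:
  assumes "real_distribution M" "real_distribution N"
  shows "char (M \<star> N) t = char M t * char N t"
proof -
  interpret M: real_distribution M by fact
  interpret N: real_distribution N by fact
  interpret P: pair_prob_space M N ..
  have i: "integrable (M \<Otimes>\<^sub>M N) (\<lambda>(x, y). iexp (t * x) * iexp (t * y))"
    by (rule P.integrable_const_bound[where B=1]) (auto simp: norm_mult)
  have "char (M \<star> N) t = (CLINT p|M \<Otimes>\<^sub>M N. (case p of (x, y) \<Rightarrow> iexp (t * x) * iexp (t * y)))"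
    unfolding char_def convolution_def
    by (subst integral_distr) (auto intro!: Bochner_Integration.integral_cong
        simp: exp_add[symmetric] algebra_simps split: prod.split)
  also have "\<dots> = (CLINT x|M. CLINT y|N. iexp (t * x) * iexp (t * y))"
    using P.integral_fst'[OF i] by simp
  also have "\<dots> = char M t * char N t"
    by (simp add: char_def)
  finally show ?thesis .
qed

primrec conv_power :: "real measure \<Rightarrow> nat \<Rightarrow> real measure" where
  "conv_power J 0 = return borel 0"
| "conv_power J (Suc n) = (J \<star> conv_power J n)"

lemma real_distribution_return: "real_distribution (return borel (x::real))"
  by (intro real_distributionI prob_space_return) auto

lemma real_distribution_conv_power:
  "real_distribution J \<Longrightarrow> real_distribution (conv_power J n)"
  by (induction n) (auto intro: real_distribution_return real_distribution_convolution)

lemma char_return: "char (return borel x) t = iexp (t * x)"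
  by (simp add: char_def integral_return)

lemma char_conv_power:
  "real_distribution J \<Longrightarrow> char (conv_power J n) t = char J t ^ n"
  by (induction n)
    (auto simp: char_return char_convolution real_distribution_conv_power)

lemma nn_integral_convolution_real:
  assumes "real_distribution M" "real_distribution N" "f \<in> borel_measurable borel"
  shows "(\<integral>\<^sup>+x. f x \<partial>(M \<star> N)) = (\<integral>\<^sup>+x. \<integral>\<^sup>+y. f (x + y) \<partial>N \<partial>M)"
proof -
  interpret M: real_distribution M by fact
  interpret N: real_distribution N by fact
  show ?thesis
    by (rule nn_integral_convolution) (use assms in \<open>auto simp: M.finite_measure_axioms N.finite_measure_axioms\<close>)
qed

lemma nn_integral_exp_convolution:
  assumes "real_distribution M" "real_distribution N"
  shows "(\<integral>\<^sup>+x. ennreal (exp (l * x)) \<partial>(M \<star> N)) =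
    (\<integral>\<^sup>+x. ennreal (exp (l * x)) \<partial>M) * (\<integral>\<^sup>+x. ennreal (exp (l * x)) \<partial>N)"
proof -
  interpret M: real_distribution M by fact
  interpret N: real_distribution N by fact
  show ?thesis
    by (subst nn_integral_convolution_real)
      (simp_all add: assms exp_add distrib_left ennreal_mult nn_integral_cmult nn_integral_multc)
qed

lemma nn_integral_exp_conv_power:
  assumes "real_distribution J"
  shows "(\<integral>\<^sup>+x. ennreal (exp (l * x)) \<partial>conv_power J n) = (\<integral>\<^sup>+x. ennreal (exp (l * x)) \<partial>J) ^ n"
  by (induction n) (simp_all add: nn_integral_return nn_integral_exp_convolution assms
      real_distribution_conv_power)

text \<open>The rate \<open>a\<close> is the expected number of jumps;
  \<open>conv_power J 0\<close>, the atom at 0, carries the event of no jump.\<close>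

definition compound_poisson :: "real \<Rightarrow> real measure \<Rightarrow> real measure" where
  "compound_poisson a J = measure_pmf (poisson_pmf a) \<bind> conv_power J"

lemma conv_power_kernel:
  assumes "real_distribution J"
  shows "conv_power J \<in> measurable (measure_pmf p) (subprob_algebra borel)"
proof -
  have "conv_power J n \<in> space (subprob_algebra borel)" for n
  proof -
    interpret N: real_distribution "conv_power J n"
      by (rule real_distribution_conv_power) fact
    show ?thesis by (simp add: space_subprob_algebra N.subprob_space_axioms)
  qed
  then show ?thesis by simp
qed

lemma real_distribution_compound_poisson:
  assumes "real_distribution J"
  shows "real_distribution (compound_poisson a J)"
proof (rule real_distributionI)
  show "sets (compound_poisson a J) = sets borel"
    unfolding compound_poisson_def
    by (subst sets_bind[where N=borel])
      (auto simp: real_distribution.events_eq_borel[OF real_distribution_conv_power[OF assms]])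
  show "prob_space (compound_poisson a J)"
    unfolding compound_poisson_def
    by (rule measure_pmf.prob_space_bind[OF _ conv_power_kernel[OF assms]])
      (auto intro!: AE_I2 real_distribution.axioms real_distribution_conv_power assms)
qed

lemma nn_integral_compound_poisson:
  assumes "0 < a" "real_distribution J" "f \<in> borel_measurable borel"
  shows "(\<integral>\<^sup>+x. f x \<partial>compound_poisson a J) =
    (\<Sum>n. ennreal (a ^ n / fact n * exp (-a)) * (\<integral>\<^sup>+x. f x \<partial>conv_power J n))"
proof -
  have "(\<integral>\<^sup>+x. f x \<partial>compound_poisson a J) =
    (\<integral>\<^sup>+n. (\<integral>\<^sup>+x. f x \<partial>conv_power J n) \<partial>measure_pmf (poisson_pmf a))"
    unfolding compound_poisson_def
    by (rule nn_integral_bind[OF assms(3) conv_power_kernel[OF assms(2)]])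
  also have "\<dots> = (\<Sum>n. ennreal (a ^ n / fact n * exp (-a)) * (\<integral>\<^sup>+x. f x \<partial>conv_power J n))"
    by (simp add: nn_integral_measure_pmf nn_integral_count_space_nat assms(1))
  finally show ?thesis .
qed

lemma emeasure_compound_poisson:
  assumes "0 < a" "real_distribution J" "B \<in> sets borel"
  shows "emeasure (compound_poisson a J) B =
    (\<Sum>n. ennreal (a ^ n / fact n * exp (-a)) * emeasure (conv_power J n) B)"
  using nn_integral_compound_poisson[OF assms(1,2), of "indicator B"] assms
  by (simp add: real_distribution.events_eq_borel[OF real_distribution_conv_power]
      real_distribution.events_eq_borel[OF real_distribution_compound_poisson])

lemma exp_sums_real: "(\<lambda>n. a ^ n / fact n) sums exp (a::real)"
  using exp_converges[of a] by (simp add: divide_inverse mult.commute)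

lemma nn_integral_exp_compound_poisson:
  assumes "0 < a" "real_distribution J" "(\<integral>\<^sup>+x. ennreal (exp (l * x)) \<partial>J) = ennreal L" "0 \<le> L"
  shows "(\<integral>\<^sup>+x. ennreal (exp (l * x)) \<partial>compound_poisson a J) = ennreal (exp (a * (L - 1)))"
proof -
  have "(\<integral>\<^sup>+x. ennreal (exp (l * x)) \<partial>compound_poisson a J) =
     (\<Sum>n. ennreal ((a * L) ^ n / fact n * exp (-a)))"
    using assms by (subst nn_integral_compound_poisson)
      (auto simp: nn_integral_exp_conv_power ennreal_power ennreal_mult[symmetric] power_mult_distrib
        intro!: suminf_cong arg_cong[where f=ennreal])
  also have "\<dots> = ennreal (exp (a * L) * exp (-a))"
    using assms sums_mult2[OF exp_sums_real[of "a * L"], of "exp (-a)"]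
    by (intro suminf_ennreal_eq) auto
  also have "exp (a * L) * exp (-a) = exp (a * (L - 1))"
    by (simp add: exp_add[symmetric] algebra_simps)
  finally show ?thesis .
qed

lemma char_compound_poisson:
  assumes a: "0 < a" and J: "real_distribution J"
  shows "char (compound_poisson a J) t = exp (of_real a * (char J t - 1))"
proof -
  interpret CP: real_distribution "compound_poisson a J"
    by (rule real_distribution_compound_poisson) fact
  \<comment> \<open>Conditioning on the number of jumps is done for bounded real functions; cosine
    and sine then give the real and imaginary parts of \<open>char\<close>.\<close>
  have real_case: "integral\<^sup>L (compound_poisson a J) g =
      (\<integral>n. integral\<^sup>L (conv_power J n) g \<partial>measure_pmf (poisson_pmf a))"
    if "g \<in> borel_measurable borel" "\<And>x. \<bar>g x\<bar> \<le> 1" for g :: "real \<Rightarrow> real"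
  proof -
    have "emeasure (conv_power J n) (space (conv_power J n)) \<le> ennreal 1" for n
    proof -
      interpret N: real_distribution "conv_power J n"
        by (rule real_distribution_conv_power) fact
      show ?thesis using N.emeasure_space_1 by simp
    qed
    then show ?thesis
      unfolding compound_poisson_def using that
      by (intro integral_bind[where K=borel and B=1 and B'=1] conv_power_kernel J
          measure_pmf.finite_measure_axioms AE_I2) auto
  qed
  have bounded: "integrable N (\<lambda>x. iexp (t * x))" if "real_distribution N" for N
  proof -
    interpret N: real_distribution N by fact
    show ?thesis by (rule N.integrable_const_bound[where B=1]) auto
  qed
  have re_im: "Re (char N t) = (\<integral>x. cos (t * x) \<partial>N)" "Im (char N t) = (\<integral>x. sin (t * x) \<partial>N)"
    if "real_distribution N" for N
    using bounded[OF that] unfolding char_def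
    by (subst integral_Re[symmetric] integral_Im[symmetric]; simp add: Re_exp Im_exp)+
  define c where "c = char J t"
  have c: "norm c \<le> 1"
    unfolding c_def using real_distribution.cmod_char_le_1[OF J] .
  have int: "integrable (measure_pmf (poisson_pmf a)) (\<lambda>n. c ^ n)"
    by (rule measure_pmf.integrable_const_bound[where B=1])
      (auto simp: norm_power c power_le_one)
  have "char (compound_poisson a J) t = (\<integral>n. c ^ n \<partial>measure_pmf (poisson_pmf a))"
  proof (rule complex_eqI)
    show "Re (char (compound_poisson a J) t) = Re (\<integral>n. c ^ n \<partial>measure_pmf (poisson_pmf a))"
      by (subst integral_Re[OF int, symmetric], subst re_im(1)[OF CP.real_distribution_axioms],
          subst real_case)
        (simp_all add: re_im(1)[OF real_distribution_conv_power[OF J], symmetric]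
          char_conv_power[OF J] c_def)
    show "Im (char (compound_poisson a J) t) = Im (\<integral>n. c ^ n \<partial>measure_pmf (poisson_pmf a))"
      by (subst integral_Im[OF int, symmetric], subst re_im(2)[OF CP.real_distribution_axioms],
          subst real_case)
        (simp_all add: re_im(2)[OF real_distribution_conv_power[OF J], symmetric]
          char_conv_power[OF J] c_def)
  qed
  also have "\<dots> = (\<integral>n. (a ^ n / fact n * exp (-a)) *\<^sub>R c ^ n \<partial>count_space UNIV)"
    unfolding measure_pmf_eq_density using a by (subst integral_density) (auto simp: )
  also have "\<dots> = exp (of_real (-a)) * exp (of_real a * c)"
  proof -
    have "(\<lambda>n. (of_real a * c) ^ n /\<^sub>R fact n) sums exp (of_real a * c)"
      by (rule exp_converges)
    from sums_mult[OF this, of "exp (of_real (-a))"]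
    have s: "(\<lambda>n. (a ^ n / fact n * exp (-a)) *\<^sub>R c ^ n) sums (exp (of_real (-a)) * exp (of_real a * c))"
      by (simp add: scaleR_conv_of_real power_mult_distrib divide_inverse exp_of_real[symmetric] mult_ac)
    have "summable (\<lambda>n. norm ((a ^ n / fact n * exp (-a)) *\<^sub>R c ^ n))"
    proof (rule summable_comparison_test')
      show "summable (\<lambda>n. a ^ n / fact n * exp (-a))"
        using exp_sums_real[of a] by (intro summable_mult2) (auto simp: sums_iff)
      show "norm (norm ((a ^ n / fact n * exp (-a)) *\<^sub>R c ^ n)) \<le> a ^ n / fact n * exp (-a)" for n
        using a power_le_one[OF norm_ge_zero c, of n]
          mult_left_le[of "cmod c ^ n" "a ^ n / fact n * exp (-a)"]
        by (simp add: norm_power norm_mult abs_mult)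
    qed
    then have "integrable (count_space UNIV) (\<lambda>n. (a ^ n / fact n * exp (-a)) *\<^sub>R c ^ n)"
      by (simp add: integrable_count_space_nat_iff)
    from sums_integral_count_space_nat[OF this] s show ?thesis
      by (rule sums_unique2)
  qed
  also have "\<dots> = exp (of_real a * (c - 1))"
    by (simp add: exp_add[symmetric] algebra_simps)
  finally show ?thesis unfolding c_def .
qed


section \<open>Infinitely divisible laws with jumps bounded above\<close>

text \<open>Only an upper bound on \<open>v\<close> is available, because jumps are cut from above
  and negative ones stay unbounded. The minimum of square and modulus matches what is integrable
  against \<nu>: the square near 0, the modulus at infinity.\<close>

lemma exp_remainder_bounds:
  fixes v c :: real
  assumes "v \<le> c" "0 \<le> c"
  shows "0 \<le> exp v - 1 - v" "exp v - 1 - v \<le> exp c * min (v\<^sup>2) \<bar>v\<bar>"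
proof -
  show nonneg: "0 \<le> exp v - 1 - v"
    using exp_ge_add_one_self[of v] by linarith
  have c1: "1 \<le> exp c" using assms by simp
  show "exp v - 1 - v \<le> exp c * min (v\<^sup>2) \<bar>v\<bar>"
  proof (cases "v \<le> 0")
    case True
    have "exp v * (1 - v) \<le> exp v * exp (-v)"
      using exp_ge_add_one_self[of "-v"] by (intro mult_left_mono) auto
    also have "\<dots> = 1" by (simp add: exp_minus)
    \<comment> \<open>The product is 1 - v^3. Cancelling the positive factor \<open>1 - v\<close>
      leaves a quadratic bound on \<open>exp v\<close> for negative \<open>v\<close>.\<close>
    also have "1 \<le> (1 + v + v\<^sup>2) * (1 - v)"
      using True by (simp add: power2_eq_square algebra_simps mult_nonpos_nonneg zero_le_mult_iff)
    finally have "exp v \<le> 1 + v + v\<^sup>2"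
      using True by (subst (asm) mult_le_cancel_right) auto
    moreover have "exp v - 1 - v \<le> \<bar>v\<bar>" using True by auto
    ultimately have "exp v - 1 - v \<le> 1 * min (v\<^sup>2) \<bar>v\<bar>" by auto
    also have "\<dots> \<le> exp c * min (v\<^sup>2) \<bar>v\<bar>" using c1 by (intro mult_right_mono) auto
    finally show ?thesis .
  next
    case False
    have "exp v * (1 - v) \<le> exp v * exp (-v)"
      using exp_ge_add_one_self[of "-v"] by (intro mult_left_mono) auto
    then have 1: "exp v - 1 \<le> v * exp v" by (simp add: exp_minus algebra_simps)
    have vc: "exp v \<le> exp c" using assms by simp
    have "exp v - 1 - v \<le> v * exp v" using 1 False by linarith
    also have "\<dots> \<le> v * exp c" using False vc by (intro mult_left_mono) auto
    finally have A: "exp v - 1 - v \<le> exp c * v" by (simp add: mult.commute)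
    have "exp v - 1 - v \<le> v * (exp v - 1)" using 1 by (simp add: algebra_simps)
    also have "\<dots> \<le> v * (v * exp v)" using 1 False by (intro mult_left_mono) auto
    also have "\<dots> \<le> v * (v * exp c)" using False vc by (intro mult_left_mono) auto
    finally have "exp v - 1 - v \<le> exp c * v\<^sup>2" by (simp add: power2_eq_square mult_ac)
    with A False show ?thesis by (auto simp: min_def)
  qed
qed

section \<open>Compensated Levy exponents and means\<close>

lemma norm_iexp_remainder_le:
  "norm (iexp (u * y) - 1 - \<i> * of_real (u * y)) \<le> (u\<^sup>2 + 2 * \<bar>u\<bar>) * min \<bar>y\<bar> (y\<^sup>2)"
proof -
  have 1: "norm (iexp (u * y) - 1 - \<i> * of_real (u * y)) \<le> \<bar>u * y\<bar>\<^sup>2 / 2"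
    using iexp_approx1[of "u * y" 1] by (simp add: algebra_simps power2_eq_square)
  have 2: "norm (iexp (u * y) - 1 - \<i> * of_real (u * y)) \<le> 2 * \<bar>u * y\<bar>"
    using iexp_approx2[of "u * y" 1] by (simp add: algebra_simps)
  have "\<bar>u * y\<bar>\<^sup>2 / 2 \<le> u\<^sup>2 * y\<^sup>2" by (simp add: power_mult_distrib)
  with 1 have 1: "norm (iexp (u * y) - 1 - \<i> * of_real (u * y)) \<le> u\<^sup>2 * y\<^sup>2" by linarith
  show ?thesis
  proof (cases "\<bar>y\<bar> \<le> y\<^sup>2")
    case True
    then show ?thesis using 2 by (simp add: min_def abs_mult algebra_simps add_increasing)
  next
    case False
    then show ?thesis using 1 by (simp add: min_def abs_mult algebra_simps add_increasing2)
  qed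
qed

text \<open>The compensator is \<open>u * y\<close> on the whole line instead of on [-1, 1]. When
  the large jumps have a first moment, this is the exponent of a centred law, so zero mean becomes
  the absence of a drift term.\<close>

definition levy_exponent :: "real \<Rightarrow> real measure \<Rightarrow> real \<Rightarrow> complex" where
  "levy_exponent \<sigma> \<nu> u =
     (CLINT y|\<nu>. iexp (u * y) - 1 - \<i> * of_real (u * y)) - of_real (\<sigma>\<^sup>2 * u\<^sup>2 / 2)"

text \<open>Formally \<open>levy_exponent\<close> at the imaginary argument -i l, that is, the
  logarithm of the moment generating function at time 1.\<close>

definition exp_cumulant :: "real \<Rightarrow> real measure \<Rightarrow> real \<Rightarrow> real" where
  "exp_cumulant \<sigma> \<nu> l = (LINT y|\<nu>. exp (l * y) - 1 - l * y) + \<sigma>\<^sup>2 * l\<^sup>2 / 2"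

lemma integrable_iexp_remainder:
  assumes [measurable_cong]: "sets \<nu> = sets borel" and int: "integrable \<nu> (\<lambda>y. min \<bar>y\<bar> (y\<^sup>2))"
  shows "integrable \<nu> (\<lambda>y. iexp (u * y) - 1 - \<i> * of_real (u * y))"
proof (rule Bochner_Integration.integrable_bound)
  show "integrable \<nu> (\<lambda>y. (u\<^sup>2 + 2 * \<bar>u\<bar>) * min \<bar>y\<bar> (y\<^sup>2))"
    using int by simp
  show "AE y in \<nu>. norm (iexp (u * y) - 1 - \<i> * of_real (u * y)) \<le>
      norm ((u\<^sup>2 + 2 * \<bar>u\<bar>) * min \<bar>y\<bar> (y\<^sup>2))"
    by (intro AE_I2 order.trans[OF norm_iexp_remainder_le]) (auto simp: abs_mult)
qed measurable

lemma integrable_exp_remainder: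
  fixes \<nu> :: "real measure"
  assumes [measurable_cong]: "sets \<nu> = sets borel" and int: "integrable \<nu> (\<lambda>y. min \<bar>y\<bar> (y\<^sup>2))"
    and AE: "AE y in \<nu>. y \<le> h" and "0 \<le> l"
  shows "integrable \<nu> (\<lambda>y. exp (l * y) - 1 - l * y)"
proof (rule Bochner_Integration.integrable_bound)
  show "integrable \<nu> (\<lambda>y. exp (l * \<bar>h\<bar>) * (l\<^sup>2 + l) * min \<bar>y\<bar> (y\<^sup>2))"
    using int by simp
  show "AE y in \<nu>. norm (exp (l * y) - 1 - l * y) \<le>
      norm (exp (l * \<bar>h\<bar>) * (l\<^sup>2 + l) * min \<bar>y\<bar> (y\<^sup>2))"
    using AE
  proof eventually_elim
    fix y assume "y \<le> h"
    then have *: "l * y \<le> l * \<bar>h\<bar>" "0 \<le> l * \<bar>h\<bar>"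
      using \<open>0 \<le> l\<close> mult_left_mono[of y "\<bar>h\<bar>" l] by auto
    have "norm (exp (l * y) - 1 - l * y) \<le> exp (l * \<bar>h\<bar>) * min ((l * y)\<^sup>2) \<bar>l * y\<bar>"
      using exp_remainder_bounds[OF *] by simp
    also have "min ((l * y)\<^sup>2) \<bar>l * y\<bar> \<le> (l\<^sup>2 + l) * min \<bar>y\<bar> (y\<^sup>2)"
      using \<open>0 \<le> l\<close> by (auto simp: min_def abs_mult power_mult_distrib distrib_right
          add_increasing add_increasing2)
    finally show "norm (exp (l * y) - 1 - l * y) \<le>
      norm (exp (l * \<bar>h\<bar>) * (l\<^sup>2 + l) * min \<bar>y\<bar> (y\<^sup>2))"
      using \<open>0 \<le> l\<close> by (simp add: abs_mult mult.assoc)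
  qed
qed measurable

text \<open>For each jump size the compensated integrand is quadratic in the frequency, so the
  exponent has derivative 0 at 0. The frequencies 1/n are enough to compute a mean.\<close>

lemma levy_exponent_small:
  assumes [measurable_cong]: "sets \<nu> = sets borel" and int: "integrable \<nu> (\<lambda>y. min \<bar>y\<bar> (y\<^sup>2))"
  shows "(\<lambda>n. of_nat (Suc n) * levy_exponent \<sigma> \<nu> (1 / real (Suc n))) \<longlonglongrightarrow> 0"
proof -
  have i: "(\<lambda>n. \<integral>y. of_nat (Suc n) * (iexp (1 / real (Suc n) * y) - 1 - \<i> * of_real (1 / real (Suc n) * y)) \<partial>\<nu>)
    \<longlonglongrightarrow> (\<integral>y. 0 \<partial>\<nu>)"
  proof (rule integral_dominated_convergence[where w="\<lambda>y. 3 * min \<bar>y\<bar> (y\<^sup>2)"])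
    show "integrable \<nu> (\<lambda>y. 3 * min \<bar>y\<bar> (y\<^sup>2))" using int by simp
    show "AE y in \<nu>. (\<lambda>n. of_nat (Suc n) * (iexp (1 / real (Suc n) * y) - 1 - \<i> * of_real (1 / real (Suc n) * y)))
      \<longlonglongrightarrow> 0"
    proof (rule AE_I2)
      fix y
      have b: "norm (of_nat (Suc n) * (iexp (1 / real (Suc n) * y) - 1 - \<i> * of_real (1 / real (Suc n) * y)))
        \<le> y\<^sup>2 / 2 * (1 / real (Suc n))" for n
      proof -
        define r where "r = real (Suc n)"
        have r: "r > 0" "cmod (of_nat (Suc n)) = r" unfolding r_def by (simp, simp only: norm_of_nat)
        have "norm (iexp (1 / r * y) - 1 - \<i> * of_real (1 / r * y)) \<le> \<bar>1 / r * y\<bar>\<^sup>2 / 2"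
          using iexp_approx1[of "1 / r * y" 1] by (simp add: algebra_simps power2_eq_square)
        then have "r * norm (iexp (1 / r * y) - 1 - \<i> * of_real (1 / r * y)) \<le> r * (\<bar>1 / r * y\<bar>\<^sup>2 / 2)"
          using r by (intro mult_left_mono) auto
        also have "\<dots> = y\<^sup>2 / 2 * (1 / r)" using r by (simp add: power2_eq_square field_simps)
        finally show ?thesis unfolding norm_mult r(2) unfolding r_def .
      qed
      have "(\<lambda>n. y\<^sup>2 / 2 * (1 / real (Suc n))) \<longlonglongrightarrow> y\<^sup>2 / 2 * 0"
        by (intro tendsto_mult_left LIMSEQ_Suc[OF lim_1_over_n])
      then show "(\<lambda>n. of_nat (Suc n) * (iexp (1 / real (Suc n) * y) - 1 - \<i> * of_real (1 / real (Suc n) * y)))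
      \<longlonglongrightarrow> 0"
        by (intro Lim_null_comparison[OF always_eventually[OF allI[OF b]]]) simp
    qed
    show "AE y in \<nu>. norm (of_nat (Suc n) * (iexp (1 / real (Suc n) * y) - 1 - \<i> * of_real (1 / real (Suc n) * y)))
        \<le> 3 * min \<bar>y\<bar> (y\<^sup>2)" for n
    proof (rule AE_I2)
      fix y
      define r where "r = real (Suc n)"
      have r: "r \<ge> 1" "cmod (of_nat (Suc n)) = r" unfolding r_def by (simp, simp only: norm_of_nat)
      have "r * norm (iexp (1 / r * y) - 1 - \<i> * of_real (1 / r * y)) \<le> r * (((1 / r)\<^sup>2 + 2 * \<bar>1 / r\<bar>) * min \<bar>y\<bar> (y\<^sup>2))"
        using r by (intro mult_left_mono norm_iexp_remainder_le) auto
      also have "\<dots> = (1 / r + 2) * min \<bar>y\<bar> (y\<^sup>2)"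
        using r by (simp add: power2_eq_square field_simps)
      also have "\<dots> \<le> 3 * min \<bar>y\<bar> (y\<^sup>2)"
        using r by (intro mult_right_mono) (auto simp: divide_simps)
      finally show "norm (of_nat (Suc n) * (iexp (1 / real (Suc n) * y) - 1 - \<i> * of_real (1 / real (Suc n) * y)))
        \<le> 3 * min \<bar>y\<bar> (y\<^sup>2)"
        unfolding norm_mult r(2) unfolding r_def .
    qed
  qed measurable
  have "(\<lambda>n. (\<integral>y. of_nat (Suc n) * (iexp (1 / real (Suc n) * y) - 1 - \<i> * of_real (1 / real (Suc n) * y)) \<partial>\<nu>)
      - of_real (\<sigma>\<^sup>2 / 2 * (1 / real (Suc n)))) \<longlonglongrightarrow> 0 - of_real (\<sigma>\<^sup>2 / 2 * 0)"
    using i by (intro tendsto_diff tendsto_of_real tendsto_mult_left LIMSEQ_Suc[OF lim_1_over_n]) simp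
  also have "(\<lambda>n. (\<integral>y. of_nat (Suc n) * (iexp (1 / real (Suc n) * y) - 1 - \<i> * of_real (1 / real (Suc n) * y)) \<partial>\<nu>)
      - of_real (\<sigma>\<^sup>2 / 2 * (1 / real (Suc n)))) = (\<lambda>n. of_nat (Suc n) * levy_exponent \<sigma> \<nu> (1 / real (Suc n)))"
  proof
    fix n
    define r where "r = real (Suc n)"
    have r: "r > 0" "complex_of_nat (Suc n) = of_real r" unfolding r_def by (simp, simp only: of_real_of_nat_eq)
    show "(\<integral>y. of_nat (Suc n) * (iexp (1 / real (Suc n) * y) - 1 - \<i> * of_real (1 / real (Suc n) * y)) \<partial>\<nu>)
      - of_real (\<sigma>\<^sup>2 / 2 * (1 / real (Suc n))) = of_nat (Suc n) * levy_exponent \<sigma> \<nu> (1 / real (Suc n))"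
      unfolding levy_exponent_def right_diff_distrib[of "of_nat (Suc n)" "CLINT y|\<nu>. f y" for f]
        integral_mult_right_zero r(2) r_def[symmetric]
      using r by (simp add: power2_eq_square field_simps)
  qed
  finally show ?thesis by simp
qed

text \<open>The difference quotient of \<open>exp\<close> at 0, extended by the value 1, is
  continuous; the extension covers the indices where \<open>w n\<close> vanishes.\<close>

lemma exp_minus_one_limit:
  fixes w :: "nat \<Rightarrow> complex"
  assumes "(\<lambda>n. of_nat (Suc n) * w n) \<longlonglongrightarrow> \<beta>"
  shows "(\<lambda>n. of_nat (Suc n) * (exp (w n) - 1)) \<longlonglongrightarrow> \<beta>"
proof -
  have "(\<lambda>n. of_real (1 / real (Suc n)) * (of_nat (Suc n) * w n)) \<longlonglongrightarrow> of_real 0 * \<beta>"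
    by (intro tendsto_mult tendsto_of_real LIMSEQ_Suc[OF lim_1_over_n] assms)
  also have "(\<lambda>n. of_real (1 / real (Suc n)) * (of_nat (Suc n) * w n)) = w"
  proof
    fix n
    define r where "r = real (Suc n)"
    have r: "r > 0" "complex_of_nat (Suc n) = of_real r" unfolding r_def by (simp, simp only: of_real_of_nat_eq)
    show "of_real (1 / real (Suc n)) * (of_nat (Suc n) * w n) = w n"
      unfolding r(2) r_def[symmetric] using r by simp
  qed
  finally have w0: "w \<longlonglongrightarrow> 0" by simp
  define g where "g z = (if z = 0 then 1 else (exp z - 1) / z)" for z :: complex
  have "(\<lambda>h. (exp (0 + h) - exp 0) / h) \<midarrow>0\<rightarrow> exp (0::complex)"
    using DERIV_exp[of "0::complex"] by (simp add: DERIV_def)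
  then have "(\<lambda>h. (exp (0 + h) - exp 0) / h) \<midarrow>0\<rightarrow> (1::complex)" by simp
  then have "g \<midarrow>0\<rightarrow> 1"
    by (rule Lim_transform_eventually) (auto simp: g_def eventually_at intro!: exI[of _ 1])
  then have "isCont g 0" by (simp add: isCont_def g_def)
  then have "(\<lambda>n. g (w n)) \<longlonglongrightarrow> g 0" using w0 by (rule isCont_tendsto_compose)
  then have "(\<lambda>n. of_nat (Suc n) * w n * g (w n)) \<longlonglongrightarrow> \<beta> * 1"
    using assms by (intro tendsto_mult) (auto simp: g_def)
  also have "(\<lambda>n. of_nat (Suc n) * w n * g (w n)) = (\<lambda>n. of_nat (Suc n) * (exp (w n) - 1))"
    by (auto simp: g_def fun_eq_iff)
  finally show ?thesis by simp
qed

lemma (in real_distribution) mean_from_char: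
  assumes int: "integrable M (\<lambda>x. x)"
  shows "(\<lambda>n. of_nat (Suc n) * (char M (1 / real (Suc n)) - 1)) \<longlonglongrightarrow> \<i> * of_real (\<integral>x. x \<partial>M)"
proof -
  have r: "real (Suc n) > 0" "complex_of_nat (Suc n) = of_real (real (Suc n))" for n
    by (simp, simp only: of_real_of_nat_eq)
  have "(\<lambda>n. \<integral>x. of_nat (Suc n) * (iexp (1 / real (Suc n) * x) - 1) \<partial>M) \<longlonglongrightarrow> (\<integral>x. \<i> * of_real x \<partial>M)"
  proof (rule integral_dominated_convergence[where w="\<lambda>x. \<bar>x\<bar>"])
    show "integrable M (\<lambda>x. \<bar>x\<bar>)" using int by simp
    show "AE x in M. (\<lambda>n. of_nat (Suc n) * (iexp (1 / real (Suc n) * x) - 1)) \<longlonglongrightarrow> \<i> * of_real x"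
    proof (intro AE_I2 exp_minus_one_limit)
      fix x
      have "of_nat (Suc n) * (\<i> * of_real (1 / real (Suc n) * x)) = \<i> * of_real x" for n
        unfolding r(2) using r(1)[of n] by (simp del: of_nat_Suc)
      then show "(\<lambda>n. of_nat (Suc n) * (\<i> * of_real (1 / real (Suc n) * x))) \<longlonglongrightarrow> \<i> * of_real x"
        by (simp del: of_nat_Suc)
    qed
    show "AE x in M. norm (of_nat (Suc n) * (iexp (1 / real (Suc n) * x) - 1)) \<le> \<bar>x\<bar>" for n
    proof (rule AE_I2)
      fix x
      have iexp_minus_one: "norm (iexp v - 1) \<le> \<bar>v\<bar>" for v
        using iexp_approx1[of v 0] by simp
      have "norm (iexp (1 / real (Suc n) * x) - 1) \<le> \<bar>1 / real (Suc n) * x\<bar>"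
        by (rule iexp_minus_one)
      then have "real (Suc n) * norm (iexp (1 / real (Suc n) * x) - 1) \<le> real (Suc n) * \<bar>1 / real (Suc n) * x\<bar>"
        by (intro mult_left_mono) auto
      also have "\<dots> = \<bar>x\<bar>" using r(1)[of n] by (simp add: abs_mult del: of_nat_Suc)
      finally show "norm (of_nat (Suc n) * (iexp (1 / real (Suc n) * x) - 1)) \<le> \<bar>x\<bar>"
        unfolding norm_mult r(2) by (simp del: of_nat_Suc)
    qed
  qed (auto simp del: of_nat_Suc)
  also have "(\<integral>x. \<i> * of_real x \<partial>M) = \<i> * of_real (\<integral>x. x \<partial>M)" by simp
  also have "(\<lambda>n. \<integral>x. of_nat (Suc n) * (iexp (1 / real (Suc n) * x) - 1) \<partial>M) =
      (\<lambda>n. of_nat (Suc n) * (char M (1 / real (Suc n)) - 1))"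
  proof
    fix n
    have "integrable M (\<lambda>x. iexp (1 / real (Suc n) * x))"
      by (rule integrable_const_bound[where B=1]) (auto simp del: of_nat_Suc)
    then show "(\<integral>x. of_nat (Suc n) * (iexp (1 / real (Suc n) * x) - 1) \<partial>M) =
       of_nat (Suc n) * (char M (1 / real (Suc n)) - 1)"
      unfolding char_def integral_mult_right_zero
      by (subst Bochner_Integration.integral_diff) (auto simp: prob_space simp del: of_nat_Suc space_eq_univ)
  qed
  finally show ?thesis .
qed

text \<open>Both sides are differentiated at 0 along the frequencies 1/n: the law yields i times its
  mean, the exponent i times the drift. No logarithm of \<open>char\<close> has to be
  chosen.\<close>

lemma (in real_distribution) mean_of_levy_exponent:
  assumes int: "integrable M (\<lambda>x. x)" and "sets \<nu> = sets borel" "integrable \<nu> (\<lambda>y. min \<bar>y\<bar> (y\<^sup>2))"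
    and char: "\<And>u. char M u = exp (\<i> * of_real (\<beta> * u) + of_real s * levy_exponent \<sigma> \<nu> u)"
  shows "(\<integral>x. x \<partial>M) = \<beta>"
proof -
  have r: "real (Suc n) > 0" "complex_of_nat (Suc n) = of_real (real (Suc n))" for n
    by (simp, simp only: of_real_of_nat_eq)
  have "(\<lambda>n. \<i> * of_real \<beta> + of_real s * (of_nat (Suc n) * levy_exponent \<sigma> \<nu> (1 / real (Suc n))))
    \<longlonglongrightarrow> \<i> * of_real \<beta> + of_real s * 0"
    by (intro tendsto_intros levy_exponent_small assms)
  also have "(\<lambda>n. \<i> * of_real \<beta> + of_real s * (of_nat (Suc n) * levy_exponent \<sigma> \<nu> (1 / real (Suc n)))) =
     (\<lambda>n. of_nat (Suc n) * (\<i> * of_real (\<beta> * (1 / real (Suc n))) + of_real s * levy_exponent \<sigma> \<nu> (1 / real (Suc n))))"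
    unfolding r(2) using r(1) by (auto simp: fun_eq_iff distrib_left simp del: of_nat_Suc)
  finally have "(\<lambda>n. of_nat (Suc n) * (char M (1 / real (Suc n)) - 1)) \<longlonglongrightarrow> \<i> * of_real \<beta>"
    unfolding char by (intro exp_minus_one_limit) (simp del: of_nat_Suc)
  from LIMSEQ_unique[OF this mean_from_char[OF int]] show ?thesis by simp
qed


text \<open>A scaled standard normal law rather than a density, so that \<open>\<tau> = 0\<close>
  gives the point mass at 0.\<close>

definition gaussian :: "real \<Rightarrow> real measure" where
  "gaussian \<tau> = distr std_normal_distribution borel (\<lambda>x. \<tau> * x)"

lemma real_distribution_gaussian: "real_distribution (gaussian \<tau>)"
proof -
  interpret real_distribution std_normal_distribution by (rule real_dist_normal_dist)
  show ?thesis unfolding gaussian_def by (intro real_distribution_distr) measurable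
qed

lemma char_gaussian: "char (gaussian \<tau>) u = exp (- of_real (\<tau>\<^sup>2 * u\<^sup>2 / 2))"
proof -
  have "char (gaussian \<tau>) u = char std_normal_distribution (u * \<tau>)"
    unfolding gaussian_def char_def by (subst integral_distr) (auto simp: mult.assoc)
  then show ?thesis
    by (simp add: char_std_normal_distribution power_mult_distrib mult.commute
        flip: exp_of_real)
qed

lemma nn_integral_exp_gaussian:
  "(\<integral>\<^sup>+x. ennreal (exp (l * x)) \<partial>gaussian \<tau>) = ennreal (exp (\<tau>\<^sup>2 * l\<^sup>2 / 2))"
proof -
  define k where "k = l * \<tau>"
  \<comment> \<open>Completing the square: the tilted density is, up to a constant, the normal
    density with mean \<open>k\<close>.\<close>
  have *: "std_normal_density x * exp (k * x) = exp (k\<^sup>2 / 2) * normal_density k 1 x" for x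
    by (simp add: normal_density_def exp_add[symmetric] power2_eq_square field_simps)
  have "(\<integral>\<^sup>+x. ennreal (exp (l * x)) \<partial>gaussian \<tau>) =
      (\<integral>\<^sup>+x. ennreal (exp (l * (\<tau> * x))) \<partial>std_normal_distribution)"
    unfolding gaussian_def by (subst nn_integral_distr) auto
  also have "\<dots> = (\<integral>\<^sup>+x. ennreal (std_normal_density x) * ennreal (exp (k * x)) \<partial>lborel)"
    by (subst nn_integral_density) (auto simp: k_def mult.assoc)
  also have "\<dots> = (\<integral>\<^sup>+x. ennreal (exp (k\<^sup>2 / 2)) * ennreal (normal_density k 1 x) \<partial>lborel)"
    by (simp add: ennreal_mult[symmetric] * del: std_normal_density_def)
  also have "\<dots> = ennreal (exp (k\<^sup>2 / 2)) * emeasure (density lborel (normal_density k 1)) UNIV"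
    by (subst nn_integral_cmult) (auto simp: emeasure_density)
  also have "emeasure (density lborel (normal_density k 1)) UNIV = 1"
    using prob_space.emeasure_space_1[OF prob_space_normal_density[of 1 k]] by simp
  finally show ?thesis by (simp add: k_def power_mult_distrib mult.commute)
qed

section \<open>Laws with a finite jump measure of bounded support\<close>

lemma integrable_exp_of_bounded:
  fixes m :: "real measure"
  assumes sets[measurable_cong]: "sets m = sets borel" and fin: "finite_measure m"
    and bdd: "AE y in m. \<bar>y\<bar> \<le> R"
  shows "integrable m (\<lambda>y. exp (l * y))"
proof -
  interpret finite_measure m by fact
  show ?thesis
  proof (rule integrable_const_bound[where B="exp (\<bar>l\<bar> * R)"])
    show "AE y in m. norm (exp (l * y)) \<le> exp (\<bar>l\<bar> * R)"
      using bdd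
    proof eventually_elim
      fix y assume "\<bar>y\<bar> \<le> R"
      then have "\<bar>l * y\<bar> \<le> \<bar>l\<bar> * R" by (simp add: abs_mult mult_left_mono)
      then show "norm (exp (l * y)) \<le> exp (\<bar>l\<bar> * R)" by simp
    qed
  qed measurable
qed

lemma compound_poisson_of_finite_measure:
  assumes sets: "sets m = sets borel" and fin: "finite_measure m" and bdd: "AE y in m. \<bar>y\<bar> \<le> R"
  shows "\<exists>C. real_distribution C \<and> (\<forall>u. char C u = exp (CLINT y|m. iexp (u * y) - 1)) \<and>
    (\<forall>l. (\<integral>\<^sup>+z. ennreal (exp (l * z)) \<partial>C) = ennreal (exp (LINT y|m. exp (l * y) - 1)))"
proof -
  interpret finite_measure m by fact
  note sets[measurable_cong]
  have space: "space m = UNIV" using sets_eq_imp_space_eq[OF sets] by simp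
  define a where "a = measure m UNIV"
  have iexp: "integrable m (\<lambda>y. iexp (u * y))" for u
    by (rule integrable_const_bound[where B=1]) auto
  have rexp: "integrable m (\<lambda>y. exp (l * y))" for l
    by (rule integrable_exp_of_bounded[OF sets fin bdd])
  show ?thesis
  \<comment> \<open>A null jump measure cannot be normalised to a jump law; its compound Poisson law
    is the point mass at 0.\<close>
  proof (cases "a = 0")
    case True
    then have "emeasure m (space m) = 0" by (simp add: a_def emeasure_eq_measure space)
    then have null: "AE y in m. False"
      by (intro AE_I[where N="space m"]) auto
    have "(CLINT y|m. iexp (u * y) - 1) = (CLINT y|m. 0)" for u
      by (intro integral_cong_AE eventually_mono[OF null]) simp_all
    moreover have "(LINT y|m. exp (l * y) - 1) = (LINT y|m. 0)" for l :: real
      by (intro integral_cong_AE eventually_mono[OF null]) simp_all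
    ultimately show ?thesis
      by (intro exI[of _ "return borel 0"])
        (auto simp: real_distribution_return char_return nn_integral_return)
  next
    case False
    then have a: "a > 0" by (simp add: a_def zero_less_measure_iff measure_eq_0_null_sets order.not_eq_order_implies_strict)
    define J where "J = density m (\<lambda>_. ennreal (1 / a))"
    have J: "real_distribution J"
    proof (rule real_distributionI)
      have "emeasure J (space J) = ennreal (1 / a) * ennreal a"
        by (simp add: J_def emeasure_density space nn_integral_cmult emeasure_eq_measure a_def)
      also have "\<dots> = 1" using a by (simp add: ennreal_mult[symmetric])
      finally show "prob_space J" by (rule prob_spaceI)
    qed (simp add: J_def sets)
    have intJ: "integral\<^sup>L J f = (1 / a) *\<^sub>R integral\<^sup>L m f"
      if [measurable]: "f \<in> borel_measurable borel" for f :: "real \<Rightarrow> 'b::{banach, second_countable_topology}"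
      unfolding J_def by (subst integral_density) (use a in auto)
    have "char (compound_poisson a J) u = exp (CLINT y|m. iexp (u * y) - 1)" for u
    proof -
      have "of_real a * (char J u - 1) = (CLINT y|m. iexp (u * y)) - of_real a"
        using a by (simp add: char_def intJ scaleR_conv_of_real algebra_simps)
      also have "\<dots> = (CLINT y|m. iexp (u * y) - 1)"
        by (subst Bochner_Integration.integral_diff[OF iexp]) (auto simp: a_def space scaleR_conv_of_real)
      finally show ?thesis by (simp add: char_compound_poisson[OF a J])
    qed
    moreover have "(\<integral>\<^sup>+z. ennreal (exp (l * z)) \<partial>compound_poisson a J) = ennreal (exp (LINT y|m. exp (l * y) - 1))" for l
    proof -
      have "integrable J (\<lambda>y. exp (l * y))"
        unfolding J_def by (subst integrable_density) (use a rexp[of l] in auto)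
      then have "(\<integral>\<^sup>+z. ennreal (exp (l * z)) \<partial>J) = ennreal (LINT y|J. exp (l * y))"
        by (intro nn_integral_eq_integral) auto
      then have "(\<integral>\<^sup>+z. ennreal (exp (l * z)) \<partial>compound_poisson a J) =
          ennreal (exp (a * ((LINT y|J. exp (l * y)) - 1)))"
        by (intro nn_integral_exp_compound_poisson a J) (auto intro!: integral_nonneg_AE)
      also have "a * ((LINT y|J. exp (l * y)) - 1) = (LINT y|m. exp (l * y)) - a"
        using a by (simp add: intJ algebra_simps)
      also have "\<dots> = (LINT y|m. exp (l * y) - 1)"
        by (subst Bochner_Integration.integral_diff[OF rexp]) (auto simp: a_def space)
      finally show ?thesis .
    qed
    ultimately show ?thesis using real_distribution_compound_poisson[OF J] by blast
  qed
qed

text \<open>A shift of the compound Poisson law by the mean of the jumps supplies the compensator,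
  and convolution with a normal law the quadratic term.\<close>

lemma finite_jump_law:
  assumes sets: "sets m = sets borel" and fin: "finite_measure m" and bdd: "AE y in m. \<bar>y\<bar> \<le> R"
  shows "\<exists>Z. real_distribution Z \<and> (\<forall>u. char Z u = exp (levy_exponent \<tau> m u)) \<and>
    (\<forall>l. (\<integral>\<^sup>+z. ennreal (exp (l * z)) \<partial>Z) = ennreal (exp (exp_cumulant \<tau> m l)))"
proof -
  interpret finite_measure m by fact
  note sets[measurable_cong]
  obtain C where C: "real_distribution C" "\<And>u. char C u = exp (CLINT y|m. iexp (u * y) - 1)"
    "\<And>l. (\<integral>\<^sup>+z. ennreal (exp (l * z)) \<partial>C) = ennreal (exp (LINT y|m. exp (l * y) - 1))"
    using compound_poisson_of_finite_measure[OF assms] by auto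
  have iexp: "integrable m (\<lambda>y. iexp (u * y))" for u
    by (rule integrable_const_bound[where B=1]) auto
  have rexp: "integrable m (\<lambda>y. exp (l * y))" for l
    by (rule integrable_exp_of_bounded[OF sets fin bdd])
  have lin: "integrable m (\<lambda>y. y)"
    using bdd by (intro integrable_const_bound[where B=R]) auto
  define c where "c = (LINT y|m. y)"
  define Z where "Z = (gaussian \<tau> \<star> (C \<star> return borel (-c)))"
  have CR: "real_distribution (C \<star> return borel (-c))"
    by (intro real_distribution_convolution C real_distribution_return)
  have "char Z u = exp (levy_exponent \<tau> m u)" for u
  proof -
    have "char Z u = exp ((CLINT y|m. iexp (u * y) - 1) - \<i> * of_real (u * c) - of_real (\<tau>\<^sup>2 * u\<^sup>2 / 2))"
      unfolding Z_def char_convolution[OF real_distribution_gaussian CR]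
        char_convolution[OF C(1) real_distribution_return] char_gaussian C(2) char_return
      by (simp add: exp_add[symmetric] algebra_simps)
    also have "(CLINT y|m. iexp (u * y) - 1) - \<i> * of_real (u * c) =
      (CLINT y|m. iexp (u * y) - 1 - \<i> * of_real (u * y))"
    proof -
      have "(CLINT y|m. iexp (u * y) - 1 - \<i> * of_real (u * y)) =
          (CLINT y|m. iexp (u * y) - 1) - (CLINT y|m. \<i> * of_real (u * y))"
        using lin iexp[of u] by (intro Bochner_Integration.integral_diff) auto
      also have "(CLINT y|m. \<i> * of_real (u * y)) = \<i> * of_real (LINT y|m. u * y)"
        by (subst integral_mult_right_zero) (simp only: integral_complex_of_real)
      finally show ?thesis by (simp add: c_def)
    qed
    finally show ?thesis by (simp add: levy_exponent_def)
  qed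
  moreover have "(\<integral>\<^sup>+z. ennreal (exp (l * z)) \<partial>Z) = ennreal (exp (exp_cumulant \<tau> m l))" for l
  proof -
    have "(\<integral>\<^sup>+z. ennreal (exp (l * z)) \<partial>Z) =
        ennreal (exp ((LINT y|m. exp (l * y) - 1) - l * c + \<tau>\<^sup>2 * l\<^sup>2 / 2))"
      unfolding Z_def nn_integral_exp_convolution[OF real_distribution_gaussian CR]
        nn_integral_exp_convolution[OF C(1) real_distribution_return] nn_integral_exp_gaussian C(3)
      by (simp add: nn_integral_return ennreal_mult[symmetric] exp_add[symmetric] algebra_simps)
    also have "(LINT y|m. exp (l * y) - 1) - l * c = (LINT y|m. exp (l * y) - 1 - l * y)"
      using lin rexp[of l] by (subst Bochner_Integration.integral_diff) (auto simp: c_def)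
    finally show ?thesis by (simp add: exp_cumulant_def)
  qed
  moreover have "real_distribution Z"
    unfolding Z_def by (intro real_distribution_convolution CR real_distribution_gaussian)
  ultimately show ?thesis by blast
qed

text \<open>The remainder of the exponential has a moment that vanishes linearly in time once
  \<open>L\<close> is the exponential of a cumulant. The first absolute moment bounds the left tail,
  for which no exponential moment survives the later weak limit.\<close>

lemma (in real_distribution) moments_of_mean_zero:
  assumes E: "\<And>l. (\<integral>\<^sup>+z. ennreal (exp (l * z)) \<partial>M) = ennreal (L l)" "\<And>l. 0 \<le> L l"
    and mean: "integrable M (\<lambda>z. z) \<Longrightarrow> (LINT z|M. z) = 0" and l: "0 < l"
  shows "(\<integral>\<^sup>+z. ennreal (exp (l * z) - 1 - l * z) \<partial>M) = ennreal (L l - 1)"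
    and "(\<integral>\<^sup>+z. ennreal \<bar>z\<bar> \<partial>M) \<le> ennreal (2 / l * L l)"
proof -
  have rexp: "integrable M (\<lambda>z. exp (k * z))" for k
    by (rule integrableI_nonneg) (auto simp: E)
  have Eexp: "(LINT z|M. exp (k * z)) = L k" for k
    using E by (intro integral_eq_nn_integral[THEN trans]) (auto simp: E)
  have lin: "integrable M (\<lambda>z. z)"
  proof (rule Bochner_Integration.integrable_bound)
    show "integrable M (\<lambda>z. exp (1 * z) + exp ((-1) * z))" by (intro Bochner_Integration.integrable_add rexp)
    have "\<bar>z\<bar> \<le> exp z + exp (-z)" for z :: real
    proof (cases "z \<ge> 0")
      case True
      have "z \<le> exp z" "0 < exp (-z)" using exp_ge_add_one_self[of z] by linarith simp
      with True show ?thesis by linarith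
    next
      case False
      have "-z \<le> exp (-z)" "0 < exp z" using exp_ge_add_one_self[of "-z"] by linarith simp
      with False show ?thesis by linarith
    qed
    then show "AE z in M. norm z \<le> norm (exp (1 * z) + exp ((-1) * z))" by simp
  qed auto
  note m0 = mean[OF lin]
  have "(\<integral>\<^sup>+z. ennreal (exp (l * z) - 1 - l * z) \<partial>M) = ennreal (LINT z|M. exp (l * z) - 1 - l * z)"
    using exp_ge_add_one_self[of "l * z" for z] lin rexp[of l]
    by (intro nn_integral_eq_integral) (auto simp: algebra_simps)
  also have "(LINT z|M. exp (l * z) - 1 - l * z) = L l - 1"
    using lin rexp[of l] by (simp add: Eexp m0 prob_space del: space_eq_univ)
  finally show "(\<integral>\<^sup>+z. ennreal (exp (l * z) - 1 - l * z) \<partial>M) = ennreal (L l - 1)" .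
  have "(\<integral>\<^sup>+z. ennreal \<bar>z\<bar> \<partial>M) = ennreal (LINT z|M. \<bar>z\<bar>)"
    using lin by (intro nn_integral_eq_integral) auto
  \<comment> \<open>Adding the vanishing mean replaces the modulus by twice the positive part, which
    the exponential moment at a positive rate dominates.\<close>
  also have "(LINT z|M. \<bar>z\<bar>) = (LINT z|M. \<bar>z\<bar> + z)" using lin by (simp add: m0)
  also have "\<dots> \<le> (LINT z|M. 2 / l * exp (l * z))"
  proof (rule integral_mono)
    show "integrable M (\<lambda>z. \<bar>z\<bar> + z)" "integrable M (\<lambda>z. 2 / l * exp (l * z))"
      using lin rexp[of l] by auto
    show "\<bar>z\<bar> + z \<le> 2 / l * exp (l * z)" for z
    proof (cases "z \<ge> 0")
      case True
      have "l * z \<le> exp (l * z)" using exp_ge_add_one_self[of "l * z"] by linarith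
      with True l show ?thesis by (simp add: field_simps)
    next
      case False
      then show ?thesis using l by (simp add: less_imp_le)
    qed
  qed
  also have "\<dots> = 2 / l * L l" by (simp add: Eexp)
  finally show "(\<integral>\<^sup>+z. ennreal \<bar>z\<bar> \<partial>M) \<le> ennreal (2 / l * L l)" by (simp add: ennreal_leI)
qed

section \<open>Infinite jump measures by weak limits\<close>

lemma weak_conv_nn_integral_le:
  fixes \<phi> :: "real \<Rightarrow> real"
  assumes M: "\<And>n. real_distribution (M n)" "real_distribution Z" and conv: "weak_conv_m M Z"
    and \<phi>: "continuous_on UNIV \<phi>" "\<And>z. 0 \<le> \<phi> z"
    and le: "\<And>n. (\<integral>\<^sup>+z. ennreal (\<phi> z) \<partial>M n) \<le> ennreal C" and "0 \<le> C"
  shows "(\<integral>\<^sup>+z. ennreal (\<phi> z) \<partial>Z) \<le> ennreal C"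
proof -
  interpret Z: real_distribution Z by fact
  have [measurable]: "\<phi> \<in> borel_measurable borel" using \<phi>(1) by (rule borel_measurable_continuous_onI)
  \<comment> \<open>Weak convergence speaks about bounded continuous functions; the cut-off at
    \<open>k\<close> is removed by monotone convergence, so an upper bound survives where an
    equality need not.\<close>
  have trunc: "(\<integral>\<^sup>+z. ennreal (min (\<phi> z) (real k)) \<partial>Z) \<le> ennreal C" for k
  proof -
    have "(\<lambda>n. \<integral>z. min (\<phi> z) (real k) \<partial>M n) \<longlonglongrightarrow> (\<integral>z. min (\<phi> z) (real k) \<partial>Z)"
      using \<phi> by (intro weak_conv_imp_integral_bdd_continuous_conv[where B="real k"] M conv)
        (auto simp: continuous_on_eq_continuous_within intro!: continuous_intros)
    moreover have "(\<integral>z. min (\<phi> z) (real k) \<partial>M n) \<le> C" for n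
    proof -
      interpret N: real_distribution "M n" by fact
      have i: "integrable (M n) (\<lambda>z. min (\<phi> z) (real k))"
        using \<phi> by (intro N.integrable_const_bound[where B="real k"]) auto
      have "ennreal (\<integral>z. min (\<phi> z) (real k) \<partial>M n) = (\<integral>\<^sup>+z. ennreal (min (\<phi> z) (real k)) \<partial>M n)"
        using i \<phi> by (intro nn_integral_eq_integral[symmetric]) auto
      also have "\<dots> \<le> (\<integral>\<^sup>+z. ennreal (\<phi> z) \<partial>M n)" by (intro nn_integral_mono) (auto simp: ennreal_leI)
      also note le[of n]
      finally show ?thesis using \<open>0 \<le> C\<close> by simp
    qed
    ultimately have "(\<integral>z. min (\<phi> z) (real k) \<partial>Z) \<le> C" by (intro LIMSEQ_le_const2) auto
    moreover have "integrable Z (\<lambda>z. min (\<phi> z) (real k))"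
      using \<phi> by (intro Z.integrable_const_bound[where B="real k"]) auto
    then have "(\<integral>\<^sup>+z. ennreal (min (\<phi> z) (real k)) \<partial>Z) = ennreal (\<integral>z. min (\<phi> z) (real k) \<partial>Z)"
      using \<phi> by (intro nn_integral_eq_integral) auto
    ultimately show ?thesis by (simp add: ennreal_leI)
  qed
  have "(\<integral>\<^sup>+z. ennreal (\<phi> z) \<partial>Z) = (\<integral>\<^sup>+z. (SUP k. ennreal (min (\<phi> z) (real k))) \<partial>Z)"
  proof (intro nn_integral_cong)
    fix z
    show "ennreal (\<phi> z) = (SUP k. ennreal (min (\<phi> z) (real k)))"
    proof (rule antisym)
      obtain k where "\<phi> z \<le> real k" using real_arch_simple by blast
      then show "ennreal (\<phi> z) \<le> (SUP k. ennreal (min (\<phi> z) (real k)))"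
        by (intro SUP_upper2[of k]) auto
      show "(SUP k. ennreal (min (\<phi> z) (real k))) \<le> ennreal (\<phi> z)"
        by (intro SUP_least ennreal_leI) auto
    qed
  qed
  also have "\<dots> = (SUP k. \<integral>\<^sup>+z. ennreal (min (\<phi> z) (real k)) \<partial>Z)"
    by (intro nn_integral_monotone_convergence_SUP)
      (auto simp: incseq_def le_fun_def intro!: ennreal_leI)
  also have "\<dots> \<le> ennreal C" by (intro SUP_least trunc)
  finally show ?thesis .
qed

text \<open>Small jumps may have infinite total mass and negative jumps are unbounded, so the law is
  a weak limit of laws with finite jump measures. The first moment gives tightness, Levy's
  continuity theorem identifies the exponent, and the moment bounds pass to the limit as
  inequalities.\<close>

theorem spectrally_bounded_law_exists:
  fixes \<rho> :: "real measure"
  assumes sets: "sets \<rho> = sets borel" and int: "integrable \<rho> (\<lambda>y. min \<bar>y\<bar> (y\<^sup>2))"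
    and AE: "AE y in \<rho>. y \<le> h" and s: "0 \<le> s"
  shows "\<exists>Z. real_distribution Z \<and> (\<forall>u. char Z u = exp (of_real s * levy_exponent \<sigma> \<rho> u)) \<and>
    (\<forall>l>0. (\<integral>\<^sup>+z. ennreal (exp (l * z) - 1 - l * z) \<partial>Z) \<le> ennreal (exp (s * exp_cumulant \<sigma> \<rho> l) - 1)) \<and>
    (\<forall>l>0. (\<integral>\<^sup>+z. ennreal (exp (l * z)) \<partial>Z) \<le> ennreal (exp (s * exp_cumulant \<sigma> \<rho> l))) \<and>
    (\<forall>l>0. (\<integral>\<^sup>+z. ennreal \<bar>z\<bar> \<partial>Z) \<le> ennreal (2 / l * exp (s * exp_cumulant \<sigma> \<rho> l)))"
proof -
  note sets[measurable_cong]
  have space: "space \<rho> = UNIV" using sets_eq_imp_space_eq[OF sets] by simp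
  \<comment> \<open>The cut near 0 makes the restricted measure finite, the cut at infinity makes
    its support bounded. The time \<open>s\<close> is absorbed into \<open>m n\<close> and
    \<tau>.\<close>
  define S where "S n = {y::real. 1 / real (Suc n) < \<bar>y\<bar> \<and> \<bar>y\<bar> \<le> real (Suc n)}" for n
  have [measurable]: "S n \<in> sets borel" for n unfolding S_def by measurable
  define m where "m n = density \<rho> (\<lambda>y. ennreal (s * indicator (S n) y))" for n
  define \<tau> where "\<tau> = \<sigma> * sqrt s"
  have \<tau>: "\<tau>\<^sup>2 = s * \<sigma>\<^sup>2" using s by (simp add: \<tau>_def power_mult_distrib)
  have sets_m: "sets (m n) = sets borel" for n by (simp add: m_def sets)
  have min_S: "indicator (S n) y \<le> (real (Suc n))\<^sup>2 * min \<bar>y\<bar> (y\<^sup>2)" for n y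
  proof (cases "y \<in> S n")
    case True
    define r where "r = real (Suc n)"
    have r: "r \<ge> 1" by (simp add: r_def)
    have "1 / r < \<bar>y\<bar>" using True by (simp add: S_def r_def)
    then have 1: "1 \<le> r * \<bar>y\<bar>" using r by (simp add: field_simps)
    then have "1\<^sup>2 \<le> (r * \<bar>y\<bar>)\<^sup>2" by (intro power_mono) auto
    moreover have "r * \<bar>y\<bar> * 1 \<le> r * \<bar>y\<bar> * r" using r by (intro mult_left_mono) auto
    ultimately show ?thesis using 1 True unfolding r_def[symmetric]
      by (auto simp: min_def power_mult_distrib power2_eq_square mult_ac)
  qed simp
  have fin: "finite_measure (m n)" for n
  proof (rule finite_measureI)
    have "integrable \<rho> (\<lambda>y. s * ((real (Suc n))\<^sup>2 * min \<bar>y\<bar> (y\<^sup>2)))" using int by simp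
    then have I: "(\<integral>\<^sup>+y. ennreal (s * ((real (Suc n))\<^sup>2 * min \<bar>y\<bar> (y\<^sup>2))) \<partial>\<rho>) < \<infinity>"
      using s by (subst nn_integral_eq_integral) auto
    have "emeasure (m n) (space (m n)) = (\<integral>\<^sup>+y. ennreal (s * indicator (S n) y) \<partial>\<rho>)"
      unfolding m_def by (subst emeasure_density) (auto simp: space)
    also have "\<dots> \<le> (\<integral>\<^sup>+y. ennreal (s * ((real (Suc n))\<^sup>2 * min \<bar>y\<bar> (y\<^sup>2))) \<partial>\<rho>)"
      by (intro nn_integral_mono ennreal_leI mult_left_mono min_S s)
    finally show "emeasure (m n) (space (m n)) \<noteq> \<infinity>" using I by auto
  qed
  have bdd: "AE y in m n. \<bar>y\<bar> \<le> real (Suc n)" for n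
    unfolding m_def by (subst AE_density) (auto simp: S_def split: split_indicator)
  have "\<exists>Z. real_distribution Z \<and> (\<forall>u. char Z u = exp (levy_exponent \<tau> (m n) u)) \<and>
    (\<forall>l. (\<integral>\<^sup>+z. ennreal (exp (l * z)) \<partial>Z) = ennreal (exp (exp_cumulant \<tau> (m n) l)))" for n
    by (rule finite_jump_law[OF sets_m fin bdd])
  then obtain Z where Z: "\<And>n. real_distribution (Z n)"
      "\<And>n u. char (Z n) u = exp (levy_exponent \<tau> (m n) u)"
      "\<And>n l. (\<integral>\<^sup>+z. ennreal (exp (l * z)) \<partial>Z n) = ennreal (exp (exp_cumulant \<tau> (m n) l))"
    by metis
  have int_m: "integral\<^sup>L (m n) f = (\<integral>y. (s * indicator (S n) y) *\<^sub>R f y \<partial>\<rho>)"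
    if [measurable]: "f \<in> borel_measurable borel" for n and f :: "real \<Rightarrow> 'b::{banach, second_countable_topology}"
    unfolding m_def by (subst integral_density) (use s in auto)
  have intm: "integrable (m n) (\<lambda>y. min \<bar>y\<bar> (y\<^sup>2))" for n
  proof -
    have "integrable \<rho> (\<lambda>y. (s * indicator (S n) y) *\<^sub>R min \<bar>y\<bar> (y\<^sup>2))"
      using integrable_mult_indicator[OF _ int, of "S n"]
      by (auto simp: sets mult.assoc)
    then show ?thesis unfolding m_def by (subst integrable_density) (use s in auto)
  qed
  have mean0: "(LINT z|Z n. z) = 0" if "integrable (Z n) (\<lambda>z. z)" for n
  proof -
    interpret N: real_distribution "Z n" by (rule Z)
    show ?thesis
      by (rule N.mean_of_levy_exponent[OF that sets_m[of n] intm[of n], of _ 1 \<tau>]) (simp add: Z)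
  qed
  define K where "K l = exp (s * exp_cumulant \<sigma> \<rho> l)" for l
  \<comment> \<open>The exponential remainder is nonnegative, so restricting the jumps to
    \<open>S n\<close> can only lower the cumulant; all bounds are uniform in
    \<open>n\<close>.\<close>
  have cum_le: "exp (exp_cumulant \<tau> (m n) l) \<le> K l" if "0 \<le> l" for n l
  proof -
    have i: "integrable \<rho> (\<lambda>y. exp (l * y) - 1 - l * y)"
      by (rule integrable_exp_remainder[OF sets int AE that])
    have "(LINT y|m n. exp (l * y) - 1 - l * y) = (LINT y|\<rho>. (s * indicator (S n) y) * (exp (l * y) - 1 - l * y))"
      by (subst int_m) auto
    also have "\<dots> \<le> (LINT y|\<rho>. s * (exp (l * y) - 1 - l * y))"
    proof (rule integral_mono_AE)
      show "integrable \<rho> (\<lambda>y. (s * indicator (S n) y) * (exp (l * y) - 1 - l * y))"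
        using integrable_mult_indicator[OF _ i, of "S n"] by (auto simp: sets mult.assoc)
      show "AE y in \<rho>. (s * indicator (S n) y) * (exp (l * y) - 1 - l * y) \<le> s * (exp (l * y) - 1 - l * y)"
      proof (rule AE_I2)
        fix y
        have "0 \<le> exp (l * y) - 1 - l * y" using exp_ge_add_one_self[of "l * y"] by linarith
        then show "(s * indicator (S n) y) * (exp (l * y) - 1 - l * y) \<le> s * (exp (l * y) - 1 - l * y)"
          using s by (intro mult_right_mono) (auto simp: indicator_def)
      qed
    qed (use i in auto)
    finally have "(LINT y|m n. exp (l * y) - 1 - l * y) \<le> s * (LINT y|\<rho>. exp (l * y) - 1 - l * y)"
      by (simp only: integral_mult_right_zero)
    then show ?thesis unfolding K_def exp_cumulant_def \<tau>
      by (simp add: distrib_left)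
  qed
  have K1: "1 \<le> K l" if "0 < l" for l
  proof -
    have "0 \<le> exp_cumulant \<sigma> \<rho> l" unfolding exp_cumulant_def
      by (intro add_nonneg_nonneg integral_nonneg_AE AE_I2)
        (use exp_ge_add_one_self[of "l * y" for y] in \<open>auto simp: algebra_simps\<close>)
    then show ?thesis using s by (simp add: K_def)
  qed
  have M1: "(\<integral>\<^sup>+z. ennreal (exp (l * z) - 1 - l * z) \<partial>Z n) \<le> ennreal (K l - 1)"
    and M2: "(\<integral>\<^sup>+z. ennreal \<bar>z\<bar> \<partial>Z n) \<le> ennreal (2 / l * K l)" if "0 < l" for l n
  proof -
    interpret N: real_distribution "Z n" by (rule Z)
    show "(\<integral>\<^sup>+z. ennreal (exp (l * z) - 1 - l * z) \<partial>Z n) \<le> ennreal (K l - 1)"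
      using that cum_le[of l n]
      by (subst N.moments_of_mean_zero(1)[where L="\<lambda>l. exp (exp_cumulant \<tau> (m n) l)"])
        (auto simp: Z mean0 intro!: ennreal_leI)
    have "(\<integral>\<^sup>+z. ennreal \<bar>z\<bar> \<partial>Z n) \<le> ennreal (2 / l * exp (exp_cumulant \<tau> (m n) l))"
      using that by (intro N.moments_of_mean_zero(2)) (auto simp: Z mean0)
    also have "\<dots> \<le> ennreal (2 / l * K l)"
      using that cum_le[of l n] by (intro ennreal_leI mult_left_mono) auto
    finally show "(\<integral>\<^sup>+z. ennreal \<bar>z\<bar> \<partial>Z n) \<le> ennreal (2 / l * K l)" .
  qed
  have "tight Z"
    unfolding tight_def
  proof (intro conjI allI impI Z)
    fix \<epsilon> :: real assume \<epsilon>: "0 < \<epsilon>"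
    \<comment> \<open>Markov's inequality with the first moment at rate \<open>l = 1\<close>: at
      most \<epsilon> / 2 of the mass lies at distance \<open>R\<close> or more.\<close>
    define R where "R = 2 * (2 / 1 * K 1) / \<epsilon>"
    have R: "R > 0" using \<epsilon> K1[of 1] by (simp add: R_def)
    have "1 - \<epsilon> < measure (Z n) {-R<..R}" for n
    proof -
      interpret N: real_distribution "Z n" by (rule Z)
      have int: "integrable (Z n) (\<lambda>z. \<bar>z\<bar>)"
        using M2[of 1 n] by (intro integrableI_nonneg) (auto intro: le_less_trans)
      have "ennreal (LINT z|Z n. \<bar>z\<bar>) \<le> ennreal (2 / 1 * K 1)"
        using M2[of 1 n] int by (subst nn_integral_eq_integral[symmetric]) auto
      then have E: "(LINT z|Z n. \<bar>z\<bar>) \<le> 2 * K 1" using K1[of 1] by simp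
      have "measure (Z n) {z \<in> space (Z n). R \<le> \<bar>z\<bar>} \<le> (LINT z|Z n. \<bar>z\<bar>) / R"
        using R int by (intro integral_Markov_inequality_measure[where A="{}"]) auto
      also have "\<dots> \<le> 2 * K 1 / R" using E R by (intro divide_right_mono) auto
      also have "\<dots> < \<epsilon>" using \<epsilon> K1[of 1] by (simp add: R_def field_simps)
      finally have "measure (Z n) {z. R \<le> \<bar>z\<bar>} < \<epsilon>" by simp
      moreover have "measure (Z n) (UNIV - {z. R \<le> \<bar>z\<bar>}) = 1 - measure (Z n) {z. R \<le> \<bar>z\<bar>}"
        using N.prob_compl[of "{z. R \<le> \<bar>z\<bar>}"] by simp
      moreover have "measure (Z n) (UNIV - {z. R \<le> \<bar>z\<bar>}) \<le> measure (Z n) {-R<..R}"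
        by (intro N.finite_measure_mono) auto
      ultimately show ?thesis by linarith
    qed
    then show "\<exists>a b. a < b \<and> (\<forall>n. 1 - \<epsilon> < measure (Z n) {a<..b})"
      using R by (intro exI[of _ "-R"] exI[of _ R]) auto
  qed
  then obtain r Z' where r: "strict_mono (r::nat \<Rightarrow> nat)" and Z': "real_distribution Z'"
    and conv: "weak_conv_m (Z \<circ> r) Z'"
    using tight_imp_convergent_subsubsequence[of Z id] by (auto simp: strict_mono_id)
  have Zr: "real_distribution ((Z \<circ> r) n)" for n by (simp add: Z)
  have "char Z' u = exp (of_real s * levy_exponent \<sigma> \<rho> u)" for u
  proof -
    have "(\<lambda>n. CLINT y|\<rho>. (s * indicator (S n) y) *\<^sub>R (iexp (u * y) - 1 - \<i> * of_real (u * y)))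
       \<longlonglongrightarrow> (CLINT y|\<rho>. s *\<^sub>R (iexp (u * y) - 1 - \<i> * of_real (u * y)))"
    proof (rule integral_dominated_convergence[where w="\<lambda>y. s * norm (iexp (u * y) - 1 - \<i> * of_real (u * y))"])
      show "integrable \<rho> (\<lambda>y. s * norm (iexp (u * y) - 1 - \<i> * of_real (u * y)))"
        by (intro integrable_mult_right integrable_norm integrable_iexp_remainder sets int)
      show "AE y in \<rho>. (\<lambda>n. (s * indicator (S n) y) *\<^sub>R (iexp (u * y) - 1 - \<i> * of_real (u * y)))
          \<longlonglongrightarrow> s *\<^sub>R (iexp (u * y) - 1 - \<i> * of_real (u * y))"
      proof (rule AE_I2)
        fix y :: real
        show "(\<lambda>n. (s * indicator (S n) y) *\<^sub>R (iexp (u * y) - 1 - \<i> * of_real (u * y)))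
          \<longlonglongrightarrow> s *\<^sub>R (iexp (u * y) - 1 - \<i> * of_real (u * y))"
        proof (cases "y = 0")
          case False
          obtain N1 where N1: "\<bar>y\<bar> \<le> real N1" using real_arch_simple by blast
          obtain N2 where N2: "1 / \<bar>y\<bar> < real N2" using reals_Archimedean2 by blast
          have "y \<in> S n" if "n \<ge> max N1 N2" for n
          proof -
            have "1 / \<bar>y\<bar> < real (Suc n)" "\<bar>y\<bar> \<le> real (Suc n)" using N1 N2 that by auto
            then show ?thesis using False by (simp add: S_def field_simps)
          qed
          then have "eventually (\<lambda>n. (s * indicator (S n) y) *\<^sub>R (iexp (u * y) - 1 - \<i> * of_real (u * y)) =
              s *\<^sub>R (iexp (u * y) - 1 - \<i> * of_real (u * y))) sequentially"
            unfolding eventually_sequentially by (intro exI[of _ "max N1 N2"]) auto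
          then show ?thesis by (rule tendsto_eventually)
        qed simp
      qed
      show "AE y in \<rho>. norm ((s * indicator (S n) y) *\<^sub>R (iexp (u * y) - 1 - \<i> * of_real (u * y)))
          \<le> s * norm (iexp (u * y) - 1 - \<i> * of_real (u * y))" for n
        using s by (intro AE_I2) (auto simp: indicator_def)
    qed measurable
    then have "(\<lambda>n. exp ((CLINT y|\<rho>. (s * indicator (S n) y) *\<^sub>R (iexp (u * y) - 1 - \<i> * of_real (u * y)))
          - of_real (\<tau>\<^sup>2 * u\<^sup>2 / 2)))
       \<longlonglongrightarrow> exp ((CLINT y|\<rho>. s *\<^sub>R (iexp (u * y) - 1 - \<i> * of_real (u * y))) - of_real (\<tau>\<^sup>2 * u\<^sup>2 / 2))"
      by (intro tendsto_intros)
    also have "(\<lambda>n. exp ((CLINT y|\<rho>. (s * indicator (S n) y) *\<^sub>R (iexp (u * y) - 1 - \<i> * of_real (u * y)))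
          - of_real (\<tau>\<^sup>2 * u\<^sup>2 / 2))) = (\<lambda>n. char (Z n) u)"
      unfolding Z(2) levy_exponent_def by (subst int_m) auto
    also have "exp ((CLINT y|\<rho>. s *\<^sub>R (iexp (u * y) - 1 - \<i> * of_real (u * y))) - of_real (\<tau>\<^sup>2 * u\<^sup>2 / 2)) =
       exp (of_real s * levy_exponent \<sigma> \<rho> u)"
      unfolding levy_exponent_def \<tau> integral_scaleR_right
      by (simp add: scaleR_conv_of_real right_diff_distrib mult.assoc)
    finally have "(\<lambda>n. char ((Z \<circ> r) n) u) \<longlonglongrightarrow> exp (of_real s * levy_exponent \<sigma> \<rho> u)"
      using LIMSEQ_subseq_LIMSEQ[OF _ r] by (auto simp: comp_def)
    with levy_continuity1[OF Zr Z' conv] show ?thesis by (rule LIMSEQ_unique)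
  qed
  moreover have "(\<integral>\<^sup>+z. ennreal (exp (l * z) - 1 - l * z) \<partial>Z') \<le> ennreal (K l - 1)" if "0 < l" for l
  proof (rule weak_conv_nn_integral_le[OF Zr Z' conv])
    show "0 \<le> exp (l * z) - 1 - l * z" for z using exp_ge_add_one_self[of "l * z"] by linarith
  qed (use M1[OF that] K1[OF that] in \<open>auto intro!: continuous_intros\<close>)
  moreover have "(\<integral>\<^sup>+z. ennreal (exp (l * z)) \<partial>Z') \<le> ennreal (K l)" if "0 < l" for l
    by (rule weak_conv_nn_integral_le[OF Zr Z' conv])
      (use cum_le[of l] K1[OF that] that in \<open>auto intro!: continuous_intros ennreal_leI simp: Z\<close>)
  moreover have "(\<integral>\<^sup>+z. ennreal \<bar>z\<bar> \<partial>Z') \<le> ennreal (2 / l * K l)" if "0 < l" for l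
    by (rule weak_conv_nn_integral_le[OF Zr Z' conv])
      (use M2[OF that] K1[OF that] that in \<open>auto intro!: continuous_intros\<close>)
  ultimately show ?thesis using Z' unfolding K_def by blast
qed


section \<open>Local bounds for convolution powers\<close>

text \<open>Only the masses of windows of length \<open>d\<close> will be under control. So the
  value at \<open>z\<close> is averaged over all windows \<open>{u<..u + d}\<close> that contain
  \<open>z\<close>, and Fubini leaves a Lebesgue integral in \<open>u\<close>.\<close>

lemma smear_nn_integral:
  fixes \<kappa> :: "real measure" and \<phi> \<psi> :: "real \<Rightarrow> ennreal"
  assumes "real_distribution \<kappa>" and "0 < d"
    and [measurable]: "\<psi> \<in> borel_measurable borel"
    and le: "\<And>z u. u < z \<Longrightarrow> z \<le> u + d \<Longrightarrow> \<phi> z \<le> \<psi> u"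
  shows "(\<integral>\<^sup>+z. \<phi> z \<partial>\<kappa>) \<le> ennreal (1 / d) * (\<integral>\<^sup>+u. \<psi> u * emeasure \<kappa> {u<..u + d} \<partial>lborel)"
proof -
  interpret real_distribution \<kappa> by fact
  interpret P: pair_sigma_finite \<kappa> lborel ..
  have eq: "\<psi> u * indicator {u<..u + d} z = \<psi> u * indicator {p. snd p < fst p \<and> fst p \<le> snd p + d} (z, u)" for z u
    by (simp add: indicator_def)
  have M: "(\<lambda>(z, u). \<psi> u * indicator {u<..u + d} z) \<in> borel_measurable (\<kappa> \<Otimes>\<^sub>M lborel)"
    unfolding eq by measurable
  have "(\<integral>\<^sup>+z. \<phi> z \<partial>\<kappa>) \<le> (\<integral>\<^sup>+z. ennreal (1 / d) * (\<integral>\<^sup>+u. \<psi> u * indicator {u<..u + d} z \<partial>lborel) \<partial>\<kappa>)"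
  proof (rule nn_integral_mono)
    fix z
    have "\<phi> z = ennreal (1 / d) * (\<phi> z * ennreal d)"
    proof -
      have "ennreal (1 / d) * ennreal d = 1" using \<open>0 < d\<close> by (simp add: ennreal_mult[symmetric])
      then show ?thesis by (metis mult.left_commute mult.right_neutral)
    qed
    also have "\<phi> z * ennreal d = (\<integral>\<^sup>+u. \<phi> z * indicator {z - d..<z} u \<partial>lborel)"
      using \<open>0 < d\<close> by (subst nn_integral_cmult) auto
    also have "\<dots> \<le> (\<integral>\<^sup>+u. \<psi> u * indicator {u<..u + d} z \<partial>lborel)"
      by (intro nn_integral_mono) (auto simp: indicator_def intro!: le)
    finally show "\<phi> z \<le> ennreal (1 / d) * (\<integral>\<^sup>+u. \<psi> u * indicator {u<..u + d} z \<partial>lborel)"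
      by (simp add: mult_left_mono)
  qed
  also have "\<dots> = ennreal (1 / d) * (\<integral>\<^sup>+z. \<integral>\<^sup>+u. \<psi> u * indicator {u<..u + d} z \<partial>lborel \<partial>\<kappa>)"
    using lborel.borel_measurable_nn_integral_fst[OF M] by (intro nn_integral_cmult) simp
  also have "(\<integral>\<^sup>+z. \<integral>\<^sup>+u. \<psi> u * indicator {u<..u + d} z \<partial>lborel \<partial>\<kappa>) =
      (\<integral>\<^sup>+u. \<integral>\<^sup>+z. \<psi> u * indicator {u<..u + d} z \<partial>\<kappa> \<partial>lborel)"
    using P.Fubini'[OF M] by simp
  also have "\<dots> = (\<integral>\<^sup>+u. \<psi> u * emeasure \<kappa> {u<..u + d} \<partial>lborel)"
    by (intro nn_integral_cong, subst nn_integral_cmult_indicator) auto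
  finally show ?thesis .
qed

text \<open>With \<open>2 * h - d \<le> y\<close>, a first summand of at most
  \<open>(y + d) / 2\<close> leaves the window of the second one at or above \<open>h - d\<close>,
  where the masses of \<open>\<kappa>'\<close> are controlled. Applied to both orders of the
  summands this covers a whole convolution. The constant \<open>C\<close> pays for moving the
  argument of \<open>f\<close> within one window.\<close>

lemma half_convolution_bound:
  fixes f :: "real \<Rightarrow> real"
  assumes \<kappa>: "real_distribution \<kappa>" and d: "0 < d" and supp: "AE z in \<kappa>. h < z"
    and \<kappa>le: "\<And>u. h - d \<le> u \<Longrightarrow> emeasure \<kappa> {u<..u + d} \<le> ennreal (B * f u)"
    and \<kappa>'le: "\<And>u. h - d \<le> u \<Longrightarrow> emeasure \<kappa>' {u<..u + d} \<le> ennreal (B' * f u)"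
    and f0: "\<And>u. h - d \<le> u \<Longrightarrow> 0 \<le> f u" and B: "0 \<le> B" "0 \<le> B'" "0 \<le> C"
    and meas[measurable]: "(\<lambda>u. f u * indicator {h - d..} u) \<in> borel_measurable borel"
    and reg: "\<And>u v. h - d \<le> u \<Longrightarrow> u \<le> v \<Longrightarrow> v \<le> u + d \<Longrightarrow> f u \<le> C * f v"
    and y: "2 * h - d \<le> y"
    and I: "(\<integral>\<^sup>+u. indicator {h - d..(y + d) / 2} u * ennreal (f u * f (y - u)) \<partial>lborel) \<le> ennreal I"
  shows "(\<integral>\<^sup>+z. indicator {..(y + d) / 2} z * emeasure \<kappa>' {y - z<..y - z + d} \<partial>\<kappa>)
    \<le> ennreal (B * B' * C / d * I)"
proof -
  define \<psi> where "\<psi> u = indicator {h - d..(y + d) / 2} u * ennreal (B' * C * f (y - u))" for u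
  have "(\<lambda>u. f (y - u) * indicator {h - d..} (y - u)) \<in> borel_measurable borel"
    by (rule measurable_compose[OF _ meas]) measurable
  then have fy: "(\<lambda>u. f (y - u) * indicator {h - d..} (y - u)) \<in> borel_measurable borel" .
  then have "(\<lambda>u. indicator {h - d..(y + d) / 2} u * ennreal (B' * C * (f (y - u) * indicator {h - d..} (y - u))))
      \<in> borel_measurable borel" by measurable
  also have "(\<lambda>u. indicator {h - d..(y + d) / 2} u * ennreal (B' * C * (f (y - u) * indicator {h - d..} (y - u)))) = \<psi>"
    using y by (auto simp: \<psi>_def indicator_def fun_eq_iff)
  finally have \<psi>[measurable]: "\<psi> \<in> borel_measurable borel" .
  define \<phi> where "\<phi> z = indicator {h<..(y + d) / 2} z * ennreal (B' * f (y - z))" for z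
  have "(\<integral>\<^sup>+z. indicator {..(y + d) / 2} z * emeasure \<kappa>' {y - z<..y - z + d} \<partial>\<kappa>) \<le> (\<integral>\<^sup>+z. \<phi> z \<partial>\<kappa>)"
    using supp
    by (intro nn_integral_mono_AE, eventually_elim)
      (use y in \<open>auto simp: indicator_def \<phi>_def intro!: \<kappa>'le\<close>)
  also have "\<dots> \<le> ennreal (1 / d) * (\<integral>\<^sup>+u. \<psi> u * emeasure \<kappa> {u<..u + d} \<partial>lborel)"
  proof (rule smear_nn_integral[OF \<kappa> d \<psi>])
    fix z u assume u: "u < z" "z \<le> u + d"
    show "\<phi> z \<le> \<psi> u"
    proof (cases "z \<in> {h<..(y + d) / 2}")
      case True
      then have "f (y - z) \<le> C * f (y - u)" using y u by (intro reg) auto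
      then have "B' * f (y - z) \<le> B' * C * f (y - u)"
        using B by (simp add: mult.assoc mult_left_mono)
      with True u show ?thesis by (auto simp: \<phi>_def \<psi>_def intro!: ennreal_leI)
    qed (simp add: \<phi>_def)
  qed
  also have "(\<integral>\<^sup>+u. \<psi> u * emeasure \<kappa> {u<..u + d} \<partial>lborel) \<le>
      (\<integral>\<^sup>+u. ennreal (B * B' * C) * (indicator {h - d..(y + d) / 2} u * ennreal (f u * f (y - u))) \<partial>lborel)"
  proof (rule nn_integral_mono)
    fix u
    show "\<psi> u * emeasure \<kappa> {u<..u + d} \<le>
      ennreal (B * B' * C) * (indicator {h - d..(y + d) / 2} u * ennreal (f u * f (y - u)))"
    proof (cases "u \<in> {h - d..(y + d) / 2}")
      case True
      then have pos: "0 \<le> f u" "0 \<le> f (y - u)" using y by (auto intro!: f0)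
      have "\<psi> u * emeasure \<kappa> {u<..u + d} \<le> ennreal (B' * C * f (y - u)) * ennreal (B * f u)"
        using True by (auto simp: \<psi>_def intro!: mult_left_mono \<kappa>le)
      also have "\<dots> = ennreal (B * B' * C) * ennreal (f u * f (y - u))"
        using pos B by (simp add: ennreal_mult[symmetric] mult_ac)
      finally show ?thesis using True d by (simp add: indicator_def)
    qed (simp add: \<psi>_def)
  qed
  also have "\<dots> \<le> ennreal (B * B' * C) * ennreal I"
  proof -
    have "(\<lambda>u. indicator {h - d..(y + d) / 2} u * ennreal ((f u * indicator {h - d..} u) * (f (y - u) * indicator {h - d..} (y - u))))
      \<in> borel_measurable borel"
      using fy by measurable
    also have "(\<lambda>u. indicator {h - d..(y + d) / 2} u * ennreal ((f u * indicator {h - d..} u) * (f (y - u) * indicator {h - d..} (y - u)))) =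
      (\<lambda>u. indicator {h - d..(y + d) / 2} u * ennreal (f u * f (y - u)))"
      using y by (auto simp: fun_eq_iff indicator_def)
    finally have "(\<integral>\<^sup>+u. ennreal (B * B' * C) * (indicator {h - d..(y + d) / 2} u * ennreal (f u * f (y - u))) \<partial>lborel)
      = ennreal (B * B' * C) * (\<integral>\<^sup>+u. indicator {h - d..(y + d) / 2} u * ennreal (f u * f (y - u)) \<partial>lborel)"
      by (intro nn_integral_cmult) simp
    then show ?thesis using I by (simp add: mult_left_mono)
  qed
  finally have "(\<integral>\<^sup>+z. indicator {..(y + d) / 2} z * emeasure \<kappa>' {y - z<..y - z + d} \<partial>\<kappa>)
    \<le> ennreal (1 / d) * (ennreal (B * B' * C) * ennreal I)" by (simp add: mult_left_mono)
  also have "\<dots> = ennreal (B * B' * C / d * I)"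
    using B d by (simp add: ennreal_mult''[symmetric] ennreal_mult'[symmetric] mult.commute)
  finally show ?thesis .
qed

lemma emeasure_convolution_real:
  assumes "real_distribution M" "real_distribution N" and [measurable]: "B \<in> sets borel"
  shows "emeasure (M \<star> N) B = (\<integral>\<^sup>+x. emeasure N {y. x + y \<in> B} \<partial>M)"
proof -
  interpret M: real_distribution M by fact
  interpret N: real_distribution N by fact
  have "emeasure (M \<star> N) B = (\<integral>\<^sup>+x. \<integral>\<^sup>+y. indicator B (x + y) \<partial>N \<partial>M)"
    using nn_integral_convolution_real[OF assms(1,2), of "indicator B"] by simp
  also have "\<dots> = (\<integral>\<^sup>+x. emeasure N {y. x + y \<in> B} \<partial>M)"
  proof (intro nn_integral_cong)
    fix x
    have "(\<integral>\<^sup>+y. indicator B (x + y) \<partial>N) = (\<integral>\<^sup>+y. indicator {y. x + y \<in> B} y \<partial>N)"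
      by (intro nn_integral_cong) (simp add: indicator_def)
    also have "\<dots> = emeasure N {y. x + y \<in> B}" by (intro nn_integral_indicator) measurable
    finally show "(\<integral>\<^sup>+y. indicator B (x + y) \<partial>N) = emeasure N {y. x + y \<in> B}" .
  qed
  finally show ?thesis .
qed

lemma AE_conv_power_Suc:
  assumes J: "real_distribution J" and supp: "AE z in J. h < z" and h: "0 \<le> h"
  shows "AE z in conv_power J (Suc n). h < z"
proof (induction n)
  case 0
  interpret J: real_distribution J by (rule J)
  have [measurable]: "Measurable.pred borel (\<lambda>z::real. h < z)" by measurable
  have "emeasure (J \<star> return borel 0) {..h} = (\<integral>\<^sup>+x. emeasure (return borel 0) {y. x + y \<in> {..h}} \<partial>J)"
    by (intro emeasure_convolution_real J real_distribution_return) auto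
  also have "\<dots> = (\<integral>\<^sup>+x. 0 \<partial>J)"
    using supp by (intro nn_integral_cong_AE) (auto elim!: eventually_mono simp: indicator_def)
  finally show ?case
    by (intro AE_I[where N="{..h}"]) auto
next
  case (Suc n)
  interpret J: real_distribution J by (rule J)
  interpret N: real_distribution "conv_power J (Suc n)" by (intro real_distribution_conv_power J)
  have 0: "emeasure (conv_power J (Suc n)) {..h} = 0"
    using Suc by (subst (asm) AE_iff_measurable[OF _ refl]) (auto simp: not_less atMost_def simp del: conv_power.simps)
  have "emeasure (J \<star> conv_power J (Suc n)) {..h} = (\<integral>\<^sup>+x. emeasure (conv_power J (Suc n)) {y. x + y \<in> {..h}} \<partial>J)"
    by (intro emeasure_convolution_real J real_distribution_conv_power) auto
  also have "\<dots> = (\<integral>\<^sup>+x. 0 \<partial>J)"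
    using supp
  proof (intro nn_integral_cong_AE, eventually_elim)
    fix x assume "h < x"
    then have "emeasure (conv_power J (Suc n)) {y. x + y \<in> {..h}} \<le> emeasure (conv_power J (Suc n)) {..h}"
      using h by (intro emeasure_mono) (auto simp del: conv_power.simps)
    then show "emeasure (conv_power J (Suc n)) {y. x + y \<in> {..h}} = 0" using 0 by simp
  qed
  finally have "emeasure (conv_power J (Suc (Suc n))) {..h} = 0" by simp
  then show ?case
    by (intro AE_I[where N="{..h}"]) (auto simp: not_less simp del: conv_power.simps
        simp: real_distribution.events_eq_borel[OF real_distribution_conv_power[OF J]])
qed

text \<open>Each further jump multiplies the bound by \<open>2 * C * \<eta> / d / a\<close>: the 2
  comes from the two halves of the convolution, the division by \<open>d\<close> from averaging over
  windows. The powers of \<open>a\<close> stay explicit because they will cancel against the Poisson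
  weights.\<close>

lemma conv_power_local_bound:
  fixes f :: "real \<Rightarrow> real"
  assumes J: "real_distribution J" and d: "0 < d" "d \<le> h" and supp: "AE z in J. h < z"
    and a: "0 < a" and s: "0 < s" and C: "0 \<le> C" and \<eta>: "0 \<le> \<eta>"
    and Jle: "\<And>u. h - d \<le> u \<Longrightarrow> a * measure J {u<..u + d} \<le> s * f u"
    and f0: "\<And>u. h - d \<le> u \<Longrightarrow> 0 \<le> f u"
    and meas: "(\<lambda>u. f u * indicator {h - d..} u) \<in> borel_measurable borel"
    and reg: "\<And>u v. h - d \<le> u \<Longrightarrow> u \<le> v \<Longrightarrow> v \<le> u + d \<Longrightarrow> f u \<le> C * f v"
    and I: "\<And>y. 2 * h - d \<le> y \<Longrightarrow>
      ennreal s * (\<integral>\<^sup>+u. indicator {h - d..(y + d) / 2} u * ennreal (f u * f (y - u)) \<partial>lborel) \<le> ennreal (\<eta> * f y)"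
    and y: "h - d \<le> y"
  shows "emeasure (conv_power J (Suc n)) {y<..y + d} \<le> ennreal (s * (2 * C * \<eta> / d) ^ n / a ^ Suc n * f y)"
  using y
proof (induction n arbitrary: y)
  case 0
  interpret J: real_distribution J by (rule J)
  have "emeasure (J \<star> return borel 0) {y<..y + d} = (\<integral>\<^sup>+x. emeasure (return borel 0) {z. x + z \<in> {y<..y + d}} \<partial>J)"
    by (intro emeasure_convolution_real J real_distribution_return) auto
  also have "\<dots> = (\<integral>\<^sup>+x. indicator {y<..y + d} x \<partial>J)"
    by (intro nn_integral_cong) (auto simp: indicator_def)
  also have "\<dots> = ennreal (measure J {y<..y + d})" by (simp add: J.emeasure_eq_measure)
  also have "\<dots> \<le> ennreal (s * f y / a)"
    using Jle[OF 0] a by (intro ennreal_leI) (simp add: field_simps)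
  finally show ?case by simp
next
  case (Suc n)
  interpret J: real_distribution J by (rule J)
  define N where "N = conv_power J (Suc n)"
  define q where "q = 2 * C * \<eta> / d"
  have q0: "0 \<le> q" using C \<eta> d by (simp add: q_def)
  have N: "real_distribution N" unfolding N_def by (intro real_distribution_conv_power J)
  interpret N: real_distribution N by (rule N)
  have h0: "0 \<le> h" using d by linarith
  have suppN: "AE z in N. h < z" unfolding N_def by (rule AE_conv_power_Suc[OF J supp h0])
  have eq: "emeasure (conv_power J (Suc (Suc n))) {y<..y + d} = (\<integral>\<^sup>+x. emeasure N {z. x + z \<in> {y<..y + d}} \<partial>J)"
    unfolding conv_power.simps(2)[of J "Suc n"] N_def[symmetric]
    by (intro emeasure_convolution_real J N) auto
  show ?case
  \<comment> \<open>Two summands above \<open>h\<close> exceed \<open>2 * h\<close>, so a window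
    ending below that level has no mass. This is why the convolution hypothesis is stated only from
    \<open>2 * h - d\<close> on.\<close>
  proof (cases "y < 2 * h - d")
    case True
    have "(\<integral>\<^sup>+x. emeasure N {z. x + z \<in> {y<..y + d}} \<partial>J) = (\<integral>\<^sup>+x. 0 \<partial>J)"
      using supp
    proof (intro nn_integral_cong_AE, eventually_elim)
      fix x assume x: "h < x"
      have "AE z in N. z \<notin> {z. x + z \<in> {y<..y + d}}"
        using suppN by eventually_elim (use x True in auto)
      then show "emeasure N {z. x + z \<in> {y<..y + d}} = 0"
        by (subst (asm) AE_iff_measurable[OF _ refl]) auto
    qed
    then show ?thesis unfolding eq by simp
  next
    case False
    then have y2: "2 * h - d \<le> y" by simp
    define K where "K = s * q ^ n / a ^ Suc n"
    have K0: "0 \<le> K" using s q0 a by (simp add: K_def)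
    have Nle: "emeasure N {u<..u + d} \<le> ennreal (K * f u)" if "h - d \<le> u" for u
      using Suc.IH[OF that] by (simp add: N_def K_def q_def)
    have Jle': "emeasure J {u<..u + d} \<le> ennreal (s / a * f u)" if "h - d \<le> u" for u
      using Jle[OF that] a unfolding J.emeasure_eq_measure by (intro ennreal_leI) (simp add: field_simps)
    show ?thesis
    proof -
      have "ennreal s * (\<integral>\<^sup>+u. indicator {h - d..(y + d) / 2} u * ennreal (f u * f (y - u)) \<partial>lborel) \<le> ennreal (\<eta> * f y)"
        by (rule I[OF y2])
      then have "ennreal (1 / s) * (ennreal s * (\<integral>\<^sup>+u. indicator {h - d..(y + d) / 2} u * ennreal (f u * f (y - u)) \<partial>lborel))
        \<le> ennreal (1 / s) * ennreal (\<eta> * f y)" by (rule mult_left_mono) simp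
      then have Is: "(\<integral>\<^sup>+u. indicator {h - d..(y + d) / 2} u * ennreal (f u * f (y - u)) \<partial>lborel) \<le> ennreal (\<eta> * f y / s)"
        using s f0[OF Suc.prems] \<eta> by (simp add: mult.assoc[symmetric] ennreal_mult[symmetric])
      have A: "(\<integral>\<^sup>+z. indicator {..(y + d) / 2} z * emeasure N {y - z<..y - z + d} \<partial>J)
        \<le> ennreal (s / a * K * C / d * (\<eta> * f y / s))"
        by (rule half_convolution_bound[OF J d(1) supp Jle' Nle f0 _ K0 C meas reg y2 Is]) (use s a in auto)
      have B: "(\<integral>\<^sup>+z. indicator {..(y + d) / 2} z * emeasure J {y - z<..y - z + d} \<partial>N)
        \<le> ennreal (K * (s / a) * C / d * (\<eta> * f y / s))"
        by (rule half_convolution_bound[OF N d(1) suppN Nle Jle' f0 K0 _ C meas reg y2 Is]) (use s a in auto)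
      text \<open>One of two summands with sum at most \<open>y + d\<close> is at most \<open>(y + d) / 2\<close>.\<close>
      interpret P: pair_prob_space J N ..
      have e1: "indicator {..(y + d) / 2} x * indicator {y - x<..y - x + d} z =
          (indicator {p. fst p \<le> (y + d) / 2 \<and> y < fst p + snd p \<and> fst p + snd p \<le> y + d} (x, z) :: ennreal)" for x z
        by (auto simp: indicator_def)
      have e2: "indicator {..(y + d) / 2} z * indicator {y - z<..y - z + d} x =
          (indicator {p. snd p \<le> (y + d) / 2 \<and> y < fst p + snd p \<and> fst p + snd p \<le> y + d} (x, z) :: ennreal)" for x z
        by (auto simp: indicator_def)
      have M1: "(\<lambda>(x, z). indicator {..(y + d) / 2} x * indicator {y - x<..y - x + d} z :: ennreal) \<in> borel_measurable (J \<Otimes>\<^sub>M N)"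
        unfolding e1 by measurable
      have M2: "(\<lambda>(x, z). indicator {..(y + d) / 2} z * indicator {y - z<..y - z + d} x :: ennreal) \<in> borel_measurable (J \<Otimes>\<^sub>M N)"
        unfolding e2 by measurable
      have "(\<integral>\<^sup>+x. emeasure N {z. x + z \<in> {y<..y + d}} \<partial>J) \<le>
        (\<integral>\<^sup>+x. (\<integral>\<^sup>+z. indicator {..(y + d) / 2} x * indicator {y - x<..y - x + d} z +
            indicator {..(y + d) / 2} z * indicator {y - z<..y - z + d} x \<partial>N) \<partial>J)"
      proof (rule nn_integral_mono)
        fix x
        have "emeasure N {z. x + z \<in> {y<..y + d}} = (\<integral>\<^sup>+z. indicator {z. x + z \<in> {y<..y + d}} z \<partial>N)"
          by (intro nn_integral_indicator[symmetric]) measurable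
        also have "\<dots> \<le> (\<integral>\<^sup>+z. indicator {..(y + d) / 2} x * indicator {y - x<..y - x + d} z +
            indicator {..(y + d) / 2} z * indicator {y - z<..y - z + d} x \<partial>N)"
          by (intro nn_integral_mono) (auto simp: indicator_def)
        finally show "emeasure N {z. x + z \<in> {y<..y + d}} \<le> (\<integral>\<^sup>+z. indicator {..(y + d) / 2} x * indicator {y - x<..y - x + d} z +
            indicator {..(y + d) / 2} z * indicator {y - z<..y - z + d} x \<partial>N)" .
      qed
      also have "\<dots> = (\<integral>\<^sup>+x. (\<integral>\<^sup>+z. indicator {..(y + d) / 2} x * indicator {y - x<..y - x + d} z \<partial>N) \<partial>J) +
         (\<integral>\<^sup>+x. (\<integral>\<^sup>+z. indicator {..(y + d) / 2} z * indicator {y - z<..y - z + d} x \<partial>N) \<partial>J)"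
      proof -
        have "(\<integral>\<^sup>+z. indicator {..(y + d) / 2} x * indicator {y - x<..y - x + d} z +
            indicator {..(y + d) / 2} z * indicator {y - z<..y - z + d} x \<partial>N) =
          (\<integral>\<^sup>+z. indicator {..(y + d) / 2} x * indicator {y - x<..y - x + d} z \<partial>N) +
          (\<integral>\<^sup>+z. indicator {..(y + d) / 2} z * indicator {y - z<..y - z + d} x \<partial>N)" for x
          using measurable_compose_Pair1[OF _ M1, of x] measurable_compose_Pair1[OF _ M2, of x]
          by (intro nn_integral_add) simp_all
        then show ?thesis
          using N.borel_measurable_nn_integral_fst[OF M1] N.borel_measurable_nn_integral_fst[OF M2]
          by (simp add: nn_integral_add)
      qed
      also have "(\<integral>\<^sup>+x. (\<integral>\<^sup>+z. indicator {..(y + d) / 2} x * indicator {y - x<..y - x + d} z \<partial>N) \<partial>J) =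
        (\<integral>\<^sup>+z. indicator {..(y + d) / 2} z * emeasure N {y - z<..y - z + d} \<partial>J)"
        by (intro nn_integral_cong nn_integral_cmult_indicator) simp
      also have "(\<integral>\<^sup>+x. (\<integral>\<^sup>+z. indicator {..(y + d) / 2} z * indicator {y - z<..y - z + d} x \<partial>N) \<partial>J) =
        (\<integral>\<^sup>+z. (\<integral>\<^sup>+x. indicator {..(y + d) / 2} z * indicator {y - z<..y - z + d} x \<partial>J) \<partial>N)"
        using P.Fubini'[OF M2] by simp
      also have "\<dots> = (\<integral>\<^sup>+z. indicator {..(y + d) / 2} z * emeasure J {y - z<..y - z + d} \<partial>N)"
        by (intro nn_integral_cong nn_integral_cmult_indicator) simp
      also note add_mono[OF A B]
      also have "ennreal (s / a * K * C / d * (\<eta> * f y / s)) + ennreal (K * (s / a) * C / d * (\<eta> * f y / s)) =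
          ennreal (s * q ^ Suc n / a ^ Suc (Suc n) * f y)"
        using s a K0 C d \<eta> f0[OF Suc.prems]
        by (subst ennreal_plus[symmetric]) (auto simp: K_def q_def field_simps)
      finally show ?thesis unfolding eq q_def .
    qed
  qed
qed


lemma conv_power_1:
  assumes J: "real_distribution J"
  shows "conv_power J (Suc 0) = J"
proof (rule measure_eqI)
  interpret J: real_distribution J by (rule J)
  show "sets (conv_power J (Suc 0)) = sets J" by simp
  fix B assume "B \<in> sets (conv_power J (Suc 0))"
  then have B[measurable]: "B \<in> sets borel" by simp
  have "emeasure (J \<star> return borel 0) B = (\<integral>\<^sup>+x. emeasure (return borel 0) {z. x + z \<in> B} \<partial>J)"
    by (intro emeasure_convolution_real J real_distribution_return B)
  also have "\<dots> = (\<integral>\<^sup>+x. indicator B x \<partial>J)"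
  proof (intro nn_integral_cong)
    fix x
    have "{z. x + z \<in> B} \<in> sets borel" by measurable
    then show "emeasure (return borel 0) {z. x + z \<in> B} = indicator B x" by (simp add: indicator_def)
  qed
  also have "\<dots> = emeasure J B" by simp
  finally show "emeasure (conv_power J (Suc 0)) B = emeasure J B" by simp
qed

text \<open>Only the event of exactly one jump is kept.\<close>

lemma compound_poisson_lower_bound:
  assumes a: "0 < a" and J: "real_distribution J" and \<phi>: "\<phi> \<in> borel_measurable borel"
  shows "ennreal (a * exp (-a)) * (\<integral>\<^sup>+x. \<phi> x \<partial>J) \<le> (\<integral>\<^sup>+x. \<phi> x \<partial>compound_poisson a J)"
proof -
  have "(\<Sum>n\<in>{Suc 0}. ennreal (a ^ n / fact n * exp (-a)) * (\<integral>\<^sup>+x. \<phi> x \<partial>conv_power J n))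
    \<le> (\<integral>\<^sup>+x. \<phi> x \<partial>compound_poisson a J)"
    unfolding nn_integral_compound_poisson[OF a J \<phi>] by (rule sum_le_suminf) auto
  then show ?thesis by (simp add: conv_power_1[OF J] del: conv_power.simps)
qed

text \<open>The powers of \<open>a\<close> cancel, and a geometric series with ratio
  \<open>2 * C * \<eta> / d\<close> remains, dominated by its one-jump term. The value 0 below
  \<open>h - d\<close> is recorded so that later estimates evaluate \<open>f\<close> at large
  arguments only.\<close>

lemma compound_poisson_local_bound:
  fixes f :: "real \<Rightarrow> real"
  assumes J: "real_distribution J" and d: "0 < d" "d \<le> h" and supp: "AE z in J. h < z"
    and a: "0 < a" and s: "0 < s" and C: "0 \<le> C" and \<eta>: "0 \<le> \<eta>"
    and Jle: "\<And>u. h - d \<le> u \<Longrightarrow> a * measure J {u<..u + d} \<le> s * f u"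
    and f0: "\<And>u. h - d \<le> u \<Longrightarrow> 0 \<le> f u"
    and meas: "(\<lambda>u. f u * indicator {h - d..} u) \<in> borel_measurable borel"
    and reg: "\<And>u v. h - d \<le> u \<Longrightarrow> u \<le> v \<Longrightarrow> v \<le> u + d \<Longrightarrow> f u \<le> C * f v"
    and I: "\<And>y. 2 * h - d \<le> y \<Longrightarrow>
      ennreal s * (\<integral>\<^sup>+u. indicator {h - d..(y + d) / 2} u * ennreal (f u * f (y - u)) \<partial>lborel) \<le> ennreal (\<eta> * f y)"
    and q: "2 * C * \<eta> / d < 1"
    and y: "0 \<le> y"
  shows "emeasure (compound_poisson a J) {y<..y + d} \<le>
    (if y < h - d then 0 else ennreal (s * f y / (1 - 2 * C * \<eta> / d)))"
proof -
  define q where "q = 2 * C * \<eta> / d"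
  have q: "0 \<le> q" "q < 1" using C \<eta> d q by (simp_all add: q_def)
  \<comment> \<open>The window starts at \<open>y \<ge> 0\<close> and is open on the left, so it
    misses the atom at 0 of the jump-free term, and the series may begin with one jump.\<close>
  have e: "emeasure (compound_poisson a J) {y<..y + d} =
    (\<Sum>n. ennreal (a ^ Suc n / fact (Suc n) * exp (-a)) * emeasure (conv_power J (Suc n)) {y<..y + d})"
    unfolding emeasure_compound_poisson[OF a J, of "{y<..y + d}", simplified]
    by (subst suminf_offset[where i=1]) (use y in \<open>simp_all del: fact_Suc\<close>)
  show ?thesis
  proof (cases "y < h - d")
    case True
    have "emeasure (conv_power J (Suc n)) {y<..y + d} = 0" for n
    proof -
      interpret N: real_distribution "conv_power J (Suc n)" by (intro real_distribution_conv_power J)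
      have "AE z in conv_power J (Suc n). z \<notin> {y<..y + d}"
        by (rule eventually_mono[OF AE_conv_power_Suc[OF J supp]]) (use d True in auto)
      then have "emeasure (conv_power J (Suc n)) {x. y < x \<and> x \<le> y + d} = 0"
        by (subst (asm) AE_iff_measurable[OF _ refl]) (auto simp del: conv_power.simps)
      then show ?thesis by (simp add: greaterThanAtMost_def greaterThan_def atMost_def Int_def del: conv_power.simps)
    qed
    then show ?thesis using True unfolding e by simp
  next
    case False
    have "emeasure (compound_poisson a J) {y<..y + d} \<le> (\<Sum>n. ennreal (s * f y * q ^ n))"
      unfolding e
    proof (intro suminf_le summableI)
      fix n
      have fy: "0 \<le> f y" using False f0 by auto
      have "ennreal (a ^ Suc n / fact (Suc n) * exp (-a)) * emeasure (conv_power J (Suc n)) {y<..y + d} \<le>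
        ennreal (a ^ Suc n / fact (Suc n) * exp (-a)) * ennreal (s * q ^ n / a ^ Suc n * f y)"
        unfolding q_def using False
        by (intro mult_left_mono conv_power_local_bound[OF J d supp a s C \<eta> Jle f0 meas reg I]) auto
      also have "\<dots> = ennreal ((exp (-a) / fact (Suc n)) * (s * f y * q ^ n))"
        using a s q fy by (subst ennreal_mult[symmetric]) (auto simp: field_simps)
      also have "\<dots> \<le> ennreal (1 * (s * f y * q ^ n))"
      proof (intro ennreal_leI mult_right_mono)
        have "exp (-a) \<le> 1" "1 \<le> (fact (Suc n) :: real)" using a fact_ge_1 by (auto simp del: fact_Suc)
        then have "exp (-a) \<le> fact (Suc n)" by linarith
        then show "exp (-a) / fact (Suc n) \<le> 1" by (simp add: divide_le_eq_1 del: fact_Suc)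
      qed (use s q fy in auto)
      finally show "ennreal (a ^ Suc n / fact (Suc n) * exp (-a)) * emeasure (conv_power J (Suc n)) {y<..y + d}
        \<le> ennreal (s * f y * q ^ n)" by simp
    qed
    also have "\<dots> = ennreal (s * f y * (1 / (1 - q)))"
      using q s False f0[of y] by (intro suminf_ennreal_eq sums_mult geometric_sums) auto
    finally show ?thesis using False by (simp add: q_def)
  qed
qed

section \<open>Splitting off the large jumps\<close>

text \<open>Jumps beyond \<open>r\<close> count linearly in \<open>y / r\<close> rather than by 1,
  since they are compensated as well. At \<open>r = 1 / l\<close> this dominates the exponential
  cumulant at rate \<open>l\<close>, up to a factor that depends on the truncation level.\<close>

definition trunc_var :: "real \<Rightarrow> real measure \<Rightarrow> real \<Rightarrow> real" where
  "trunc_var \<sigma> \<nu> r = \<sigma>\<^sup>2 / r\<^sup>2 + (LINT y|\<nu>. min ((y / r)\<^sup>2) \<bar>y / r\<bar>)"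

lemma integrable_min_scaled:
  fixes \<nu> :: "real measure"
  assumes [measurable_cong]: "sets \<nu> = sets borel" and int: "integrable \<nu> (\<lambda>y. min \<bar>y\<bar> (y\<^sup>2))"
  shows "integrable \<nu> (\<lambda>y. min ((k * y)\<^sup>2) \<bar>k * y\<bar>)"
proof (rule Bochner_Integration.integrable_bound)
  show "integrable \<nu> (\<lambda>y. (k\<^sup>2 + \<bar>k\<bar>) * min \<bar>y\<bar> (y\<^sup>2))" using int by simp
  show "AE y in \<nu>. norm (min ((k * y)\<^sup>2) \<bar>k * y\<bar>) \<le> norm ((k\<^sup>2 + \<bar>k\<bar>) * min \<bar>y\<bar> (y\<^sup>2))"
    by (intro AE_I2) (auto simp: min_def abs_mult power_mult_distrib distrib_right add_increasing add_increasing2)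
qed measurable

lemma trunc_var_nonneg: "0 \<le> trunc_var \<sigma> \<nu> r"
  unfolding trunc_var_def by (intro add_nonneg_nonneg integral_nonneg_AE AE_I2) auto

text \<open>The quadratic part scales by \<open>k^2\<close>, the linear part only by
  \<open>k\<close>. This permits passing between constant multiples of one scale.\<close>

lemma trunc_var_mono_scale:
  fixes \<nu> :: "real measure"
  assumes sets: "sets \<nu> = sets borel" and int: "integrable \<nu> (\<lambda>y. min \<bar>y\<bar> (y\<^sup>2))"
    and r: "0 < r" and k: "1 \<le> k"
  shows "trunc_var \<sigma> \<nu> (r / k) \<le> k\<^sup>2 * trunc_var \<sigma> \<nu> r"
proof -
  have "(LINT y|\<nu>. min ((y / (r / k))\<^sup>2) \<bar>y / (r / k)\<bar>) \<le> (LINT y|\<nu>. k\<^sup>2 * min ((y / r)\<^sup>2) \<bar>y / r\<bar>)"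
  proof (rule integral_mono)
    show "integrable \<nu> (\<lambda>y. min ((y / (r / k))\<^sup>2) \<bar>y / (r / k)\<bar>)"
      using integrable_min_scaled[OF sets int, of "k / r"] by (simp add: mult.commute)
    show "integrable \<nu> (\<lambda>y. k\<^sup>2 * min ((y / r)\<^sup>2) \<bar>y / r\<bar>)"
      using integrable_min_scaled[OF sets int, of "1 / r"] by simp
    fix y
    have "k * \<bar>y / r\<bar> \<le> k\<^sup>2 * \<bar>y / r\<bar>"
      using k by (intro mult_right_mono) (auto simp: power2_eq_square)
    then have "min (k\<^sup>2 * (y / r)\<^sup>2) (k * \<bar>y / r\<bar>) \<le> k\<^sup>2 * min ((y / r)\<^sup>2) \<bar>y / r\<bar>"
      by (subst mult_min_right) (auto intro: min.coboundedI2)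
    then show "min ((y / (r / k))\<^sup>2) \<bar>y / (r / k)\<bar> \<le> k\<^sup>2 * min ((y / r)\<^sup>2) \<bar>y / r\<bar>"
      using k by (simp add: abs_mult power_mult_distrib power_divide mult_ac)
  qed
  also have "\<dots> = k\<^sup>2 * (LINT y|\<nu>. min ((y / r)\<^sup>2) \<bar>y / r\<bar>)" by simp
  finally show ?thesis
    using k r by (simp add: trunc_var_def distrib_left power_divide mult.commute)
qed

text \<open>Multiplying by \<open>r\<close> turns the integrand into min(y^2 / r, |y|), which tends
  to 0 and is dominated for r \<ge> 1. This gain over the order 1 / r lets Chernoff's bound work for
  times of order x.\<close>

lemma trunc_var_sublinear:
  fixes \<nu> :: "real measure"
  assumes [measurable_cong]: "sets \<nu> = sets borel" and int: "integrable \<nu> (\<lambda>y. min \<bar>y\<bar> (y\<^sup>2))"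
  shows "((\<lambda>r. r * trunc_var \<sigma> \<nu> r) \<longlongrightarrow> 0) at_top"
proof -
  have "((\<lambda>r. LINT y|\<nu>. min (y\<^sup>2 / r) \<bar>y\<bar>) \<longlongrightarrow> (LINT y|\<nu>. 0)) at_top"
  proof (rule integral_dominated_convergence_at_top[where w="\<lambda>y. min \<bar>y\<bar> (y\<^sup>2)"])
    show "AE y in \<nu>. ((\<lambda>r. min (y\<^sup>2 / r) \<bar>y\<bar>) \<longlongrightarrow> 0) at_top"
    proof (rule AE_I2)
      fix y :: real
      have "((\<lambda>r. y\<^sup>2 / r) \<longlongrightarrow> 0) at_top"
        by (intro real_tendsto_divide_at_top[OF tendsto_const] filterlim_ident)
      then have "((\<lambda>r. min (y\<^sup>2 / r) \<bar>y\<bar>) \<longlongrightarrow> min 0 \<bar>y\<bar>) at_top" by (intro tendsto_intros)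
      then show "((\<lambda>r. min (y\<^sup>2 / r) \<bar>y\<bar>) \<longlongrightarrow> 0) at_top" by simp
    qed
    show "\<forall>\<^sub>F r in at_top. AE y in \<nu>. norm (min (y\<^sup>2 / r) \<bar>y\<bar>) \<le> min \<bar>y\<bar> (y\<^sup>2)"
      using eventually_ge_at_top[of "1::real"]
    proof eventually_elim
      fix r :: real assume r: "1 \<le> r"
      have "y\<^sup>2 / r \<le> y\<^sup>2" for y using r by (simp add: divide_le_eq mult_left_le mult_le_cancel_left1)
      then show "AE y in \<nu>. norm (min (y\<^sup>2 / r) \<bar>y\<bar>) \<le> min \<bar>y\<bar> (y\<^sup>2)"
        using r by (intro AE_I2) (auto simp: min_le_iff_disj)
    qed
  qed (use int in measurable)
  then have "((\<lambda>r. \<sigma>\<^sup>2 / r + (LINT y|\<nu>. min (y\<^sup>2 / r) \<bar>y\<bar>)) \<longlongrightarrow> 0 + 0) at_top"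
    by (intro tendsto_add real_tendsto_divide_at_top[OF tendsto_const] filterlim_ident) simp
  then have "((\<lambda>r. \<sigma>\<^sup>2 / r + (LINT y|\<nu>. min (y\<^sup>2 / r) \<bar>y\<bar>)) \<longlongrightarrow> 0) at_top" by simp
  then show ?thesis
  proof (rule Lim_transform_eventually)
    show "\<forall>\<^sub>F r in at_top. \<sigma>\<^sup>2 / r + (LINT y|\<nu>. min (y\<^sup>2 / r) \<bar>y\<bar>) = r * trunc_var \<sigma> \<nu> r"
      using eventually_gt_at_top[of "0::real"]
    proof eventually_elim
      fix r :: real assume r: "0 < r"
      have "r * min ((y / r)\<^sup>2) \<bar>y / r\<bar> = min (y\<^sup>2 / r) \<bar>y\<bar>" for y
        using r by (subst mult_min_right) (auto simp: power2_eq_square abs_mult)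
      then have "(LINT y|\<nu>. min (y\<^sup>2 / r) \<bar>y\<bar>) = r * (LINT y|\<nu>. min ((y / r)\<^sup>2) \<bar>y / r\<bar>)"
        by (simp only: integral_mult_right_zero[symmetric])
      then show "\<sigma>\<^sup>2 / r + (LINT y|\<nu>. min (y\<^sup>2 / r) \<bar>y\<bar>) = r * trunc_var \<sigma> \<nu> r"
        using r by (simp add: trunc_var_def distrib_left power2_eq_square)
    qed
  qed
qed

lemma emeasure_tail_finite:
  fixes \<nu> :: "real measure"
  assumes [measurable_cong]: "sets \<nu> = sets borel" and int: "integrable \<nu> (\<lambda>y. min \<bar>y\<bar> (y\<^sup>2))" and h: "0 < h"
  shows "emeasure \<nu> {h<..} < \<infinity>"
proof -
  define k where "k = min h (h\<^sup>2)"
  have k: "0 < k" using h by (simp add: k_def)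
  have "emeasure \<nu> {h<..} = (\<integral>\<^sup>+y. indicator {h<..} y \<partial>\<nu>)" by (simp add: assms(1))
  also have "\<dots> \<le> (\<integral>\<^sup>+y. ennreal (min \<bar>y\<bar> (y\<^sup>2) / k) \<partial>\<nu>)"
  proof (rule nn_integral_mono)
    fix y
    show "indicator {h<..} y \<le> ennreal (min \<bar>y\<bar> (y\<^sup>2) / k)"
    proof (cases "h < y")
      case True
      then have "h\<^sup>2 \<le> y\<^sup>2" using h by (intro power_mono) auto
      then have "k \<le> min \<bar>y\<bar> (y\<^sup>2)" using True h by (auto simp: k_def min_le_iff_disj)
      then show ?thesis using True k by simp
    qed simp
  qed
  also have "\<dots> < \<infinity>" using int k by (subst nn_integral_eq_integral) auto
  finally show ?thesis .
qed

lemma exp_cumulant_truncated_le: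
  fixes \<nu> :: "real measure"
  assumes sets: "sets \<nu> = sets borel" and int: "integrable \<nu> (\<lambda>y. min \<bar>y\<bar> (y\<^sup>2))"
    and l: "0 < l" and A: "l * h \<le> A" "0 \<le> A"
  shows "exp_cumulant \<sigma> (density \<nu> (indicator {..h})) l \<le> exp A * trunc_var \<sigma> \<nu> (1 / l)"
proof -
  note sets[measurable_cong]
  have "(LINT y|density \<nu> (indicator {..h}). exp (l * y) - 1 - l * y) =
      (LINT y|\<nu>. indicator {..h} y *\<^sub>R (exp (l * y) - 1 - l * y))"
    by (subst integral_density[symmetric]) (auto simp: ennreal_indicator[abs_def])
  also have "\<dots> \<le> (LINT y|\<nu>. exp A * min ((l * y)\<^sup>2) \<bar>l * y\<bar>)"
  proof (rule integral_mono')
    show "integrable \<nu> (\<lambda>y. exp A * min ((l * y)\<^sup>2) \<bar>l * y\<bar>)"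
      using integrable_min_scaled[OF sets int, of l] by simp
    fix y
    show "indicator {..h} y *\<^sub>R (exp (l * y) - 1 - l * y) \<le> exp A * min ((l * y)\<^sup>2) \<bar>l * y\<bar>"
    proof (cases "y \<le> h")
      case True
      then have "l * y \<le> l * h" using l by (intro mult_left_mono) auto
      then have "l * y \<le> A" using A by linarith
      then show ?thesis using True exp_remainder_bounds[of "l * y" A] A by simp
    qed simp
  qed simp
  also have "\<dots> = exp A * (LINT y|\<nu>. min ((l * y)\<^sup>2) \<bar>l * y\<bar>)" by simp
  finally have 1: "(LINT y|density \<nu> (indicator {..h}). exp (l * y) - 1 - l * y) \<le>
    exp A * (LINT y|\<nu>. min ((l * y)\<^sup>2) \<bar>l * y\<bar>)" .
  have "1 * (\<sigma>\<^sup>2 * l\<^sup>2 / 2) \<le> exp A * (\<sigma>\<^sup>2 * l\<^sup>2)"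
    using A by (intro mult_mono) auto
  with 1 show ?thesis
    by (simp add: exp_cumulant_def trunc_var_def distrib_left mult.commute power_divide)
qed


section \<open>Splitting a law at a jump level\<close>

definition jump_tail_law :: "real measure \<Rightarrow> real \<Rightarrow> real measure" where
  "jump_tail_law \<nu> h = density \<nu> (\<lambda>y. indicator {h<..} y / emeasure \<nu> {h<..})"

lemma jump_tail_law:
  fixes \<nu> :: "real measure"
  assumes sets: "sets \<nu> = sets borel" and int: "integrable \<nu> (\<lambda>y. min \<bar>y\<bar> (y\<^sup>2))" and h: "0 < h"
    and pos: "0 < measure \<nu> {h<..}"
  shows "real_distribution (jump_tail_law \<nu> h)" "AE y in jump_tail_law \<nu> h. h < y"
    "\<And>B. B \<in> sets borel \<Longrightarrow> measure \<nu> {h<..} * measure (jump_tail_law \<nu> h) B = measure \<nu> (B \<inter> {h<..})"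
    "\<And>f :: real \<Rightarrow> complex. f \<in> borel_measurable borel \<Longrightarrow>
      of_real (measure \<nu> {h<..}) * integral\<^sup>L (jump_tail_law \<nu> h) f = (CLINT y|\<nu>. indicator {h<..} y *\<^sub>R f y)"
proof -
  note sets[measurable_cong]
  have space: "space \<nu> = UNIV" using sets_eq_imp_space_eq[OF sets] by simp
  define k where "k = measure \<nu> {h<..}"
  have fin: "emeasure \<nu> {h<..} < \<infinity>" by (rule emeasure_tail_finite[OF sets int h])
  have k: "emeasure \<nu> {h<..} = ennreal k" "0 < k"
    using fin pos by (simp_all add: k_def emeasure_eq_ennreal_measure less_top)
  have J: "jump_tail_law \<nu> h = density \<nu> (\<lambda>y. ennreal (indicator {h<..} y / k))"
    unfolding jump_tail_law_def k(1) using k(2)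
    using divide_ennreal[of 1 k]
    by (intro arg_cong[where f="density \<nu>"] ext) (auto simp: indicator_def)
  have em: "emeasure (jump_tail_law \<nu> h) B = ennreal (measure \<nu> (B \<inter> {h<..}) / k)" if [measurable]: "B \<in> sets borel" for B
  proof -
    have "emeasure (jump_tail_law \<nu> h) B = (\<integral>\<^sup>+y. ennreal (indicator {h<..} y / k) * indicator B y \<partial>\<nu>)"
      unfolding J by (intro emeasure_density) auto
    also have "\<dots> = (\<integral>\<^sup>+y. ennreal (1 / k) * indicator (B \<inter> {h<..}) y \<partial>\<nu>)"
      by (intro nn_integral_cong) (auto simp: indicator_def)
    also have "\<dots> = ennreal (1 / k) * emeasure \<nu> (B \<inter> {h<..})"
      by (intro nn_integral_cmult_indicator) (simp add: sets)
    also have "emeasure \<nu> (B \<inter> {h<..}) = ennreal (measure \<nu> (B \<inter> {h<..}))"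
    proof -
      have "emeasure \<nu> (B \<inter> {h<..}) \<le> emeasure \<nu> {h<..}" by (intro emeasure_mono) (auto simp: sets)
      then show ?thesis using fin by (intro emeasure_eq_ennreal_measure) (auto simp: top_unique)
    qed
    finally show ?thesis using k(2) by (simp add: ennreal_mult[symmetric])
  qed
  show rd: "real_distribution (jump_tail_law \<nu> h)"
  proof (rule real_distributionI)
    have "emeasure (jump_tail_law \<nu> h) UNIV = 1" using em[of UNIV] k by (simp add: k_def)
    then show "prob_space (jump_tail_law \<nu> h)" by (intro prob_spaceI) (simp add: J space)
  qed (simp add: J sets)
  show "AE y in jump_tail_law \<nu> h. h < y"
    unfolding J by (subst AE_density) (auto simp: indicator_def)
  interpret JJ: real_distribution "jump_tail_law \<nu> h" by (rule rd)
  show "measure \<nu> {h<..} * measure (jump_tail_law \<nu> h) B = measure \<nu> (B \<inter> {h<..})" if "B \<in> sets borel" for B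
    using em[OF that] k(2) unfolding JJ.emeasure_eq_measure by (simp add: k_def[symmetric])
  show "of_real (measure \<nu> {h<..}) * integral\<^sup>L (jump_tail_law \<nu> h) f = (CLINT y|\<nu>. indicator {h<..} y *\<^sub>R f y)"
    if [measurable]: "f \<in> borel_measurable borel" for f :: "real \<Rightarrow> complex"
  proof -
    have "integral\<^sup>L (jump_tail_law \<nu> h) f = (CLINT y|\<nu>. (indicator {h<..} y / k) *\<^sub>R f y)"
      unfolding J by (subst integral_density) (use k in auto)
    also have "\<dots> = (CLINT y|\<nu>. of_real (1 / k) * (indicator {h<..} y *\<^sub>R f y))"
      by (intro Bochner_Integration.integral_cong) (auto simp: scaleR_conv_of_real)
    also have "\<dots> = of_real (1 / k) * (CLINT y|\<nu>. indicator {h<..} y *\<^sub>R f y)"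
      by (rule integral_mult_right_zero)
    finally show ?thesis using k(2) by (simp add: k_def[symmetric])
  qed
qed

lemma integrable_tail_identity:
  fixes \<nu> :: "real measure"
  assumes sets: "sets \<nu> = sets borel" and int: "integrable \<nu> (\<lambda>y. min \<bar>y\<bar> (y\<^sup>2))" and h: "0 < h"
  shows "integrable \<nu> (\<lambda>y. indicator {h<..} y * y)" "integrable \<nu> (\<lambda>y. indicator {h<..} y :: real)"
proof -
  note sets[measurable_cong]
  show "integrable \<nu> (\<lambda>y. indicator {h<..} y :: real)"
    using emeasure_tail_finite[OF assms] by (intro integrable_real_indicator) (auto simp: sets)
  show "integrable \<nu> (\<lambda>y. indicator {h<..} y * y)"
  proof (rule Bochner_Integration.integrable_bound)
    show "integrable \<nu> (\<lambda>y. (1 + 1 / h) * min \<bar>y\<bar> (y\<^sup>2))" using int by simp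
    show "AE y in \<nu>. norm (indicator {h<..} y * y) \<le> norm ((1 + 1 / h) * min \<bar>y\<bar> (y\<^sup>2))"
    proof (rule AE_I2)
      fix y
      show "norm (indicator {h<..} y * y) \<le> norm ((1 + 1 / h) * min \<bar>y\<bar> (y\<^sup>2))"
      proof (cases "h < y")
        case True
        then have "h * y \<le> y * y" using h by (intro mult_right_mono) auto
        then have "y \<le> 1 / h * y\<^sup>2" using h by (simp add: field_simps power2_eq_square)
        then have "y \<le> (1 + 1 / h) * y\<^sup>2" by (simp add: distrib_right add_increasing)
        moreover have "y \<le> (1 + 1 / h) * y" using h True by (simp add: distrib_right)
        ultimately show ?thesis using True h by (auto simp: min_def abs_mult)
      qed simp
    qed
  qed measurable
qed

text \<open>The compensated exponent splits into integrals over \<open>{..h}\<close> and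
  \<open>{h<..}\<close>. A compound Poisson law is not centred, so the compensator of the large
  jumps becomes a shift by \<open>s\<close> times their mean, while \<open>Z\<close> stays centred.
  Any pair with \<open>l * h \<le> A\<close> yields moments of \<open>Z\<close> in terms of
  \<open>trunc_var\<close> of \<nu> itself.\<close>

lemma levy_split:
  fixes \<nu> :: "real measure"
  assumes sets: "sets \<nu> = sets borel" and int: "integrable \<nu> (\<lambda>y. min \<bar>y\<bar> (y\<^sup>2))" and h: "0 < h" and s: "0 < s"
    and pos: "0 < measure \<nu> {h<..}" and \<mu>: "real_distribution \<mu>"
    and char_\<mu>: "\<And>u. char \<mu> u = exp (of_real s * levy_exponent \<sigma> \<nu> u)"
  shows "\<exists>Z. real_distribution Z \<and>
    (\<forall>\<phi>\<in>borel_measurable borel. (\<integral>\<^sup>+x. \<phi> x \<partial>\<mu>) = (\<integral>\<^sup>+z. \<integral>\<^sup>+w. \<phi> (z - s * (LINT y|\<nu>. indicator {h<..} y * y) + w)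
        \<partial>compound_poisson (s * measure \<nu> {h<..}) (jump_tail_law \<nu> h) \<partial>Z)) \<and>
    (\<forall>l A. 0 < l \<longrightarrow> l * h \<le> A \<longrightarrow> 0 \<le> A \<longrightarrow>
      (\<integral>\<^sup>+z. ennreal (exp (l * z) - 1 - l * z) \<partial>Z) \<le> ennreal (exp (s * exp A * trunc_var \<sigma> \<nu> (1 / l)) - 1) \<and>
      (\<integral>\<^sup>+z. ennreal (exp (l * z)) \<partial>Z) \<le> ennreal (exp (s * exp A * trunc_var \<sigma> \<nu> (1 / l))) \<and>
      (\<integral>\<^sup>+z. ennreal \<bar>z\<bar> \<partial>Z) \<le> ennreal (2 / l * exp (s * exp A * trunc_var \<sigma> \<nu> (1 / l))))"
proof -
  note sets[measurable_cong]
  define \<nu>' where "\<nu>' = density \<nu> (indicator {..h})"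
  define k c where "k = measure \<nu> {h<..}" and "c = (LINT y|\<nu>. indicator {h<..} y * y)"
  define J where "J = jump_tail_law \<nu> h"
  define a where "a = s * k"
  have a: "0 < a" using s pos by (simp add: a_def k_def)
  note J = jump_tail_law[OF sets int h pos, folded J_def k_def]
  have CP: "real_distribution (compound_poisson a J)" by (rule real_distribution_compound_poisson[OF J(1)])
  have "integrable \<nu>' (\<lambda>y. min \<bar>y\<bar> (y\<^sup>2))"
  proof -
    have "integrable \<nu> (\<lambda>y. indicator {..h} y *\<^sub>R min \<bar>y\<bar> (y\<^sup>2))"
      using int by (intro integrable_mult_indicator) (auto simp: sets)
    then show ?thesis unfolding \<nu>'_def ennreal_indicator[symmetric, abs_def]
      by (subst integrable_density) auto
  qed
  moreover have "AE y in \<nu>'. y \<le> h"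
    unfolding \<nu>'_def by (subst AE_density) (auto simp: indicator_def)
  moreover have "sets \<nu>' = sets borel" by (simp add: \<nu>'_def sets)
  ultimately obtain Z where Z: "real_distribution Z"
      "\<And>u. char Z u = exp (of_real s * levy_exponent \<sigma> \<nu>' u)"
      "\<And>l. l > 0 \<Longrightarrow> (\<integral>\<^sup>+z. ennreal (exp (l * z) - 1 - l * z) \<partial>Z) \<le> ennreal (exp (s * exp_cumulant \<sigma> \<nu>' l) - 1)"
      "\<And>l. l > 0 \<Longrightarrow> (\<integral>\<^sup>+z. ennreal (exp (l * z)) \<partial>Z) \<le> ennreal (exp (s * exp_cumulant \<sigma> \<nu>' l))"
      "\<And>l. l > 0 \<Longrightarrow> (\<integral>\<^sup>+z. ennreal \<bar>z\<bar> \<partial>Z) \<le> ennreal (2 / l * exp (s * exp_cumulant \<sigma> \<nu>' l))"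
    using spectrally_bounded_law_exists[of \<nu>' h s \<sigma>] s by auto
  have CPR: "real_distribution (return borel (- s * c) \<star> compound_poisson a J)"
    by (intro real_distribution_convolution CP real_distribution_return)
  have "char \<mu> = char (Z \<star> (return borel (- s * c) \<star> compound_poisson a J))"
  proof
    fix u
    have i1: "integrable \<nu> (\<lambda>y. indicator {h<..} y *\<^sub>R (iexp (u * y) - 1))"
    proof (rule Bochner_Integration.integrable_bound)
      show "integrable \<nu> (\<lambda>y. 2 * indicator {h<..} y :: real)"
        using integrable_tail_identity(2)[OF sets int h] by simp
      have "norm (iexp (u * y) - 1) \<le> 2" for y
        using norm_triangle_ineq4[of "iexp (u * y)" 1] by simp
      then show "AE y in \<nu>. norm (indicator {h<..} y *\<^sub>R (iexp (u * y) - 1)) \<le> norm (2 * indicator {h<..} y :: real)"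
        by (intro AE_I2) (simp add: indicator_def)
    qed measurable
    have i2: "integrable \<nu> (\<lambda>y. \<i> * of_real (u * (indicator {h<..} y * y)))"
      using integrable_tail_identity(1)[OF sets int h] by (intro integrable_mult_right integrable_of_real) simp
    have i3: "integrable \<nu> (\<lambda>y. indicator {..h} y *\<^sub>R (iexp (u * y) - 1 - \<i> * of_real (u * y)))"
      by (intro integrable_mult_indicator integrable_iexp_remainder[OF sets int]) (auto simp: sets)
    have "(CLINT y|\<nu>. iexp (u * y) - 1 - \<i> * of_real (u * y)) =
        (CLINT y|\<nu>. indicator {..h} y *\<^sub>R (iexp (u * y) - 1 - \<i> * of_real (u * y)) +
          (indicator {h<..} y *\<^sub>R (iexp (u * y) - 1) - \<i> * of_real (u * (indicator {h<..} y * y))))"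
      by (intro Bochner_Integration.integral_cong) (auto simp: indicator_def)
    also have "\<dots> = (CLINT y|\<nu>. indicator {..h} y *\<^sub>R (iexp (u * y) - 1 - \<i> * of_real (u * y))) +
       ((CLINT y|\<nu>. indicator {h<..} y *\<^sub>R (iexp (u * y) - 1)) - (CLINT y|\<nu>. \<i> * of_real (u * (indicator {h<..} y * y))))"
      using i1 i2 i3 by simp
    also have "(CLINT y|\<nu>. \<i> * of_real (u * (indicator {h<..} y * y))) = \<i> * of_real (u * c)"
      unfolding c_def by (simp only: integral_mult_right_zero integral_complex_of_real)
    also have "(CLINT y|\<nu>. indicator {h<..} y *\<^sub>R (iexp (u * y) - 1)) = of_real k * (char J u - 1)"
    proof -
      interpret J: real_distribution J by (rule J)
      have "integrable J (\<lambda>y. iexp (u * y))" by (rule J.integrable_const_bound[where B=1]) auto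
      then have "char J u - 1 = (CLINT y|J. iexp (u * y) - 1)"
        by (simp add: char_def J.prob_space del: J.space_eq_univ)
      then show ?thesis using J(4)[of "\<lambda>y. iexp (u * y) - 1"] by simp
    qed
    also have "(CLINT y|\<nu>. indicator {..h} y *\<^sub>R (iexp (u * y) - 1 - \<i> * of_real (u * y))) =
        (CLINT y|\<nu>'. iexp (u * y) - 1 - \<i> * of_real (u * y))"
      unfolding \<nu>'_def ennreal_indicator[symmetric, abs_def] by (subst integral_density) auto
    finally have E: "levy_exponent \<sigma> \<nu> u = levy_exponent \<sigma> \<nu>' u + (of_real k * (char J u - 1) - \<i> * of_real (u * c))"
      by (simp add: levy_exponent_def)
    show "char \<mu> u = char (Z \<star> (return borel (- s * c) \<star> compound_poisson a J)) u"
      unfolding char_\<mu> char_convolution[OF Z(1) CPR] char_convolution[OF real_distribution_return CP]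
        char_return char_compound_poisson[OF a J(1)] Z(2) E
      by (simp add: a_def exp_add[symmetric] algebra_simps)
  qed
  then have eq: "\<mu> = (Z \<star> (return borel (- s * c) \<star> compound_poisson a J))"
    by (intro Levy_uniqueness \<mu> real_distribution_convolution Z CPR)
  have "(\<integral>\<^sup>+x. \<phi> x \<partial>\<mu>) = (\<integral>\<^sup>+z. \<integral>\<^sup>+w. \<phi> (z - s * c + w) \<partial>compound_poisson a J \<partial>Z)"
    if [measurable]: "\<phi> \<in> borel_measurable borel" for \<phi> :: "real \<Rightarrow> ennreal"
  proof -
    interpret C: real_distribution "compound_poisson a J" by (rule CP)
    have m2: "(\<lambda>x. \<integral>\<^sup>+w. \<phi> (z + (x + w)) \<partial>compound_poisson a J) \<in> borel_measurable borel" for z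
      by (rule C.borel_measurable_nn_integral) measurable
    have "(\<integral>\<^sup>+x. \<phi> x \<partial>\<mu>) = (\<integral>\<^sup>+z. \<integral>\<^sup>+v. \<phi> (z + v) \<partial>(return borel (- s * c) \<star> compound_poisson a J) \<partial>Z)"
      unfolding eq by (intro nn_integral_convolution_real Z CPR that)
    also have "\<dots> = (\<integral>\<^sup>+z. \<integral>\<^sup>+x. \<integral>\<^sup>+w. \<phi> (z + (x + w)) \<partial>compound_poisson a J \<partial>return borel (- s * c) \<partial>Z)"
      by (intro nn_integral_cong nn_integral_convolution_real CP real_distribution_return) measurable
    also have "\<dots> = (\<integral>\<^sup>+z. \<integral>\<^sup>+w. \<phi> (z - s * c + w) \<partial>compound_poisson a J \<partial>Z)"
      using m2 by (intro nn_integral_cong, subst nn_integral_return) (auto simp: algebra_simps)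
    finally show ?thesis .
  qed
  moreover have "(\<integral>\<^sup>+z. ennreal (exp (l * z) - 1 - l * z) \<partial>Z) \<le> ennreal (exp (s * exp A * trunc_var \<sigma> \<nu> (1 / l)) - 1) \<and>
      (\<integral>\<^sup>+z. ennreal (exp (l * z)) \<partial>Z) \<le> ennreal (exp (s * exp A * trunc_var \<sigma> \<nu> (1 / l))) \<and>
      (\<integral>\<^sup>+z. ennreal \<bar>z\<bar> \<partial>Z) \<le> ennreal (2 / l * exp (s * exp A * trunc_var \<sigma> \<nu> (1 / l)))"
    if "0 < l" "l * h \<le> A" "0 \<le> A" for l A
  proof -
    have "s * exp_cumulant \<sigma> \<nu>' l \<le> s * exp A * trunc_var \<sigma> \<nu> (1 / l)"
      using exp_cumulant_truncated_le[OF sets int that, of \<sigma>] s unfolding \<nu>'_def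
      by (simp add: mult.assoc mult_left_mono)
    then have "exp (s * exp_cumulant \<sigma> \<nu>' l) \<le> exp (s * exp A * trunc_var \<sigma> \<nu> (1 / l))" by simp
    then show ?thesis using Z(3-5)[OF that(1)] that(1)
      by (auto intro!: order.trans[OF Z(3)] order.trans[OF Z(4)] order.trans[OF Z(5)] ennreal_leI divide_right_mono)
  qed
  ultimately show ?thesis using Z(1) unfolding a_def J_def k_def c_def by blast
qed

lemma nn_integral_jump_tail_law:
  fixes \<nu> :: "real measure"
  assumes sets[measurable_cong]: "sets \<nu> = sets borel" and [measurable]: "\<phi> \<in> borel_measurable borel"
  shows "(\<integral>\<^sup>+y. \<phi> y \<partial>jump_tail_law \<nu> h) = (\<integral>\<^sup>+y. indicator {h<..} y / emeasure \<nu> {h<..} * \<phi> y \<partial>\<nu>)"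
  unfolding jump_tail_law_def by (rule nn_integral_density) measurable

text \<open>Extending the compensator to all jumps changes only the drift, by the integral of the
  jumps outside [-1, 1]. The mean at time 1 then forces the resulting drift to vanish.\<close>

lemma zero_mean_char:
  fixes X :: "real \<Rightarrow> 'a \<Rightarrow> real"
  assumes L: "levy_process M X" and m0: "zero_mean M X" and T: "has_levy_triplet M X \<gamma> \<sigma> \<nu>"
    and int: "integrable \<nu> (\<lambda>y. min \<bar>y\<bar> (y\<^sup>2))" and t: "0 \<le> t"
  shows "char (distr M borel (X t)) u = exp (of_real t * levy_exponent \<sigma> \<nu> u)"
proof -
  interpret levy_process M X by fact
  have sets[measurable_cong]: "sets \<nu> = sets borel"
    using T by (simp add: has_levy_triplet_def levy_measure_def)
  define g where "g y = y * indicator (- {-1..1}) y" for y :: real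
  have [measurable]: "g \<in> borel_measurable borel" unfolding g_def[abs_def] by measurable
  have g: "integrable \<nu> g"
  proof (rule Bochner_Integration.integrable_bound[OF int])
    show "AE y in \<nu>. norm (g y) \<le> norm (min \<bar>y\<bar> (y\<^sup>2))"
    proof (rule AE_I2)
      fix y :: real
      show "norm (g y) \<le> norm (min \<bar>y\<bar> (y\<^sup>2))"
      proof (cases "y \<in> {-1..1}")
        case False
        then have "1 < \<bar>y\<bar>" by auto
        then have "\<bar>y\<bar> * 1 \<le> \<bar>y\<bar> * \<bar>y\<bar>" by (intro mult_left_mono) auto
        with False show ?thesis by (simp add: g_def min_def power2_eq_square)
      qed (simp add: g_def)
    qed
  qed measurable
  define \<beta> where "\<beta> = \<gamma> + (LINT y|\<nu>. g y)"
  have ch: "char (distr M borel (X t)) u = exp (\<i> * of_real (\<beta> * t * u) + of_real t * levy_exponent \<sigma> \<nu> u)"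
    if "0 \<le> t" for t u
  proof -
    have "(CLINT y|\<nu>. iexp (u * y) - 1 - \<i> * of_real (u * y * indicator {-1..1} y)) =
      (CLINT y|\<nu>. (iexp (u * y) - 1 - \<i> * of_real (u * y)) + \<i> * of_real (u * g y))"
      by (intro Bochner_Integration.integral_cong) (auto simp: g_def indicator_def)
    also have "\<dots> = (CLINT y|\<nu>. iexp (u * y) - 1 - \<i> * of_real (u * y)) + (CLINT y|\<nu>. \<i> * of_real (u * g y))"
      using g by (intro Bochner_Integration.integral_add integrable_iexp_remainder[OF sets int]) auto
    also have "(CLINT y|\<nu>. \<i> * of_real (u * g y)) = \<i> * of_real (u * (LINT y|\<nu>. g y))"
      by (simp only: integral_mult_right_zero integral_complex_of_real)
    finally show ?thesis using T that
      by (auto simp: has_levy_triplet_def \<beta>_def levy_exponent_def algebra_simps)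
  qed
  have \<beta>: "\<beta> = 0"
  proof -
    have [measurable]: "X 1 \<in> borel_measurable M" by (rule rv) simp
    interpret D: real_distribution "distr M borel (X 1)" by (intro real_distribution_distr) simp
    have X1: "integrable M (X 1)" "(LINT \<omega>|M. X 1 \<omega>) = 0"
      using m0 by (auto simp: zero_mean_def)
    have "(\<integral>x. x \<partial>distr M borel (X 1)) = \<beta>"
      using X1 by (intro D.mean_of_levy_exponent[OF _ sets int, of _ 1 \<sigma>]) (auto simp: integrable_distr_eq ch)
    then show ?thesis using X1 by (simp add: integral_distr)
  qed
  show ?thesis using ch[OF t, of u] by (simp add: \<beta>)
qed


lemma powr_at_top:
  fixes p :: real
  assumes "0 < p"
  shows "filterlim (\<lambda>x. x powr p) at_top at_top"
  unfolding filterlim_at_top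
proof
  fix Z :: real
  show "\<forall>\<^sub>F x in at_top. Z \<le> x powr p"
    using eventually_ge_at_top[of "max 1 Z powr (1 / p)"]
  proof eventually_elim
    fix x assume x: "max 1 Z powr (1 / p) \<le> x"
    have "Z \<le> max 1 Z" by simp
    also have "\<dots> = (max 1 Z powr (1 / p)) powr p" using assms by (simp add: powr_powr)
    also have "\<dots> \<le> x powr p" using x assms by (intro powr_mono2) auto
    finally show "Z \<le> x powr p" .
  qed
qed

section \<open>Truncated variance at the fluctuation scale\<close>

lemma continuous_levy_exponent:
  assumes [measurable_cong]: "sets \<nu> = sets borel" and int: "integrable \<nu> (\<lambda>y. min \<bar>y\<bar> (y\<^sup>2))"
  shows "isCont (levy_exponent \<sigma> \<nu>) u"
  unfolding continuous_at_sequentially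
proof safe
  fix X assume X: "X \<longlonglongrightarrow> u"
  then have "Bseq X" by (intro convergent_imp_Bseq) (auto simp: convergent_def)
  then obtain K where K: "0 < K" "\<And>n. \<bar>X n\<bar> \<le> K" by (auto simp: Bseq_def)
  have "(\<lambda>n. CLINT y|\<nu>. iexp (X n * y) - 1 - \<i> * of_real (X n * y)) \<longlonglongrightarrow>
      (CLINT y|\<nu>. iexp (u * y) - 1 - \<i> * of_real (u * y))"
  proof (rule integral_dominated_convergence[where w="\<lambda>y. (K\<^sup>2 + 2 * K) * min \<bar>y\<bar> (y\<^sup>2)"])
    show "AE y in \<nu>. norm (iexp (X n * y) - 1 - \<i> * of_real (X n * y)) \<le> (K\<^sup>2 + 2 * K) * min \<bar>y\<bar> (y\<^sup>2)" for n
    proof (rule AE_I2)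
      fix y
      have "(X n)\<^sup>2 \<le> K\<^sup>2" using K(2)[of n] K(1) by (metis abs_ge_zero power2_abs power_mono)
      then have "((X n)\<^sup>2 + 2 * \<bar>X n\<bar>) * min \<bar>y\<bar> (y\<^sup>2) \<le> (K\<^sup>2 + 2 * K) * min \<bar>y\<bar> (y\<^sup>2)"
        using K(2)[of n] by (intro mult_right_mono) auto
      with norm_iexp_remainder_le[of "X n" y]
      show "norm (iexp (X n * y) - 1 - \<i> * of_real (X n * y)) \<le> (K\<^sup>2 + 2 * K) * min \<bar>y\<bar> (y\<^sup>2)"
        by linarith
    qed
    show "AE y in \<nu>. (\<lambda>n. iexp (X n * y) - 1 - \<i> * of_real (X n * y)) \<longlonglongrightarrow> iexp (u * y) - 1 - \<i> * of_real (u * y)"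
      by (intro AE_I2 tendsto_intros X)
    show "integrable \<nu> (\<lambda>y. (K\<^sup>2 + 2 * K) * min \<bar>y\<bar> (y\<^sup>2))" using int by simp
  qed measurable
  then show "(levy_exponent \<sigma> \<nu> \<circ> X) \<longlonglongrightarrow> levy_exponent \<sigma> \<nu> u"
    unfolding levy_exponent_def comp_def
    by (intro tendsto_diff tendsto_of_real tendsto_divide tendsto_mult tendsto_power tendsto_const X) auto
qed

text \<open>Along a path on which \<open>exp \<circ> \<Phi>\<close> stays close to 1, a continuous logarithm starting at 0 is
  the principal one.\<close>

lemma continuous_log_bounded:
  fixes \<Phi> :: "real \<Rightarrow> complex"
  assumes cont: "continuous_on {0..w} \<Phi>" and \<Phi>0: "\<Phi> 0 = 0" and w: "0 \<le> w"
    and close: "\<And>v. 0 \<le> v \<Longrightarrow> v \<le> w \<Longrightarrow> norm (exp (\<Phi> v) - 1) \<le> 1 / 4"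
  shows "-1 \<le> Re (\<Phi> w)" "\<bar>Im (\<Phi> w)\<bar> \<le> 2"
proof -
  have re: "3 / 4 \<le> Re (exp (\<Phi> v))" if "0 \<le> v" "v \<le> w" for v
    using close[OF that] abs_Re_le_cmod[of "exp (\<Phi> v) - 1"] by simp
  have "3 / 4 \<le> exp (Re (\<Phi> w))"
    using re[OF w order_refl] complex_Re_le_cmod[of "exp (\<Phi> w)"] by simp
  moreover have "exp (-1) \<le> (1 / 2 :: real)"
    using exp_ge_add_one_self[of 1] by (simp add: exp_minus field_simps)
  ultimately have "exp (-1) \<le> exp (Re (\<Phi> w))" by linarith
  then show "-1 \<le> Re (\<Phi> w)" by simp
  show "\<bar>Im (\<Phi> w)\<bar> \<le> 2"
  proof (rule ccontr)
    assume "\<not> \<bar>Im (\<Phi> w)\<bar> \<le> 2"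
    \<comment> \<open>A larger imaginary part would have crossed pi / 2 on the way, where the cosine
      makes the real part of \<open>exp (\<Phi> v)\<close> vanish.\<close>
    then have "pi / 2 \<le> \<bar>Im (\<Phi> w)\<bar>" using pi_less_4 by linarith
    moreover have "continuous_on {0..w} (\<lambda>v. \<bar>Im (\<Phi> v)\<bar>)" by (intro continuous_intros cont)
    ultimately obtain v where v: "0 \<le> v" "v \<le> w" "\<bar>Im (\<Phi> v)\<bar> = pi / 2"
      using IVT'[of "\<lambda>v. \<bar>Im (\<Phi> v)\<bar>" 0 "pi / 2" w] w by (auto simp: \<Phi>0)
    have "cos (Im (\<Phi> v)) = cos \<bar>Im (\<Phi> v)\<bar>" by (simp add: abs_if)
    then have "Re (exp (\<Phi> v)) = 0" using v(3) by (simp add: Re_exp)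
    with re[OF v(1,2)] show False by simp
  qed
qed

text \<open>Taylor's formula of order four: for |p| \<le> 2 the term p^4 / 24 is at most p^2 / 6,
  which leaves p^2 / 3 of p^2 / 2.\<close>

lemma one_minus_cos_lower:
  fixes p :: real
  assumes "\<bar>p\<bar> \<le> 2"
  shows "p\<^sup>2 \<le> 3 * (1 - cos p)"
proof -
  have "cos p \<le> 1 - p\<^sup>2 / 2 + p ^ 4 / 24"
  proof -
    obtain t where t: "cos p = (\<Sum>m<4. cos_coeff m * p ^ m) + cos (t + 1 / 2 * real 4 * pi) / fact 4 * p ^ 4"
      using Maclaurin_cos_expansion[of p 4] by auto
    have four: "{..<4::nat} = {0, 1, 2, 3}" by auto
    have "(\<Sum>m<4. cos_coeff m * p ^ m) = 1 - p\<^sup>2 / 2"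
      unfolding four by (simp add: cos_coeff_def fact_numeral)
    moreover have "cos (t + 1 / 2 * real 4 * pi) / fact 4 * p ^ 4 \<le> 1 / fact 4 * p ^ 4"
      by (intro mult_right_mono divide_right_mono) auto
    ultimately show ?thesis using t by (simp add: fact_numeral)
  qed
  moreover have "p ^ 4 \<le> 4 * p\<^sup>2"
  proof -
    have "\<bar>p\<bar>\<^sup>2 \<le> 2\<^sup>2" using assms by (intro power_mono) auto
    then have "p\<^sup>2 * p\<^sup>2 \<le> 4 * p\<^sup>2" by (intro mult_right_mono) auto
    then show ?thesis by (simp add: power2_eq_square power4_eq_xxxx)
  qed
  ultimately show ?thesis by (simp add: field_simps)
qed

text \<open>The right side consists of the integrands of the real and the imaginary part of the
  exponent. For |p| \<le> 2 the cosine term suffices; beyond, the second term is at least 2 |p| - 2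
  \<ge> |p|.\<close>

lemma cos_sin_lower: "min (p\<^sup>2) \<bar>p\<bar> \<le> 3 * (1 - cos p) + 2 * (\<bar>p\<bar> - sin \<bar>p\<bar>)" for p :: real
proof -
  have "sin \<bar>p\<bar> \<le> \<bar>p\<bar>" by (rule sin_x_le_x) simp
  moreover have "cos p \<le> 1" "sin \<bar>p\<bar> \<le> 1" by simp_all
  moreover have "p\<^sup>2 \<le> 3 * (1 - cos p)" if "\<bar>p\<bar> \<le> 2" by (rule one_minus_cos_lower[OF that])
  ultimately show ?thesis by (smt (verit))
qed

text \<open>On the positive half-line the odd part is controlled by the even one: up to 1 it is of
  order p^2, and beyond 1 it is at most 2 p \<le> 2 p^\<alpha>, to be paid for by the one-sided
  moment.\<close>

lemma sin_upper:
  fixes p \<alpha> :: real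
  assumes "0 < p" "1 \<le> \<alpha>"
  shows "p - sin p \<le> 3 * (1 - cos p) + (if 1 < p then 2 * p powr \<alpha> else 0)"
proof (cases "1 < p")
  case True
  have "p powr 1 \<le> p powr \<alpha>" using True assms by (intro powr_mono) auto
  then have "p \<le> p powr \<alpha>" using assms by simp
  moreover have "-1 \<le> sin p" "cos p \<le> 1" by auto
  ultimately have "p - sin p \<le> 3 * (1 - cos p) + 2 * p powr \<alpha>" using True by (smt (verit))
  then show ?thesis using True by simp
next
  case False
  have "norm (iexp p - 1 - \<i> * of_real p) \<le> \<bar>p\<bar>\<^sup>2 / 2"
    using iexp_approx1[of p 1] by (simp add: algebra_simps power2_eq_square)
  moreover have "Im (iexp p - 1 - \<i> * of_real p) = sin p - p" by (simp add: Im_exp)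
  ultimately have "p - sin p \<le> p\<^sup>2 / 2"
    using abs_Im_le_cmod[of "iexp p - 1 - \<i> * of_real p"] by simp
  moreover have "p\<^sup>2 \<le> 3 * (1 - cos p)" using False assms by (intro one_minus_cos_lower) auto
  moreover have "cos p \<le> 1" by simp
  moreover have "a \<le> q / 2 \<Longrightarrow> q \<le> 3 * (1 - c) \<Longrightarrow> c \<le> 1 \<Longrightarrow> a \<le> 3 * (1 - c)" for a q c :: real
    by (simp add: field_simps)
  ultimately have "p - sin p \<le> 3 * (1 - cos p)" by blast
  then show ?thesis using False by simp
qed

text \<open>The standing condition at one window length \<open>d\<close>, in the form in which it is
  applied: limits superior become statements about all large arguments, and the process is
  represented by the family \<open>\<mu>\<close> of its marginal laws. The length is a parameter
  because the blocks that make up longer intervals get shorter with the prescribed error.\<close>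

locale local_big_jump =
  fixes \<nu> :: "real measure" and \<sigma> \<alpha> d :: real and b :: "real \<Rightarrow> real" and \<mu> :: "real \<Rightarrow> real measure"
    and f :: "real \<Rightarrow> real"
  assumes sets_\<nu>[measurable_cong, simp]: "sets \<nu> = sets borel"
    and int_\<nu>: "integrable \<nu> (\<lambda>y. min \<bar>y\<bar> (y\<^sup>2))"
    and \<alpha>: "1 < \<alpha>" "\<alpha> \<le> 2" and d: "0 < d"
    and f_def: "\<And>x. f x = measure \<nu> {x<..x + d}"
    and \<mu>: "\<And>s. 0 < s \<Longrightarrow> real_distribution (\<mu> s)"
    and char_\<mu>: "\<And>s u. 0 < s \<Longrightarrow> char (\<mu> s) u = exp (of_real s * levy_exponent \<sigma> \<nu> u)"
    and moment: "integrable (\<mu> 1) (\<lambda>x. max x 0 powr \<alpha>)"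
    and b_pos: "\<And>t. 0 \<le> t \<Longrightarrow> 0 < b t"
    and b_mono: "\<exists>t0. mono_on {t0..} b"
    and b_half: "\<exists>C>0. \<forall>\<^sub>F x in at_top. b x \<le> C * b (x / 2)"
    and b_lower: "\<exists>c>0. \<forall>\<^sub>F x in at_top. c * x powr (1 / \<alpha>) \<le> b x"
    and b_sublinear: "((\<lambda>t. b t / t) \<longlongrightarrow> 0) at_top"
    and tight: "\<And>\<epsilon>. 0 < \<epsilon> \<Longrightarrow> \<exists>K>0. \<forall>\<^sub>F t in at_top. measure (\<mu> t) {x. K * b t \<le> \<bar>x\<bar>} \<le> \<epsilon>"
    and almost_dec: "\<exists>c>0. \<exists>x0>0. \<forall>x y. x0 \<le> x \<longrightarrow> x \<le> y \<longrightarrow> c * f y \<le> f x"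
    and f_class: "(\<lambda>x. x powr \<alpha> * f x) \<in> subexponential \<union> O_regularly_varying"
    and insens: "\<And>K \<epsilon>. 0 \<le> K \<Longrightarrow> 0 < \<epsilon> \<Longrightarrow>
      \<forall>\<^sub>F x in at_top. \<forall>y. \<bar>y\<bar> \<le> K * b x \<longrightarrow> \<bar>f (x - y) / f x - 1\<bar> \<le> \<epsilon>"
begin

section \<open>Positivity, tails and moments of the Levy measure\<close>

lemma f_nonneg: "0 \<le> f x" by (simp add: f_def)

lemma f_eventually_pos: "\<forall>\<^sub>F x in at_top. 0 < f x"
proof -
  have "\<forall>\<^sub>F x in at_top. 0 < x powr \<alpha> * f x"
    using f_class by (auto simp: subexponential_def O_regularly_varying_def)
  then show ?thesis by (rule eventually_mono) (simp add: zero_less_mult_iff)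
qed

lemma tail_finite: "0 < h \<Longrightarrow> emeasure \<nu> {h<..} < \<infinity>"
  by (rule emeasure_tail_finite[OF sets_\<nu> int_\<nu>])

lemma f_le_tail: "0 < x \<Longrightarrow> f x \<le> measure \<nu> {x<..}"
  unfolding f_def measure_def using tail_finite[of x]
  by (intro enn2real_mono emeasure_mono) auto

lemma tail_pos:
  assumes "0 < h" shows "0 < measure \<nu> {h<..}"
proof -
  obtain x where x: "h < x" "0 < f x"
    using eventually_conj[OF eventually_gt_at_top[of h] f_eventually_pos]
    by (auto simp: eventually_at_top_linorder)
  have "f x \<le> measure \<nu> {h<..}"
    unfolding f_def measure_def using tail_finite[OF assms] x
    by (intro enn2real_mono emeasure_mono) auto
  with x show ?thesis by linarith
qed

text \<open>If exactly one jump exceeds 1, that jump is larger than \<open>2 * R\<close>, and the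
  rest of X_1 is at least \<open>- R\<close>, then X_1 is at least half of the jump. For suitable
  \<open>R\<close> the rest satisfies this with positive probability, so the moment of X_1 bounds
  that of the jumps.\<close>

lemma nu_moment: "integrable \<nu> (\<lambda>y. indicator {1<..} y * y powr \<alpha>)"
proof -
  have one: "(0::real) < 1" by simp
  define k where "k = measure \<nu> {1<..}"
  define c where "c = (LINT y|\<nu>. indicator {1<..} y * y)"
  define J where "J = jump_tail_law \<nu> 1"
  have k: "0 < k" using tail_pos[OF one] by (simp add: k_def)
  have ek: "emeasure \<nu> {1<..} = ennreal k"
    using tail_finite[OF one] by (simp add: k_def emeasure_eq_ennreal_measure less_top)
  note J = jump_tail_law[OF sets_\<nu> int_\<nu> one tail_pos[OF one], folded J_def]
  interpret J: real_distribution J by (rule J)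
  obtain Z where Z: "real_distribution Z"
    and eq: "\<And>\<phi>. \<phi> \<in> borel_measurable borel \<Longrightarrow> (\<integral>\<^sup>+x. \<phi> x \<partial>\<mu> 1) = (\<integral>\<^sup>+z. \<integral>\<^sup>+w. \<phi> (z - c + w) \<partial>compound_poisson k J \<partial>Z)"
    using levy_split[OF sets_\<nu> int_\<nu> one one tail_pos[OF one] \<mu>[OF one] char_\<mu>[OF one]]
    unfolding J_def k_def c_def by auto
  interpret Z: real_distribution Z by (rule Z)
  define \<phi> where "\<phi> x = ennreal (max x 0 powr \<alpha>)" for x :: real
  have [measurable]: "\<phi> \<in> borel_measurable borel" unfolding \<phi>_def by measurable
  have fin: "(\<integral>\<^sup>+x. \<phi> x \<partial>\<mu> 1) < \<infinity>"
    unfolding \<phi>_def using moment by (subst nn_integral_eq_integral) auto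
  obtain R where R: "1 \<le> R" "0 < measure Z {z. c - R \<le> z}"
  proof -
    have "(\<lambda>n. measure Z {z. c - real n \<le> z}) \<longlonglongrightarrow> measure Z (\<Union>n. {z. c - real n \<le> z})"
      by (intro Z.finite_Lim_measure_incseq) (auto simp: incseq_def)
    also have "(\<Union>n. {z. c - real n \<le> z}) = UNIV"
    proof -
      have "\<exists>n. c - real n \<le> z" for z
        using real_arch_simple[of "c - z"] by (auto simp: algebra_simps)
      then show ?thesis by auto
    qed
    finally have "(\<lambda>n. measure Z {z. c - real n \<le> z}) \<longlonglongrightarrow> 1" using Z.prob_space by simp
    then have "\<forall>\<^sub>F n in sequentially. 0 < measure Z {z. c - real n \<le> z}"
      by (rule order_tendstoD) simp
    then have "\<forall>\<^sub>F n in sequentially. 0 < measure Z {z. c - real n \<le> z} \<and> 1 \<le> n"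
      using eventually_ge_at_top[of 1] by (rule eventually_conj)
    then obtain n where "0 < measure Z {z. c - real n \<le> z}" "1 \<le> n"
      by (auto simp: eventually_sequentially)
    then show thesis by (intro that[of "real n"]) auto
  qed
  define I where "I = (\<integral>\<^sup>+w. indicator {2 * R<..} w * ennreal (w powr \<alpha>) \<partial>J)"
  define r where "r = (1 / 2) powr \<alpha>"
  have r: "0 < r" by (simp add: r_def)
  have "ennreal (r * (k * exp (-k))) * I * ennreal (measure Z {z. c - R \<le> z}) =
      (\<integral>\<^sup>+z. ennreal (r * (k * exp (-k))) * I * indicator {z. c - R \<le> z} z \<partial>Z)"
    by (subst nn_integral_cmult_indicator) (auto simp: Z.emeasure_eq_measure)
  also have "\<dots> \<le> (\<integral>\<^sup>+z. \<integral>\<^sup>+w. \<phi> (z - c + w) \<partial>compound_poisson k J \<partial>Z)"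
  proof (intro nn_integral_mono)
    fix z
    show "ennreal (r * (k * exp (-k))) * I * indicator {z. c - R \<le> z} z \<le> (\<integral>\<^sup>+w. \<phi> (z - c + w) \<partial>compound_poisson k J)"
    proof (cases "c - R \<le> z")
      case True
      have "ennreal r * I = (\<integral>\<^sup>+w. ennreal r * (indicator {2 * R<..} w * ennreal (w powr \<alpha>)) \<partial>J)"
        unfolding I_def by (subst nn_integral_cmult) auto
      also have "\<dots> \<le> (\<integral>\<^sup>+w. \<phi> (z - c + w) \<partial>J)"
      proof (intro nn_integral_mono)
        fix w
        show "ennreal r * (indicator {2 * R<..} w * ennreal (w powr \<alpha>)) \<le> \<phi> (z - c + w)"
        proof (cases "2 * R < w")
          case w: True
          have "(1 / 2 * w) powr \<alpha> \<le> max (z - c + w) 0 powr \<alpha>"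
            using True w R \<alpha> by (intro powr_mono2) auto
          moreover have "(1 / 2 * w) powr \<alpha> = r * w powr \<alpha>"
            unfolding r_def using w R by (intro powr_mult)
          ultimately show ?thesis using w r by (simp add: \<phi>_def ennreal_mult[symmetric] ennreal_leI)
        qed simp
      qed
      finally have "ennreal (k * exp (-k)) * (ennreal r * I) \<le> ennreal (k * exp (-k)) * (\<integral>\<^sup>+w. \<phi> (z - c + w) \<partial>J)"
        by (rule mult_left_mono) simp
      also have "\<dots> \<le> (\<integral>\<^sup>+w. \<phi> (z - c + w) \<partial>compound_poisson k J)"
        by (rule compound_poisson_lower_bound[OF k J(1)]) measurable
      finally show ?thesis using True k r by (simp add: ennreal_mult' mult_ac)
    qed simp
  qed
  also have "\<dots> < \<infinity>" using fin eq[of \<phi>] by simp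
  finally have "I < \<infinity>"
    using R(2) r k by (auto simp: ennreal_mult_less_top ennreal_mult_eq_top_iff less_top[symmetric])
  have "(\<integral>\<^sup>+y. indicator {2 * R<..} y * ennreal (y powr \<alpha>) \<partial>\<nu>) = ennreal k * I"
  proof -
    have "I = (\<integral>\<^sup>+y. indicator {1<..} y / ennreal k * (indicator {2 * R<..} y * ennreal (y powr \<alpha>)) \<partial>\<nu>)"
      unfolding I_def J_def by (subst nn_integral_jump_tail_law) (auto simp: ek)
    also have "\<dots> = (\<integral>\<^sup>+y. ennreal (1 / k) * (indicator {2 * R<..} y * ennreal (y powr \<alpha>)) \<partial>\<nu>)"
      using R k divide_ennreal[of 1 k] by (intro nn_integral_cong) (auto simp: indicator_def)
    also have "\<dots> = ennreal (1 / k) * (\<integral>\<^sup>+y. indicator {2 * R<..} y * ennreal (y powr \<alpha>) \<partial>\<nu>)"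
      by (subst nn_integral_cmult) auto
    finally show ?thesis using k by (simp add: mult.assoc[symmetric] ennreal_mult[symmetric])
  qed
  with \<open>I < \<infinity>\<close> have fin2: "(\<integral>\<^sup>+y. indicator {2 * R<..} y * ennreal (y powr \<alpha>) \<partial>\<nu>) < \<infinity>"
    by (simp add: ennreal_mult_less_top)
  show ?thesis
  proof (rule integrableI_nonneg)
    have "(\<integral>\<^sup>+y. ennreal (indicator {1<..} y * y powr \<alpha>) \<partial>\<nu>) \<le>
      (\<integral>\<^sup>+y. ennreal ((2 * R) powr \<alpha>) * indicator {1<..} y + indicator {2 * R<..} y * ennreal (y powr \<alpha>) \<partial>\<nu>)"
    proof (intro nn_integral_mono)
      fix y
      show "ennreal (indicator {1<..} y * y powr \<alpha>) \<le>
        ennreal ((2 * R) powr \<alpha>) * indicator {1<..} y + indicator {2 * R<..} y * ennreal (y powr \<alpha>)"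
      proof (cases "1 < y \<and> y \<le> 2 * R")
        case True
        then have "y powr \<alpha> \<le> (2 * R) powr \<alpha>" using \<alpha> by (intro powr_mono2) auto
        with True show ?thesis by (simp add: ennreal_leI)
      qed (use R in \<open>auto simp: indicator_def\<close>)
    qed
    also have "\<dots> = ennreal ((2 * R) powr \<alpha>) * emeasure \<nu> {1<..} + (\<integral>\<^sup>+y. indicator {2 * R<..} y * ennreal (y powr \<alpha>) \<partial>\<nu>)"
      by (subst nn_integral_add) (auto simp: nn_integral_cmult_indicator)
    also have "\<dots> < \<infinity>" using fin2 by (simp add: ek ennreal_mult_less_top)
    finally show "(\<integral>\<^sup>+y. ennreal (indicator {1<..} y * y powr \<alpha>) \<partial>\<nu>) < \<infinity>" .
  qed auto
qed

text \<open>Tightness keeps the characteristic function near 1 at frequencies up to a small multiple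
  \<open>w\<close> of 1 / b(t), so \<open>t\<close> times the exponent is bounded there. Its real
  part bounds the integral of 1 - cos(w y). Its imaginary part bounds only the signed integral of w
  y - sin(w y), in which positive and negative jumps may cancel; the \<alpha>-th moment of the
  positive jumps rules this out.\<close>

lemma trunc_var_at_b: "\<exists>C>0. \<forall>\<^sub>F x in at_top. x * trunc_var \<sigma> \<nu> (b x) \<le> C"
proof -
  obtain K where K: "0 < K" and tightK: "\<forall>\<^sub>F t in at_top. measure (\<mu> t) {x. K * b t \<le> \<bar>x\<bar>} \<le> 1 / 16"
    using tight[of "1 / 16"] by auto
  obtain c where c: "0 < c" and bc: "\<forall>\<^sub>F x in at_top. c * x powr (1 / \<alpha>) \<le> b x"
    using b_lower by auto
  \<comment> \<open>The constants fit the allowance 1 / 4 of \<open>continuous_log_bounded\<close>: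
    2 * (1 / 16) from outside \<open>K * b t\<close> and \<open>u * K \<le> 1 / 8\<close> from
    inside.\<close>
  define u where "u = min 1 (1 / (8 * K))"
  have u: "0 < u" "u \<le> 1" "u * K \<le> 1 / 8" using K by (auto simp: u_def min_def field_simps)
  define M where "M = (LINT y|\<nu>. indicator {1<..} y * y powr \<alpha>)"
  have M: "0 \<le> M" unfolding M_def by (intro integral_nonneg_AE AE_I2) auto
  \<comment> \<open>Here 21 = 15 + 4 + 2, from the real part, the imaginary part and the Gaussian
    term; the other summand comes from the large positive jumps.\<close>
  define C0 where "C0 = 21 + 8 * M / c powr \<alpha>"
  have b1: "\<forall>\<^sub>F x in at_top. 1 \<le> b x"
  proof -
    have "filterlim (\<lambda>x. c * x powr (1 / \<alpha>)) at_top at_top"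
      using c \<alpha> by (intro filterlim_tendsto_pos_mult_at_top[OF tendsto_const] powr_at_top) auto
    then have "\<forall>\<^sub>F x in at_top. 1 \<le> c * x powr (1 / \<alpha>)" by (simp add: filterlim_at_top)
    with bc show ?thesis by eventually_elim linarith
  qed
  have "\<forall>\<^sub>F t in at_top. t * trunc_var \<sigma> \<nu> (b t / u) \<le> C0"
    using tightK bc b1 eventually_gt_at_top[of "0::real"]
  proof eventually_elim
    fix t :: real assume tK: "measure (\<mu> t) {x. K * b t \<le> \<bar>x\<bar>} \<le> 1 / 16"
      and bt: "c * t powr (1 / \<alpha>) \<le> b t" and b1: "1 \<le> b t" and t: "0 < t"
    interpret D: real_distribution "\<mu> t" by (rule \<mu>[OF t])
    define w where "w = u / b t"
    have w: "0 < w" "w \<le> 1" using u b1 by (auto simp: w_def divide_le_eq)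
    define \<Phi> where "\<Phi> v = of_real t * levy_exponent \<sigma> \<nu> v" for v
    have close: "norm (exp (\<Phi> v) - 1) \<le> 1 / 4" if v: "0 \<le> v" "v \<le> w" for v
    proof -
      have i: "integrable (\<mu> t) (\<lambda>x. iexp (v * x))"
        by (rule D.integrable_const_bound[where B=1]) auto
      have "exp (\<Phi> v) - 1 = (CLINT x|\<mu> t. iexp (v * x) - 1)"
        using i char_\<mu>[OF t, of v] by (simp add: char_def \<Phi>_def D.prob_space del: D.space_eq_univ)
      also have "norm \<dots> \<le> (LINT x|\<mu> t. norm (iexp (v * x) - 1))" by (rule integral_norm_bound)
      also have "\<dots> \<le> (LINT x|\<mu> t. 2 * indicator {x. K * b t \<le> \<bar>x\<bar>} x + 1 / 8)"
      proof (rule integral_mono)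
        show "norm (iexp (v * x) - 1) \<le> 2 * indicator {x. K * b t \<le> \<bar>x\<bar>} x + 1 / 8" for x
        proof (cases "K * b t \<le> \<bar>x\<bar>")
          case True
          have "norm (iexp (v * x) - 1) \<le> 2"
            using norm_triangle_ineq4[of "iexp (v * x)" 1] by simp
          with True show ?thesis by simp
        next
          case False
          have "norm (iexp (v * x) - 1) \<le> \<bar>v * x\<bar>" using iexp_approx1[of "v * x" 0] by simp
          also have "\<dots> = v * \<bar>x\<bar>" using v by (simp add: abs_mult)
          also have "\<dots> \<le> w * (K * b t)" using False v w by (intro mult_mono) auto
          also have "\<dots> = u * K" using b1 by (simp add: w_def)
          also have "\<dots> \<le> 1 / 8" by (rule u)
          finally show ?thesis using False by simp
        qed
      qed (use i in \<open>auto intro!: integrable_norm Bochner_Integration.integrable_diff Bochner_Integration.integrable_add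
            integrable_mult_right integrable_real_indicator simp: D.emeasure_eq_measure\<close>)
      also have "\<dots> = 2 * measure (\<mu> t) {x. K * b t \<le> \<bar>x\<bar>} + 1 / 8"
        by (subst Bochner_Integration.integral_add)
          (auto simp: D.prob_space D.emeasure_eq_measure simp del: D.space_eq_univ)
      also have "\<dots> \<le> 1 / 4" using tK by linarith
      finally show ?thesis .
    qed
    have cont: "continuous_on {0..w} \<Phi>"
      unfolding \<Phi>_def
      by (intro continuous_intros continuous_at_imp_continuous_on ballI continuous_levy_exponent sets_\<nu> int_\<nu>)
    have \<Phi>0: "\<Phi> 0 = 0" by (simp add: \<Phi>_def levy_exponent_def)
    note bounds = continuous_log_bounded[OF cont \<Phi>0 less_imp_le[OF w(1)] close]
    have ii: "integrable \<nu> (\<lambda>y. iexp (w * y) - 1 - \<i> * of_real (w * y))"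
      by (rule integrable_iexp_remainder[OF sets_\<nu> int_\<nu>])
    define A where "A = (LINT y|\<nu>. 1 - cos (w * y))"
    define S where "S = (LINT y|\<nu>. w * y - sin (w * y))"
    have iA: "integrable \<nu> (\<lambda>y. 1 - cos (w * y))"
      using integrable_Re[OF ii] by (simp add: Re_exp Im_exp) (metis (no_types, lifting) Bochner_Integration.integrable_cong integrable_minus minus_diff_eq)
    have iS: "integrable \<nu> (\<lambda>y. w * y - sin (w * y))"
      using integrable_Im[OF ii] by (simp add: Re_exp Im_exp) (metis (no_types, lifting) Bochner_Integration.integrable_cong integrable_minus minus_diff_eq)
    define L where "L = (CLINT y|\<nu>. iexp (w * y) - 1 - \<i> * of_real (w * y))"
    have ReL: "Re L = - A"
      unfolding A_def L_def integral_minus[symmetric] integral_Re[OF ii, symmetric]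
      by (intro Bochner_Integration.integral_cong) (auto simp: Re_exp)
    have ImL: "Im L = - S"
      unfolding S_def L_def integral_minus[symmetric] integral_Im[OF ii, symmetric]
      by (intro Bochner_Integration.integral_cong) (auto simp: Im_exp)
    have \<Phi>w: "\<Phi> w = of_real t * (L - of_real (\<sigma>\<^sup>2 * w\<^sup>2 / 2))"
      unfolding \<Phi>_def levy_exponent_def L_def ..
    have A0: "0 \<le> A" unfolding A_def by (intro integral_nonneg_AE AE_I2) simp
    have tA: "t * A + t * (\<sigma>\<^sup>2 * w\<^sup>2 / 2) \<le> 1"
      using bounds(1) by (simp add: \<Phi>w ReL algebra_simps)
    \<comment> \<open>\<open>S\<close> will occur with a negative sign in \<open>key\<close>, so a
      lower bound on it is what counts.\<close>
    have tS: "- (t * S) \<le> 2"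
      using bounds(2) by (simp add: \<Phi>w ImL abs_le_iff)
    have tA1: "t * A \<le> 1" using tA t by (smt (verit) mult_nonneg_nonneg zero_le_power2 divide_nonneg_pos)
    have t\<sigma>: "t * (\<sigma>\<^sup>2 * w\<^sup>2) \<le> 2" using tA A0 t by (smt (verit) mult_nonneg_nonneg field_sum_of_halves distrib_left)
    have im: "integrable \<nu> (\<lambda>y. (w powr \<alpha>) * (indicator {1<..} y * y powr \<alpha>))" using nu_moment by simp
    \<comment> \<open>Write A, D, W for the three terms on the right. For \<open>y > 0\<close>, the
      bound 3 A + 2 D equals 3 A + 4 D - 2 D, and D \<le> 3 A + 2 W turns it into 15 A - 2 D + 8 W.
      For \<open>y \<le> 0\<close> the odd term already has the right sign.\<close>
    have key: "min ((w * y)\<^sup>2) \<bar>w * y\<bar> \<le>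
      15 * (1 - cos (w * y)) - 2 * (w * y - sin (w * y)) + 8 * ((w powr \<alpha>) * (indicator {1<..} y * y powr \<alpha>))" for y
    proof (cases "0 < y")
      case True
      have "1 < w * y \<Longrightarrow> 1 < y"
        using mult_right_mono[OF w(2) less_imp_le[OF True]] by linarith
      then have "(if 1 < w * y then 2 * (w * y) powr \<alpha> else 0) \<le> 2 * ((w powr \<alpha>) * (indicator {1<..} y * y powr \<alpha>))"
        using w True by (auto simp: powr_mult)
      moreover have "w * y - sin (w * y) \<le> 3 * (1 - cos (w * y)) + (if 1 < w * y then 2 * (w * y) powr \<alpha> else 0)"
        using sin_upper[of "w * y" \<alpha>] w True \<alpha> by auto
      moreover have "min ((w * y)\<^sup>2) \<bar>w * y\<bar> \<le> 3 * (1 - cos (w * y)) + 2 * (w * y - sin (w * y))"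
        using cos_sin_lower[of "w * y"] True w by (simp add: abs_mult)
      moreover have "P \<le> 2 * W \<Longrightarrow> D \<le> 3 * A + P \<Longrightarrow> m \<le> 3 * A + 2 * D \<Longrightarrow> m \<le> 15 * A - 2 * D + 8 * W"
        for m A D P W :: real by linarith
      ultimately show ?thesis by blast
    next
      case False
      then have wy: "w * y \<le> 0" using w by (simp add: mult_nonneg_nonpos)
      have "min ((w * y)\<^sup>2) \<bar>w * y\<bar> \<le> 3 * (1 - cos (w * y)) - 2 * (w * y - sin (w * y))"
        using cos_sin_lower[of "w * y"] wy by (simp add: abs_of_nonpos)
      moreover have "cos (w * y) \<le> 1" by simp
      moreover have "0 \<le> (w powr \<alpha>) * (indicator {1<..} y * y powr \<alpha>)" by simp
      ultimately show ?thesis by (smt (verit))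
    qed
    have "(LINT y|\<nu>. min ((w * y)\<^sup>2) \<bar>w * y\<bar>) \<le>
      (LINT y|\<nu>. 15 * (1 - cos (w * y)) - 2 * (w * y - sin (w * y)) + 8 * ((w powr \<alpha>) * (indicator {1<..} y * y powr \<alpha>)))"
      by (intro integral_mono integrable_min_scaled[OF sets_\<nu> int_\<nu>] key Bochner_Integration.integrable_add
          Bochner_Integration.integrable_diff integrable_mult_right iA iS im)
    also have "\<dots> = 15 * A - 2 * S + 8 * (w powr \<alpha> * M)"
      using iA iS im unfolding A_def S_def M_def
      by (simp only: Bochner_Integration.integral_add Bochner_Integration.integral_diff integral_mult_right_zero
        Bochner_Integration.integrable_diff integrable_mult_right)
    finally have "t * (LINT y|\<nu>. min ((w * y)\<^sup>2) \<bar>w * y\<bar>) \<le> t * (15 * A - 2 * S + 8 * (w powr \<alpha> * M))"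
      using t by (intro mult_left_mono) auto
    also have "\<dots> = 15 * (t * A) + 2 * (- (t * S)) + 8 * M * (t * w powr \<alpha>)" by (simp add: algebra_simps)
    also have "\<dots> \<le> 15 * 1 + 2 * 2 + 8 * M * (1 / c powr \<alpha>)"
    proof (intro add_mono mult_left_mono tA1 tS)
      \<comment> \<open>The lower bound of order t^(1/\<alpha>) on \<open>b\<close> makes the
        contribution \<open>t * w powr \<alpha>\<close> of the moment bounded.\<close>
      have "w \<le> 1 / (c * t powr (1 / \<alpha>))"
        unfolding w_def using bt b1 u c t by (intro frac_le) auto
      then have "w powr \<alpha> \<le> (1 / (c * t powr (1 / \<alpha>))) powr \<alpha>"
        using w \<alpha> by (intro powr_mono2) auto
      also have "\<dots> = 1 / (c powr \<alpha> * t)"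
        using c t \<alpha> by (simp add: powr_divide powr_mult powr_powr)
      finally have "t * w powr \<alpha> \<le> t * (1 / (c powr \<alpha> * t))" using t by (intro mult_left_mono) auto
      then show "t * w powr \<alpha> \<le> 1 / c powr \<alpha>" using t by simp
    qed (use M in auto)
    finally have I: "t * (LINT y|\<nu>. min ((w * y)\<^sup>2) \<bar>w * y\<bar>) \<le> 19 + 8 * M / c powr \<alpha>" by simp
    have "t * trunc_var \<sigma> \<nu> (b t / u) = t * (\<sigma>\<^sup>2 * w\<^sup>2) + t * (LINT y|\<nu>. min ((w * y)\<^sup>2) \<bar>w * y\<bar>)"
      using b1 u by (simp add: trunc_var_def w_def power_divide distrib_left mult.commute)
    then show "t * trunc_var \<sigma> \<nu> (b t / u) \<le> C0" using I t\<sigma> by (simp add: C0_def)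
  qed
  then have "\<forall>\<^sub>F x in at_top. x * trunc_var \<sigma> \<nu> (b x) \<le> (1 / u)\<^sup>2 * C0"
    using eventually_gt_at_top[of "0::real"]
  proof eventually_elim
    fix t :: real assume *: "t * trunc_var \<sigma> \<nu> (b t / u) \<le> C0" and t: "0 < t"
    \<comment> \<open>Returning from the scale \<open>b t / u\<close> to \<open>b t\<close> costs
      the square of \<open>1 / u\<close>.\<close>
    have "trunc_var \<sigma> \<nu> ((b t / u) / (1 / u)) \<le> (1 / u)\<^sup>2 * trunc_var \<sigma> \<nu> (b t / u)"
      using b_pos[of t] t u by (intro trunc_var_mono_scale sets_\<nu> int_\<nu>) auto
    then have "t * trunc_var \<sigma> \<nu> (b t) \<le> t * ((1 / u)\<^sup>2 * trunc_var \<sigma> \<nu> (b t / u))"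
      using t u by (intro mult_left_mono) auto
    also have "\<dots> = (1 / u)\<^sup>2 * (t * trunc_var \<sigma> \<nu> (b t / u))" by simp
    also have "\<dots> \<le> (1 / u)\<^sup>2 * C0" by (intro mult_left_mono *) simp
    finally show "t * trunc_var \<sigma> \<nu> (b t) \<le> (1 / u)\<^sup>2 * C0" .
  qed
  moreover have "0 < (1 / u)\<^sup>2 * C0" using u M c by (auto simp: C0_def intro!: mult_pos_pos add_pos_nonneg)
  ultimately show ?thesis by blast
qed

section \<open>The local tail function\<close>

text \<open>Almost monotonicity carries positivity at some later point back to every point beyond
  \<open>R\<close>.\<close>

lemma f_upper: "\<exists>C\<ge>1. \<exists>R\<ge>1. (\<forall>x\<ge>R. 0 < f x) \<and> (\<forall>x y. R \<le> x \<longrightarrow> x \<le> y \<longrightarrow> f y \<le> C * f x)"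
proof -
  obtain c x0 where c: "0 < c" "0 < x0" "\<And>x y. x0 \<le> x \<Longrightarrow> x \<le> y \<Longrightarrow> c * f y \<le> f x"
    using almost_dec by blast
  define C where "C = max 1 (1 / c)"
  define R where "R = max 1 x0"
  have up: "f y \<le> C * f x" if "R \<le> x" "x \<le> y" for x y
  proof -
    have "f y \<le> 1 / c * f x" using c(3)[of x y] that c(1) by (simp add: R_def field_simps)
    also have "\<dots> \<le> C * f x" by (intro mult_right_mono f_nonneg) (simp add: C_def)
    finally show ?thesis .
  qed
  moreover have "0 < f x" if "R \<le> x" for x
  proof -
    obtain y where "x \<le> y" "0 < f y"
      using eventually_conj[OF eventually_ge_at_top[of x] f_eventually_pos]
      by (auto simp: eventually_at_top_linorder)
    with up[OF that \<open>x \<le> y\<close>] have "0 < C * f x" by linarith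
    then show ?thesis by (simp add: C_def zero_less_mult_iff)
  qed
  ultimately show ?thesis by (intro exI[of _ C] exI[of _ R] conjI) (auto simp: C_def R_def)
qed

lemma b_at_top: "filterlim b at_top at_top"
proof -
  obtain c where c: "0 < c" and bc: "\<forall>\<^sub>F x in at_top. c * x powr (1 / \<alpha>) \<le> b x"
    using b_lower by auto
  have "filterlim (\<lambda>x. c * x powr (1 / \<alpha>)) at_top at_top"
    using c \<alpha> by (intro filterlim_tendsto_pos_mult_at_top[OF tendsto_const] powr_at_top) auto
  then show ?thesis by (rule filterlim_at_top_mono) (rule bc)
qed

lemma insens_factor:
  assumes "0 \<le> K" "0 < \<epsilon>"
  shows "\<forall>\<^sub>F x in at_top. \<forall>y. \<bar>y\<bar> \<le> K * b x \<longrightarrow> (1 - \<epsilon>) * f x \<le> f (x - y) \<and> f (x - y) \<le> (1 + \<epsilon>) * f x"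
  using insens[OF assms] f_eventually_pos
proof eventually_elim
  case (elim x)
  show ?case
  proof (intro allI impI)
    fix y assume "\<bar>y\<bar> \<le> K * b x"
    then have "\<bar>f (x - y) / f x - 1\<bar> \<le> \<epsilon>" using elim by blast
    then have "1 - \<epsilon> \<le> f (x - y) / f x" "f (x - y) / f x \<le> 1 + \<epsilon>" by linarith+
    then show "(1 - \<epsilon>) * f x \<le> f (x - y) \<and> f (x - y) \<le> (1 + \<epsilon>) * f x"
      using elim(2) by (simp add: field_simps)
  qed
qed

lemma insens_bounded:
  assumes "0 \<le> L" "0 < \<epsilon>"
  shows "\<forall>\<^sub>F x in at_top. \<forall>y. \<bar>y\<bar> \<le> L \<longrightarrow> (1 - \<epsilon>) * f x \<le> f (x - y) \<and> f (x - y) \<le> (1 + \<epsilon>) * f x"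
proof -
  have "\<forall>\<^sub>F x in at_top. 1 \<le> b x" using b_at_top by (simp add: filterlim_at_top)
  with insens_factor[OF assms] show ?thesis
  proof eventually_elim
    case (elim x)
    then have "L * 1 \<le> L * b x" using assms by (intro mult_left_mono) auto
    then show ?case using elim(1) by auto
  qed
qed

section \<open>Moment tails, decay and growth of the local tail\<close>

definition T where "T h = (LINT y|\<nu>. indicator {h<..} y * y powr \<alpha>)"

lemma T_integrable: "1 \<le> h \<Longrightarrow> integrable \<nu> (\<lambda>y. indicator {h<..} y * y powr \<alpha>)"
  by (rule Bochner_Integration.integrable_bound[OF nu_moment]) (auto simp: indicator_def)

lemma T_nonneg: "0 \<le> T h"
  unfolding T_def by (intro integral_nonneg_AE AE_I2) auto

lemma T_tendsto: "(T \<longlongrightarrow> 0) at_top"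
proof -
  have "((\<lambda>h. LINT y|\<nu>. indicator {h<..} y * y powr \<alpha>) \<longlongrightarrow> (LINT y|\<nu>. 0)) at_top"
  proof (rule integral_dominated_convergence_at_top[where w="\<lambda>y. indicator {1<..} y * y powr \<alpha>"])
    show "AE y in \<nu>. ((\<lambda>h. indicator {h<..} y * y powr \<alpha>) \<longlongrightarrow> 0) at_top"
    proof (rule AE_I2)
      fix y
      have "\<forall>\<^sub>F h in at_top. indicator {h<..} y * y powr \<alpha> = 0"
        using eventually_ge_at_top[of y] by eventually_elim (simp add: indicator_def)
      then show "((\<lambda>h. indicator {h<..} y * y powr \<alpha>) \<longlongrightarrow> 0) at_top" by (rule tendsto_eventually)
    qed
    show "\<forall>\<^sub>F h in at_top. AE y in \<nu>. norm (indicator {h<..} y * y powr \<alpha>) \<le> indicator {1<..} y * y powr \<alpha>"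
      using eventually_ge_at_top[of "1::real"]
      by eventually_elim (auto simp: indicator_def)
  qed (use nu_moment in auto)
  then show ?thesis by (simp add: T_def[abs_def])
qed

text \<open>Markov's inequality for the two quantities that the splitting produces: the intensity of
  the large jumps and their mean.\<close>

lemma tail_le_T:
  assumes "1 \<le> h"
  shows "measure \<nu> {h<..} * h powr \<alpha> \<le> T h" "(LINT y|\<nu>. indicator {h<..} y * y) * h powr (\<alpha> - 1) \<le> T h"
proof -
  have h: "0 < h" using assms by linarith
  have "measure \<nu> {h<..} * h powr \<alpha> = (LINT y|\<nu>. indicator {h<..} y * h powr \<alpha>)" by simp
  also have "\<dots> \<le> T h" unfolding T_def
    using integrable_tail_identity(2)[OF sets_\<nu> int_\<nu> h] T_integrable[OF assms] assms \<alpha>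
    by (intro integral_mono integrable_mult_left) (auto simp: indicator_def intro!: powr_mono2)
  finally show "measure \<nu> {h<..} * h powr \<alpha> \<le> T h" .
  have "(LINT y|\<nu>. indicator {h<..} y * y) * h powr (\<alpha> - 1) = (LINT y|\<nu>. indicator {h<..} y * y * h powr (\<alpha> - 1))" by simp
  also have "\<dots> \<le> T h" unfolding T_def
  proof (intro integral_mono T_integrable assms)
    show "integrable \<nu> (\<lambda>y. indicator {h<..} y * y * h powr (\<alpha> - 1))"
      using integrable_tail_identity(1)[OF sets_\<nu> int_\<nu> h] by simp
    fix y
    show "indicator {h<..} y * y * h powr (\<alpha> - 1) \<le> indicator {h<..} y * y powr \<alpha>"
    proof (cases "h < y")
      case True
      then have "h powr (\<alpha> - 1) \<le> y powr (\<alpha> - 1)" using h \<alpha> by (intro powr_mono2) auto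
      then have "y * h powr (\<alpha> - 1) \<le> y * y powr (\<alpha> - 1)" using True h by (intro mult_left_mono) auto
      also have "\<dots> = y powr \<alpha>" using True h powr_add[of y 1 "\<alpha> - 1"] by simp
      finally show ?thesis using True by simp
    qed simp
  qed
  finally show "(LINT y|\<nu>. indicator {h<..} y * y) * h powr (\<alpha> - 1) \<le> T h" .
qed

lemma f_tendsto: "(f \<longlongrightarrow> 0) at_top"
proof (rule tendsto_sandwich[OF _ _ tendsto_const T_tendsto])
  show "\<forall>\<^sub>F x in at_top. 0 \<le> f x" by (simp add: f_nonneg)
  show "\<forall>\<^sub>F x in at_top. f x \<le> T x"
    using eventually_ge_at_top[of "1::real"]
  proof eventually_elim
    fix x :: real assume x: "1 \<le> x"
    have "f x \<le> measure \<nu> {x<..}" using x by (intro f_le_tail) auto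
    also have "\<dots> * 1 \<le> measure \<nu> {x<..} * x powr \<alpha>"
      using x \<alpha> by (intro mult_left_mono ge_one_powr_ge_zero) auto
    also have "\<dots> \<le> T x" by (rule tail_le_T[OF x])
    finally show "f x \<le> T x" by simp
  qed
qed

text \<open>Moving down from \<open>x\<close> by a multiple of \<open>x powr (1 / \<alpha>)\<close> changes \<open>f\<close> at most by a factor 2 and
  lowers \<open>x powr (1 - 1 / \<alpha>)\<close> by at least a constant, so the bound propagates upwards.\<close>

lemma minus_ln_f_le: "\<exists>C>0. \<forall>\<^sub>F x in at_top. - ln (f x) \<le> C * x powr (1 - 1 / \<alpha>)"
proof -
  obtain c where c: "0 < c" and bc: "\<forall>\<^sub>F x in at_top. c * x powr (1 / \<alpha>) \<le> b x"
    using b_lower by auto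
  obtain C1 R where C1: "1 \<le> C1" "1 \<le> R" and fpos: "\<And>x. R \<le> x \<Longrightarrow> 0 < f x"
    and fup: "\<And>x y. R \<le> x \<Longrightarrow> x \<le> y \<Longrightarrow> f y \<le> C1 * f x"
    using f_upper by blast
  define \<kappa> where "\<kappa> = 1 - 1 / \<alpha>"
  have \<kappa>: "0 < \<kappa>" "\<kappa> < 1" using \<alpha> by (auto simp: \<kappa>_def)
  \<comment> \<open>The bound 1 / 2 keeps \<open>x - y\<close> at or above \<open>x / 2\<close>,
    hence above \<open>x1\<close>; the bound \<open>c\<close> keeps the displacement within
    \<open>b x\<close>.\<close>
  define c' where "c' = min c (1 / 2)"
  have c': "0 < c'" "c' \<le> c" "c' \<le> 1 / 2" using c by (auto simp: c'_def)
  have "\<forall>\<^sub>F x in at_top. 1 \<le> c' * x powr (1 / \<alpha>)"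
  proof -
    have "filterlim (\<lambda>x. c' * x powr (1 / \<alpha>)) at_top at_top"
      using c' \<alpha> by (intro filterlim_tendsto_pos_mult_at_top[OF tendsto_const] powr_at_top) auto
    then show ?thesis by (simp add: filterlim_at_top)
  qed
  with bc insens_factor[of 1 1] eventually_ge_at_top[of R]
  have "\<forall>\<^sub>F x in at_top. c * x powr (1 / \<alpha>) \<le> b x \<and>
      (\<forall>y. \<bar>y\<bar> \<le> 1 * b x \<longrightarrow> (1 - 1) * f x \<le> f (x - y) \<and> f (x - y) \<le> (1 + 1) * f x) \<and> R \<le> x
      \<and> 1 \<le> c' * x powr (1 / \<alpha>)" by (auto simp: eventually_conj_iff)
  then obtain x1 where x1: "\<And>x. x1 \<le> x \<Longrightarrow> c * x powr (1 / \<alpha>) \<le> b x"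
    "\<And>x y. x1 \<le> x \<Longrightarrow> \<bar>y\<bar> \<le> b x \<Longrightarrow> f (x - y) \<le> 2 * f x" "\<And>x. x1 \<le> x \<Longrightarrow> R \<le> x"
    "\<And>x. x1 \<le> x \<Longrightarrow> 1 \<le> c' * x powr (1 / \<alpha>)"
    unfolding eventually_at_top_linorder by (metis one_add_one mult_1)
  have x11: "1 \<le> x1" "R \<le> x1" using x1(3)[of x1] C1 by auto
  define D where "D = - ln (f (2 * x1) / C1)"
  \<comment> \<open>With this constant one displacement lowers \<open>C * x powr \<kappa>\<close> by
    at least 1, which covers the loss of ln 2.\<close>
  define C where "C = 1 / (\<kappa> * c')"
  have C: "0 < C" using \<kappa> c' by (simp add: C_def)
  \<comment> \<open>Displacements are at least 1, so extending the range by 1 leads back to the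
    previous range. The base interval reaches up to \<open>2 * x1\<close> because a displacement may
    halve \<open>x\<close>.\<close>
  have main: "x1 \<le> x \<Longrightarrow> x \<le> 2 * x1 + real n \<Longrightarrow> - ln (f x) \<le> D + C * x powr \<kappa>" for n x
  proof (induction n arbitrary: x)
    case 0
    have "f (2 * x1) / C1 \<le> f x" using fup[of x "2 * x1"] 0 x11 C1 by (simp add: field_simps)
    then have "ln (f (2 * x1) / C1) \<le> ln (f x)"
      using fpos[of "2 * x1"] fpos[of x] 0 x11 C1 by (subst ln_le_cancel_iff) auto
    moreover have "0 \<le> C * x powr \<kappa>" using C by simp
    ultimately show ?case by (simp add: D_def)
  next
    case (Suc n)
    show ?case
    proof (cases "x \<le> 2 * x1 + real n")
      case True
      then show ?thesis using Suc by blast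
    next
      case False
      then have x: "2 * x1 \<le> x" by linarith
      have x0: "1 \<le> x" "0 < x" using x x11 by auto
      define y where "y = c' * x powr (1 / \<alpha>)"
      have y1: "1 \<le> y" using x1(4)[of x] x x11 by (simp add: y_def)
      have "x powr (1 / \<alpha>) \<le> x powr 1" using x0 \<alpha> by (intro powr_mono) auto
      then have "y \<le> 1 / 2 * x" unfolding y_def using c' x0 by (intro mult_mono) auto
      then have y2: "y \<le> x / 2" by simp
      have yb: "y \<le> b x"
      proof -
        have "y \<le> c * x powr (1 / \<alpha>)" unfolding y_def using c' by (intro mult_right_mono) auto
        also have "\<dots> \<le> b x" using x1(1)[of x] x x11 by simp
        finally show ?thesis .
      qed
      have xy: "x1 \<le> x - y" "x - y \<le> 2 * x1 + real n" using x y2 y1 Suc.prems by auto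
      have IH: "- ln (f (x - y)) \<le> D + C * (x - y) powr \<kappa>" by (rule Suc.IH[OF xy])
      have "f (x - y) \<le> 2 * f x" using x1(2)[of x y] yb y1 x x11 by auto
      then have "ln (f (x - y)) \<le> ln (2 * f x)"
        using fpos[of "x - y"] fpos[of x] xy x x11 by (subst ln_le_cancel_iff) auto
      also have "\<dots> = ln 2 + ln (f x)" using fpos[of x] x x11 by (intro ln_mult_pos) auto
      also have "ln 2 \<le> (1::real)" using ln_2_less_1 by simp
      finally have "- ln (f x) \<le> 1 + (D + C * (x - y) powr \<kappa>)" using IH by linarith
      moreover have "1 \<le> C * (x powr \<kappa> - (x - y) powr \<kappa>)"
      proof -
        have yx: "0 < 1 - y / x" using y2 x0 by (simp add: field_simps)
        \<comment> \<open>The weighted inequality of arithmetic and geometric means with second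
          entry 1, which is Bernoulli's inequality for the exponent \<kappa> < 1.\<close>
        have "(1 - y / x) powr \<kappa> * 1 powr (1 - \<kappa>) \<le> \<kappa> * (1 - y / x) + (1 - \<kappa>) * 1"
          using yx \<kappa> by (intro Youngs_inequality_0) auto
        then have bern: "(1 - y / x) powr \<kappa> \<le> 1 - \<kappa> * (y / x)" by (simp add: algebra_simps)
        have "x - y = x * (1 - y / x)" using x0 by (simp add: field_simps)
        then have "(x - y) powr \<kappa> = x powr \<kappa> * (1 - y / x) powr \<kappa>"
          using yx x0 by (simp add: powr_mult)
        also have "\<dots> \<le> x powr \<kappa> * (1 - \<kappa> * (y / x))" using bern by (intro mult_left_mono) auto
        finally have "\<kappa> * (x powr \<kappa> * (y / x)) \<le> x powr \<kappa> - (x - y) powr \<kappa>" by (simp add: algebra_simps)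
        moreover have "x powr \<kappa> * (y / x) = c'"
        proof -
          have "x powr \<kappa> * x powr (1 / \<alpha>) = x" using x0 by (simp add: powr_add[symmetric] \<kappa>_def)
          then show ?thesis using x0 by (simp add: y_def field_simps)
        qed
        ultimately have "\<kappa> * c' \<le> x powr \<kappa> - (x - y) powr \<kappa>" by (simp only:)
        then have "C * (\<kappa> * c') \<le> C * (x powr \<kappa> - (x - y) powr \<kappa>)" using C by (intro mult_left_mono) auto
        then show ?thesis using \<kappa> c' by (simp add: C_def)
      qed
      ultimately show ?thesis by (simp add: algebra_simps)
    qed
  qed
  have "\<forall>\<^sub>F x in at_top. \<bar>D\<bar> \<le> x powr \<kappa>"
    using powr_at_top[OF \<kappa>(1)] by (simp add: filterlim_at_top)
  then have "\<forall>\<^sub>F x in at_top. - ln (f x) \<le> (C + 1) * x powr \<kappa>"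
    using eventually_ge_at_top[of x1]
  proof eventually_elim
    fix x assume D: "\<bar>D\<bar> \<le> x powr \<kappa>" and x: "x1 \<le> x"
    obtain n where "x - 2 * x1 \<le> real n" using real_arch_simple by blast
    then have "- ln (f x) \<le> D + C * x powr \<kappa>" using x by (intro main[of x n]) auto
    then show "- ln (f x) \<le> (C + 1) * x powr \<kappa>" using D by (simp add: algebra_simps)
  qed
  then show ?thesis using C unfolding \<kappa>_def by (intro exI[of _ "C + 1"]) auto
qed

text \<open>The displacement is made in steps of length at most \<open>b x\<close>. Each costs a
  factor 2 \<le> e, because \<open>b x \<le> C * b (x / 2)\<close> makes the step admissible for
  insensitivity at every intermediate point above \<open>x / 2\<close>. The number of steps exceeds
  \<open>z / b x\<close> by at most 1, hence the exponent.\<close>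

lemma f_exp_growth: "\<forall>\<^sub>F x in at_top. \<forall>z. 0 \<le> z \<longrightarrow> z \<le> x / 2 \<longrightarrow> f (x - z) \<le> f x * exp (1 + z / b x)"
proof -
  obtain C where C: "0 < C" and half: "\<forall>\<^sub>F x in at_top. b x \<le> C * b (x / 2)" using b_half by auto
  obtain t0 where t0: "mono_on {t0..} b" using b_mono by auto
  obtain X where X: "\<And>x y. X \<le> x \<Longrightarrow> \<bar>y\<bar> \<le> C * b x \<Longrightarrow> f (x - y) \<le> 2 * f x"
    using insens_factor[of C 1] C unfolding eventually_at_top_linorder
    by (metis less_imp_le one_add_one zero_less_one)
  show ?thesis
    using half eventually_ge_at_top[of "max (2 * X) (max 1 (2 * t0))"]
  proof eventually_elim
    fix x assume bx: "b x \<le> C * b (x / 2)" and x: "max (2 * X) (max 1 (2 * t0)) \<le> x"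
    have bpos: "0 < b x" using x by (intro b_pos) auto
    have step: "f (u - y) \<le> exp 1 * f u" if "x / 2 \<le> u" "u \<le> x" "0 \<le> y" "y \<le> b x" for u y
    proof -
      have "b (x / 2) \<le> b u" using that x by (intro mono_onD[OF t0]) auto
      then have "b x \<le> C * b u" using bx C by (meson less_imp_le mult_left_mono order_trans)
      then have "f (u - y) \<le> 2 * f u" using that x by (intro X) auto
      also have "\<dots> \<le> exp 1 * f u" using exp_ge_add_one_self[of 1] by (intro mult_right_mono f_nonneg) auto
      finally show ?thesis .
    qed
    have ind: "0 \<le> z \<Longrightarrow> z \<le> x / 2 \<Longrightarrow> z \<le> real n * b x \<Longrightarrow> f (x - z) \<le> exp (real n) * f x" for n z
    proof (induction n arbitrary: z)
      case 0
      then show ?case by simp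
    next
      case (Suc n)
      define z' where "z' = max 0 (z - b x)"
      have z': "0 \<le> z'" "z' \<le> z" "z - z' \<le> b x" "z' \<le> real n * b x"
        using Suc.prems bpos by (auto simp: z'_def algebra_simps)
      have "f (x - z) = f ((x - z') - (z - z'))" by simp
      also have "\<dots> \<le> exp 1 * f (x - z')" using z' Suc.prems by (intro step) auto
      also have "\<dots> \<le> exp 1 * (exp (real n) * f x)"
        using z' Suc.prems by (intro mult_left_mono Suc.IH) auto
      also have "\<dots> = exp (real (Suc n)) * f x" by (simp add: exp_add)
      finally show ?case .
    qed
    show "\<forall>z. 0 \<le> z \<longrightarrow> z \<le> x / 2 \<longrightarrow> f (x - z) \<le> f x * exp (1 + z / b x)"
    proof (intro allI impI)
      fix z assume z: "0 \<le> z" "z \<le> x / 2"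
      define n where "n = nat \<lceil>z / b x\<rceil>"
      have "0 \<le> z / b x" using z bpos by simp
      then have n: "z / b x \<le> real n" "real n \<le> 1 + z / b x" unfolding n_def by linarith+
      have "f (x - z) \<le> exp (real n) * f x"
        using n z bpos by (intro ind) (auto simp: field_simps)
      also have "\<dots> \<le> exp (1 + z / b x) * f x" using n by (intro mult_right_mono f_nonneg) auto
      finally show "f (x - z) \<le> f x * exp (1 + z / b x)" by (simp add: mult.commute)
    qed
  qed
qed


section \<open>Convolution of the local tail with itself\<close>

lemma f_measurable: "1 \<le> A \<Longrightarrow> (\<lambda>x. f x * indicator {A..} x) \<in> borel_measurable borel"
proof -
  assume A: "1 \<le> A"
  \<comment> \<open>\<open>f\<close> is a difference of two monotone tail functions; the maximum
    with \<open>A\<close> avoids tails from points at or below 0, where \<nu> may be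
    infinite.\<close>
  define F where "F x = measure \<nu> {max A x<..}" for x
  have fin: "emeasure \<nu> {max A x<..} < \<infinity>" for x using A by (intro tail_finite) auto
  have "mono (\<lambda>x. - F x)"
    unfolding mono_def F_def measure_def
    using fin by (auto intro!: enn2real_mono emeasure_mono)
  then have "(\<lambda>x. - F x) \<in> borel_measurable borel" by (rule borel_measurable_mono)
  then have F[measurable]: "F \<in> borel_measurable borel" by (simp add: borel_measurable_uminus_eq)
  have "f x * indicator {A..} x = (F x - F (x + d)) * indicator {A..} x" for x
  proof (cases "A \<le> x")
    case True
    have "measure \<nu> ({x<..} - {x + d<..}) = measure \<nu> {x<..} - measure \<nu> {x + d<..}"
      using fin[of x] True d by (intro measure_Diff) auto
    moreover have "{x<..} - {x + d<..} = {x<..x + d}" by auto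
    ultimately show ?thesis using True d by (simp add: F_def f_def max_def)
  qed simp
  then have eq: "(\<lambda>x. f x * indicator {A..} x) = (\<lambda>x. (F x - F (x + d)) * indicator {A..} x)" by (rule ext)
  show ?thesis unfolding eq by measurable
qed

text \<open>By Fubini, a jump of size \<open>z\<close> belongs to the windows
  \<open>{u<..u + d}\<close> with \<open>u\<close> between \<open>z - d\<close> and
  \<open>z\<close>. These have total length \<open>d\<close>, and
  \<open>u powr \<alpha> \<le> z powr \<alpha>\<close> on them.\<close>

lemma tail_moment_lborel:
  assumes A: "1 \<le> A"
  shows "(\<integral>\<^sup>+u. indicator {A..} u * ennreal (u powr \<alpha> * f u) \<partial>lborel) \<le> ennreal (d * T A)"
proof -
  define k where "k = measure \<nu> {1<..}"
  define J where "J = jump_tail_law \<nu> 1"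
  have one: "(0::real) < 1" by simp
  have k: "0 < k" using tail_pos[OF one] by (simp add: k_def)
  have ek: "emeasure \<nu> {1<..} = ennreal k"
    using tail_finite[OF one] by (simp add: k_def emeasure_eq_ennreal_measure less_top)
  note J = jump_tail_law[OF sets_\<nu> int_\<nu> one tail_pos[OF one], folded J_def k_def]
  interpret J: real_distribution J by (rule J)
  interpret P: pair_sigma_finite J lborel ..
  \<comment> \<open>Beyond 1 the measure \<nu> is \<open>k\<close> times the probability law
    \<open>J\<close>, to which Fubini is applied.\<close>
  have fJ: "f u = k * measure J {u<..u + d}" if "A \<le> u" for u
  proof -
    have "{u<..u + d} \<inter> {1<..} = {u<..u + d}" using that A by auto
    then show ?thesis using J(3)[of "{u<..u + d}"] by (simp add: f_def)
  qed
  define g where "g z u = (indicator {p. A \<le> snd p \<and> snd p < fst p \<and> fst p \<le> snd p + d} (z, u) * ennreal (u powr \<alpha>) :: ennreal)" for z u :: real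
  have M: "(\<lambda>(z, u). g z u) \<in> borel_measurable (J \<Otimes>\<^sub>M lborel)" unfolding g_def by measurable
  have M': "(\<lambda>(u, z). g z u) \<in> borel_measurable (lborel \<Otimes>\<^sub>M J)" unfolding g_def by measurable
  have "(\<integral>\<^sup>+u. indicator {A..} u * ennreal (u powr \<alpha> * f u) \<partial>lborel) =
      (\<integral>\<^sup>+u. ennreal k * (\<integral>\<^sup>+z. g z u \<partial>J) \<partial>lborel)"
  proof (intro nn_integral_cong)
    fix u
    show "indicator {A..} u * ennreal (u powr \<alpha> * f u) = ennreal k * (\<integral>\<^sup>+z. g z u \<partial>J)"
    proof (cases "A \<le> u")
      case True
      have "(\<integral>\<^sup>+z. g z u \<partial>J) = (\<integral>\<^sup>+z. ennreal (u powr \<alpha>) * indicator {u<..u + d} z \<partial>J)"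
        using True by (intro nn_integral_cong) (simp add: g_def indicator_def)
      also have "\<dots> = ennreal (u powr \<alpha>) * ennreal (measure J {u<..u + d})"
        by (subst nn_integral_cmult_indicator) (auto simp: J.emeasure_eq_measure)
      finally show ?thesis using True k fJ[OF True] by (simp add: ennreal_mult[symmetric] mult_ac)
    qed (simp add: g_def)
  qed
  also have "\<dots> = ennreal k * (\<integral>\<^sup>+u. (\<integral>\<^sup>+z. g z u \<partial>J) \<partial>lborel)"
    using J.borel_measurable_nn_integral_fst[OF M'] by (intro nn_integral_cmult) simp
  also have "(\<integral>\<^sup>+u. (\<integral>\<^sup>+z. g z u \<partial>J) \<partial>lborel) = (\<integral>\<^sup>+z. (\<integral>\<^sup>+u. g z u \<partial>lborel) \<partial>J)"
    using P.Fubini'[OF M] by simp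
  also have "\<dots> \<le> (\<integral>\<^sup>+z. ennreal d * (indicator {A<..} z * ennreal (z powr \<alpha>)) \<partial>J)"
  proof (intro nn_integral_mono)
    fix z
    have "(\<integral>\<^sup>+u. g z u \<partial>lborel) \<le> (\<integral>\<^sup>+u. (indicator {A<..} z * ennreal (z powr \<alpha>)) * indicator {z - d..z} u \<partial>lborel)"
    proof (intro nn_integral_mono)
      fix u
      show "g z u \<le> (indicator {A<..} z * ennreal (z powr \<alpha>)) * indicator {z - d..z} u"
      proof (cases "A \<le> u \<and> u < z \<and> z \<le> u + d")
        case True
        then have "u powr \<alpha> \<le> z powr \<alpha>" using A \<alpha> by (intro powr_mono2) auto
        with True show ?thesis by (simp add: g_def ennreal_leI)
      qed (simp add: g_def)
    qed
    also have "\<dots> = ennreal d * (indicator {A<..} z * ennreal (z powr \<alpha>))"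
      using d by (subst nn_integral_cmult_indicator) (auto simp: mult.commute)
    finally show "(\<integral>\<^sup>+u. g z u \<partial>lborel) \<le> ennreal d * (indicator {A<..} z * ennreal (z powr \<alpha>))" .
  qed
  also have "\<dots> = ennreal d * (\<integral>\<^sup>+y. indicator {1<..} y / ennreal k * (indicator {A<..} y * ennreal (y powr \<alpha>)) \<partial>\<nu>)"
    unfolding J_def ek[symmetric]
    by (subst nn_integral_jump_tail_law[OF sets_\<nu>, symmetric]) (auto intro!: nn_integral_cmult simp: J_def[symmetric])
  also have "(\<integral>\<^sup>+y. indicator {1<..} y / ennreal k * (indicator {A<..} y * ennreal (y powr \<alpha>)) \<partial>\<nu>) =
    (\<integral>\<^sup>+y. ennreal (1 / k) * ennreal (indicator {A<..} y * y powr \<alpha>) \<partial>\<nu>)"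
    using A k divide_ennreal[of 1 k] by (intro nn_integral_cong) (auto simp: indicator_def)
  also have "\<dots> = ennreal (1 / k) * ennreal (T A)"
    unfolding T_def using T_integrable[OF A]
    by (subst nn_integral_cmult, simp, subst nn_integral_eq_integral) auto
  also have "ennreal k * (ennreal d * (ennreal (1 / k) * ennreal (T A))) = ennreal (d * T A)"
    using k d T_nonneg[of A] by (simp add: ennreal_mult[symmetric])
  finally show ?thesis by (simp add: mult_left_mono)
qed

text \<open>For \<open>u \<le> (y + d) / 2\<close> and \<open>y \<ge> 3 * d\<close> the other
  argument is at least \<open>y / 3\<close>, and O-regular variation makes \<open>f (y / 3)\<close>
  at most a multiple of \<open>f y\<close>; the factor 9 bounds 3^\<alpha>. What remains is the tail
  of a convergent moment integral.\<close>

lemma convolution_tail_OR: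
  assumes OR: "(\<lambda>x. x powr \<alpha> * f x) \<in> O_regularly_varying" and \<epsilon>: "0 < \<epsilon>"
  shows "\<exists>A0. \<forall>A\<ge>A0. \<forall>y\<ge>2 * A - d.
    (\<integral>\<^sup>+u. indicator {A..(y + d) / 2} u * ennreal (u powr \<alpha> * f u * f (y - u)) \<partial>lborel) \<le> ennreal (\<epsilon> * f y)"
proof -
  obtain C R where C: "1 \<le> C" "1 \<le> R" and fpos: "\<And>x. R \<le> x \<Longrightarrow> 0 < f x"
    and fup: "\<And>x y. R \<le> x \<Longrightarrow> x \<le> y \<Longrightarrow> f y \<le> C * f x"
    using f_upper by blast
  have "0 < Liminf at_top (\<lambda>x. ereal ((3 * x) powr \<alpha> * f (3 * x) / (x powr \<alpha> * f x)))"
    using OR unfolding O_regularly_varying_def mem_Collect_eq by (metis one_le_numeral)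
  then obtain c where c: "0 < ereal c" "ereal c < Liminf at_top (\<lambda>x. ereal ((3 * x) powr \<alpha> * f (3 * x) / (x powr \<alpha> * f x)))"
    using ereal_dense2 by blast
  have "\<forall>\<^sub>F x in at_top. ereal c < ereal ((3 * x) powr \<alpha> * f (3 * x) / (x powr \<alpha> * f x))"
    using less_LiminfD[OF c(2)] .
  then have "\<forall>\<^sub>F x in at_top. f x \<le> 9 / c * f (3 * x)"
    using eventually_ge_at_top[of R]
  proof eventually_elim
    fix x assume *: "ereal c < ereal ((3 * x) powr \<alpha> * f (3 * x) / (x powr \<alpha> * f x))" and x: "R \<le> x"
    have x0: "0 < x" using x C by linarith
    have "c * f x \<le> 3 powr \<alpha> * f (3 * x)"
      using * x0 fpos[OF x] by (simp add: powr_mult field_simps)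
    also have "\<dots> \<le> 3 powr 2 * f (3 * x)" using \<alpha> by (intro mult_right_mono f_nonneg powr_mono) auto
    finally show "f x \<le> 9 / c * f (3 * x)" using c(1) by (simp add: field_simps)
  qed
  then obtain X where X: "\<And>x. X \<le> x \<Longrightarrow> f x \<le> 9 / c * f (3 * x)" by (auto simp: eventually_at_top_linorder)
  have "((\<lambda>A. C * (9 / c) * d * T A) \<longlongrightarrow> C * (9 / c) * d * 0) at_top" by (intro tendsto_intros T_tendsto)
  then have "\<forall>\<^sub>F A in at_top. C * (9 / c) * d * T A < \<epsilon>" using \<epsilon> by (intro order_tendstoD) auto
  then obtain A1 where A1: "\<And>A. A1 \<le> A \<Longrightarrow> C * (9 / c) * d * T A < \<epsilon>" by (auto simp: eventually_at_top_linorder)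
  define A0 where "A0 = max A1 (3 * max R X + 3 * d)"
  show ?thesis
  proof (intro exI[of _ A0] allI impI)
    fix A y assume A: "A0 \<le> A" and y: "2 * A - d \<le> y"
    have *: "R \<le> y / 3" "X \<le> y / 3" "1 \<le> A" "A1 \<le> A" "3 * d \<le> y" using A y C d unfolding A0_def by linarith+
    have fy: "f (y / 3) \<le> 9 / c * f y" using X[of "y / 3"] * by simp
    have "(\<integral>\<^sup>+u. indicator {A..(y + d) / 2} u * ennreal (u powr \<alpha> * f u * f (y - u)) \<partial>lborel) \<le>
      (\<integral>\<^sup>+u. ennreal (C * (9 / c) * f y) * (indicator {A..} u * ennreal (u powr \<alpha> * f u)) \<partial>lborel)"
    proof (intro nn_integral_mono)
      fix u
      show "indicator {A..(y + d) / 2} u * ennreal (u powr \<alpha> * f u * f (y - u)) \<le>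
        ennreal (C * (9 / c) * f y) * (indicator {A..} u * ennreal (u powr \<alpha> * f u))"
      proof (cases "A \<le> u \<and> u \<le> (y + d) / 2")
        case True
        have "f (y - u) \<le> C * f (y / 3)" using True * by (intro fup) auto
        also have "\<dots> \<le> C * (9 / c * f y)" using fy C by (intro mult_left_mono) auto
        finally have "u powr \<alpha> * f u * f (y - u) \<le> u powr \<alpha> * f u * (C * (9 / c) * f y)"
          by (intro mult_left_mono) (auto simp: f_nonneg)
        then show ?thesis using True c C
          by (simp add: ennreal_mult[symmetric] f_nonneg ennreal_leI mult_ac)
      qed simp
    qed
    also have "\<dots> = ennreal (C * (9 / c) * f y) * (\<integral>\<^sup>+u. indicator {A..} u * ennreal (u powr \<alpha> * f u) \<partial>lborel)"
    proof (rule nn_integral_cmult)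
      have "(\<lambda>u. ennreal (u powr \<alpha> * (f u * indicator {A..} u))) \<in> borel_measurable borel"
        using f_measurable[OF *(3)] by measurable
      also have "(\<lambda>u. ennreal (u powr \<alpha> * (f u * indicator {A..} u))) = (\<lambda>u. indicator {A..} u * ennreal (u powr \<alpha> * f u))"
        by (auto simp: indicator_def)
      finally show "(\<lambda>u. indicator {A..} u * ennreal (u powr \<alpha> * f u)) \<in> borel_measurable lborel" by simp
    qed
    also have "\<dots> \<le> ennreal (C * (9 / c) * f y) * ennreal (d * T A)"
      by (intro mult_left_mono tail_moment_lborel *) auto
    also have "\<dots> = ennreal (C * (9 / c) * d * T A * f y)"
      using C c d T_nonneg[of A] f_nonneg[of y] by (simp add: ennreal_mult[symmetric] mult_ac)
    also have "\<dots> \<le> ennreal (\<epsilon> * f y)"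
      using A1[OF *(4)] by (intro ennreal_leI mult_right_mono f_nonneg) auto
    finally show "(\<integral>\<^sup>+u. indicator {A..(y + d) / 2} u * ennreal (u powr \<alpha> * f u * f (y - u)) \<partial>lborel) \<le> ennreal (\<epsilon> * f y)" .
  qed
qed

text \<open>Insensitivity bounds the two end pieces of the convolution integral from below by almost
  the whole of its limit \<open>2 * G\<close>, so little is left for the middle piece.\<close>

lemma convolution_tail_Sd:
  assumes Sd: "(\<lambda>x. x powr \<alpha> * f x) \<in> subexponential" and \<epsilon>: "0 < \<epsilon>"
  shows "\<exists>A0. \<forall>A\<ge>A0. \<forall>y\<ge>2 * A - d.
    (\<integral>\<^sup>+u. indicator {A..(y + d) / 2} u * ennreal (u powr \<alpha> * f u * f (y - u)) \<partial>lborel) \<le> ennreal (\<epsilon> * f y)"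
proof -
  define g where "g x = x powr \<alpha> * f x" for x
  have g0: "0 \<le> g x" for x by (simp add: g_def f_nonneg)
  define G where "G = (LINT z:{0<..}|lborel. g z)"
  have gi: "set_integrable lborel {0<..} g" and gp: "\<forall>\<^sub>F x in at_top. 0 < g x"
    and glim: "((\<lambda>x. (LINT z:{0<..<x}|lborel. g (x - z) * g z) / g x) \<longlongrightarrow> 2 * G) at_top"
    using Sd unfolding subexponential_def G_def g_def by auto
  have gI: "integrable lborel (\<lambda>z. indicator {0<..} z * g z)" using gi by (simp add: set_integrable_def)
  have G: "G = (\<integral>z. indicator {0<..} z * g z \<partial>lborel)" by (simp add: G_def set_lebesgue_integral_def)
  have G0: "0 \<le> G" unfolding G by (intro integral_nonneg_AE AE_I2) (simp add: g0)
  have Gpos: "0 < G"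
  proof -
    obtain x1 where x1: "\<And>x. x1 \<le> x \<Longrightarrow> 0 < g x" using gp by (auto simp: eventually_at_top_linorder)
    have "\<not> (AE z in lborel. indicator {0<..} z * g z = 0)"
    proof
      assume "AE z in lborel. indicator {0<..} z * g z = 0"
      then have "AE z in lborel. z \<notin> {max 1 x1..max 1 x1 + 1}"
      proof eventually_elim
        fix z :: real assume *: "indicator {0<..} z * g z = 0"
        show "z \<notin> {max 1 x1..max 1 x1 + 1}"
        proof
          assume "z \<in> {max 1 x1..max 1 x1 + 1}"
          then have "0 < z" "0 < g z" using x1[of z] by auto
          with * show False by (simp add: indicator_def)
        qed
      qed
      then have "{max 1 x1..max 1 x1 + 1} \<in> null_sets lborel"
        by (rule AE_iff_null_sets[THEN iffD2, rotated]) simp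
      then show False by (auto dest: null_setsD1)
    qed
    then have "G \<noteq> 0" unfolding G by (subst integral_nonneg_eq_0_iff_AE[OF gI]) (auto simp: g0)
    with G0 show ?thesis by simp
  qed
  \<comment> \<open>The expression 3 + 2 G collects the errors of the total and of the two end
    pieces, and 9 \<ge> 3^\<alpha> is the cost of replacing \<open>(y - u) powr \<alpha>\<close> by
    \<open>y powr \<alpha>\<close>.\<close>
  define e where "e = min (1 / 2) (\<epsilon> / (9 * (3 + 2 * G)))"
  have e: "0 < e" "e \<le> 1 / 2" "9 * (e * (3 + 2 * G)) \<le> \<epsilon>"
  proof -
    show "0 < e" using \<epsilon> G0 by (auto simp: e_def)
    show "e \<le> 1 / 2" unfolding e_def by (rule min.cobounded1)
    have "e * (9 * (3 + 2 * G)) \<le> \<epsilon> / (9 * (3 + 2 * G)) * (9 * (3 + 2 * G))"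
      using G0 by (intro mult_right_mono) (auto simp: e_def)
    also have "\<dots> = \<epsilon>" using G0 by (simp add: add_nonneg_eq_0_iff)
    finally show "9 * (e * (3 + 2 * G)) \<le> \<epsilon>" by (simp add: mult_ac)
  qed
  define GA where "GA a = (\<integral>z. indicator {0<..<a} z * g z \<partial>lborel)" for a :: real
  have gAI: "integrable lborel (\<lambda>z. indicator {0<..<a} z * g z)" for a :: real
  proof -
    have "integrable lborel (\<lambda>z. indicator {0<..<a} z *\<^sub>R (indicator {0<..} z * g z))"
      by (rule integrable_mult_indicator[OF _ gI]) simp
    also have "(\<lambda>z. indicator {0<..<a} z *\<^sub>R (indicator {0<..} z * g z)) = (\<lambda>z. indicator {0<..<a} z * g z)"
      by (auto simp: indicator_def fun_eq_iff)
    finally show ?thesis .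
  qed
  obtain A1 where A1: "1 \<le> A1" "G - e \<le> GA A1"
  proof -
    have "((\<lambda>a. GA a) \<longlongrightarrow> G) at_top" unfolding GA_def G
    proof (rule integral_dominated_convergence_at_top[where w="\<lambda>z. indicator {0<..} z * g z"])
      show "AE z in lborel. ((\<lambda>a. indicator {0<..<a} z * g z) \<longlongrightarrow> indicator {0<..} z * g z) at_top"
      proof (rule AE_I2)
        fix z :: real
        have "\<forall>\<^sub>F a in at_top. indicator {0<..<a} z * g z = indicator {0<..} z * g z"
          using eventually_gt_at_top[of z] by eventually_elim (simp add: indicator_def)
        then show "((\<lambda>a. indicator {0<..<a} z * g z) \<longlongrightarrow> indicator {0<..} z * g z) at_top"
          by (rule tendsto_eventually)
      qed
      show "\<forall>\<^sub>F a in at_top. AE z in lborel. norm (indicator {0<..<a} z * g z) \<le> indicator {0<..} z * g z"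
        by (intro always_eventually allI AE_I2) (auto simp: indicator_def g0)
    qed (use gI gAI in auto)
    then have "\<forall>\<^sub>F a in at_top. G - e < GA a" using e by (intro order_tendstoD) auto
    then have "\<forall>\<^sub>F a in at_top. G - e < GA a \<and> 1 \<le> a" using eventually_ge_at_top by (rule eventually_conj)
    then show thesis using that by (auto simp: eventually_at_top_linorder)
  qed
  have "\<forall>\<^sub>F x in at_top. (LINT z:{0<..<x}|lborel. g (x - z) * g z) / g x < 2 * G + e"
    using glim e by (intro order_tendstoD) auto
  moreover have "\<forall>\<^sub>F x in at_top. 0 < (LINT z:{0<..<x}|lborel. g (x - z) * g z) / g x"
    using Gpos by (intro order_tendstoD(1)[OF glim]) auto
  moreover have "\<forall>\<^sub>F x in at_top. \<forall>y. \<bar>y\<bar> \<le> A1 \<longrightarrow> (1 - e / 2) * f x \<le> f (x - y) \<and> f (x - y) \<le> (1 + e / 2) * f x"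
    using A1 e by (intro insens_bounded) auto
  ultimately have "\<forall>\<^sub>F x in at_top. (\<integral>\<^sup>+z. indicator {A1..x - A1} z * ennreal (g (x - z) * g z) \<partial>lborel) \<le>
      ennreal (e * (3 + 2 * G) * g x)"
    \<comment> \<open>From this point on, \<open>z < A1\<close> gives (x - z) / x \<ge> 1 - e / 4.
      As \<alpha> \<le> 2, the power weight loses at most e / 2, and insensitivity another e /
      2.\<close>
    using gp eventually_ge_at_top[of "2 * A1 + 4 * A1 / e"]
  proof eventually_elim
    fix x assume up: "(LINT z:{0<..<x}|lborel. g (x - z) * g z) / g x < 2 * G + e"
      and lo: "0 < (LINT z:{0<..<x}|lborel. g (x - z) * g z) / g x"
      and ins: "\<forall>y. \<bar>y\<bar> \<le> A1 \<longrightarrow> (1 - e / 2) * f x \<le> f (x - y) \<and> f (x - y) \<le> (1 + e / 2) * f x"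
      and gx: "0 < g x" and x: "2 * A1 + 4 * A1 / e \<le> x"
    have xA: "2 * A1 \<le> x" "4 * A1 \<le> e * x" "0 < x"
    proof -
      have "0 \<le> 4 * A1 / e" using A1 e by auto
      then show "2 * A1 \<le> x" "0 < x" using x A1 by linarith+
      have "4 * A1 / e \<le> x" using x A1 by linarith
      then show "4 * A1 \<le> e * x" using e by (simp add: field_simps)
    qed
    define Q where "Q z = g (x - z) * g z" for z
    have Q0: "0 \<le> Q z" for z by (simp add: Q_def g0)
    define N where "N S = (\<integral>\<^sup>+z. indicator S z * ennreal (Q z) \<partial>lborel)" for S
    have I: "(LINT z:{0<..<x}|lborel. g (x - z) * g z) = (\<integral>z. indicator {0<..<x} z * Q z \<partial>lborel)"
      by (simp add: set_lebesgue_integral_def Q_def)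
    \<comment> \<open>A non-integrable function has Bochner integral 0, so the positivity
      \<open>lo\<close> of the ratio implies integrability.\<close>
    have QI: "integrable lborel (\<lambda>z. indicator {0<..<x} z * Q z)"
      using lo gx not_integrable_integral_eq[of lborel "\<lambda>z. indicator {0<..<x} z * Q z"] unfolding I by fastforce
    have Qm: "(\<lambda>z. indicator {0<..<x} z * Q z) \<in> borel_measurable borel"
      using borel_measurable_integrable[OF QI] by simp
    have Nm: "(\<lambda>z. indicator S z * ennreal (Q z)) \<in> borel_measurable borel" if "S \<subseteq> {0<..<x}" "S \<in> sets borel" for S
    proof -
      have "(\<lambda>z. indicator S z * ennreal (indicator {0<..<x} z * Q z)) \<in> borel_measurable borel"
        using Qm that(2) by measurable
      also have "(\<lambda>z. indicator S z * ennreal (indicator {0<..<x} z * Q z)) = (\<lambda>z. indicator S z * ennreal (Q z))"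
        using that(1) by (auto simp: indicator_def fun_eq_iff)
      finally show ?thesis .
    qed
    have total: "N {0<..<x} \<le> ennreal ((2 * G + e) * g x)"
    proof -
      have "N {0<..<x} = (\<integral>\<^sup>+z. ennreal (indicator {0<..<x} z * Q z) \<partial>lborel)"
        unfolding N_def by (intro nn_integral_cong) (simp add: indicator_def)
      also have "\<dots> = ennreal (\<integral>z. indicator {0<..<x} z * Q z \<partial>lborel)"
        by (intro nn_integral_eq_integral QI AE_I2) (simp add: Q0)
      also have "\<dots> \<le> ennreal ((2 * G + e) * g x)"
        using up gx unfolding I by (intro ennreal_leI) (simp add: field_simps)
      finally show ?thesis .
    qed
    have left: "ennreal ((1 - e) * g x * GA A1) \<le> N {0<..<A1}"
    proof -
      have "ennreal ((1 - e) * g x * GA A1) = (\<integral>\<^sup>+z. ennreal ((1 - e) * g x * (indicator {0<..<A1} z * g z)) \<partial>lborel)"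
        unfolding GA_def using gAI[of A1] gx e
        by (subst nn_integral_eq_integral) (auto simp: g0 intro!: mult_nonneg_nonneg)
      also have "\<dots> \<le> N {0<..<A1}" unfolding N_def
      proof (intro nn_integral_mono)
        fix z
        show "ennreal ((1 - e) * g x * (indicator {0<..<A1} z * g z)) \<le> indicator {0<..<A1} z * ennreal (Q z)"
        proof (cases "0 < z \<and> z < A1")
          case True
          have r: "1 - e / 4 \<le> (x - z) / x" using True xA by (simp add: field_simps)
          have r01: "0 < (x - z) / x" "(x - z) / x \<le> 1" using True xA by auto
          have "1 - e / 2 \<le> (1 - e / 4)\<^sup>2" by (simp add: power2_eq_square algebra_simps)
          also have "\<dots> \<le> ((x - z) / x)\<^sup>2" using r e by (intro power_mono) auto
          also have "\<dots> = ((x - z) / x) powr 2" using r01 by (simp add: powr_numeral)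
          also have "\<dots> \<le> ((x - z) / x) powr \<alpha>" using r01 \<alpha> by (intro powr_mono') auto
          also have "\<dots> = (x - z) powr \<alpha> / x powr \<alpha>" using True xA by (intro powr_divide)
          finally have "(1 - e / 2) * x powr \<alpha> \<le> (x - z) powr \<alpha>" using xA by (simp add: field_simps)
          then have "((1 - e / 2) * x powr \<alpha>) * ((1 - e / 2) * f x) \<le> (x - z) powr \<alpha> * f (x - z)"
            using ins True e f_nonneg by (intro mult_mono) auto
          moreover have "(1 - e) * g x \<le> ((1 - e / 2) * x powr \<alpha>) * ((1 - e / 2) * f x)"
          proof -
            have "(1 - e) \<le> (1 - e / 2) * (1 - e / 2)" by (simp add: algebra_simps)
            then have "(1 - e) * g x \<le> (1 - e / 2) * (1 - e / 2) * g x" by (intro mult_right_mono g0)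
            then show ?thesis by (simp add: g_def mult_ac)
          qed
          ultimately have "(1 - e) * g x \<le> g (x - z)" by (simp add: g_def)
          then have "(1 - e) * g x * g z \<le> Q z" unfolding Q_def by (intro mult_right_mono g0)
          with True show ?thesis by (simp add: ennreal_leI)
        qed auto
      qed
      finally show ?thesis .
    qed
    \<comment> \<open>The integrand is symmetric under the reflection that sends \<open>z\<close> to
      \<open>x - z\<close>.\<close>
    have right: "N {x - A1<..<x} = N {0<..<A1}"
    proof -
      have "N {x - A1<..<x} = ennreal \<bar>-1\<bar> * (\<integral>\<^sup>+z. indicator {x - A1<..<x} (x + (-1) * z) * ennreal (Q (x + (-1) * z)) \<partial>lborel)"
        unfolding N_def using xA A1
        by (intro nn_integral_real_affine Nm) auto
      also have "\<dots> = N {0<..<A1}"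
        unfolding N_def by (simp, intro nn_integral_cong) (auto simp: indicator_def Q_def mult.commute)
      finally show ?thesis .
    qed
    have split: "N {0<..<A1} + N {x - A1<..<x} + N {A1..x - A1} \<le> N {0<..<x}"
    proof -
      have "N {0<..<A1} + N {x - A1<..<x} + N {A1..x - A1} =
        (\<integral>\<^sup>+z. indicator {0<..<A1} z * ennreal (Q z) + indicator {x - A1<..<x} z * ennreal (Q z) + indicator {A1..x - A1} z * ennreal (Q z) \<partial>lborel)"
      proof -
        have "(\<lambda>z. indicator {0<..<A1} z * ennreal (Q z)) \<in> borel_measurable borel"
          "(\<lambda>z. indicator {x - A1<..<x} z * ennreal (Q z)) \<in> borel_measurable borel"
          "(\<lambda>z. indicator {A1..x - A1} z * ennreal (Q z)) \<in> borel_measurable borel"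
          using xA A1 by (intro Nm; auto)+
        then show ?thesis unfolding N_def by (simp add: nn_integral_add)
      qed
      also have "\<dots> \<le> N {0<..<x}"
        unfolding N_def using xA A1 by (intro nn_integral_mono) (auto simp: indicator_def)
      finally show ?thesis .
    qed
    have "N {A1..x - A1} < \<infinity>"
      using split total by (metis add.commute ennreal_less_top infinity_ennreal_def le_iff_add order.strict_trans1 order_trans)
    then obtain n where n: "N {A1..x - A1} = ennreal n" "0 \<le> n" by (metis ennreal_cases less_irrefl infinity_ennreal_def)
    have "ennreal ((1 - e) * g x * GA A1) + ennreal ((1 - e) * g x * GA A1) + ennreal n \<le> ennreal ((2 * G + e) * g x)"
      using split total left unfolding right n(1) by (meson add_mono order_refl order_trans)
    moreover have GA0: "0 \<le> GA A1" unfolding GA_def by (intro integral_nonneg_AE AE_I2) (simp add: g0)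
    moreover have p: "0 \<le> (1 - e) * g x * GA A1" using e gx GA0 by simp
    ultimately have "(1 - e) * g x * GA A1 + (1 - e) * g x * GA A1 + n \<le> (2 * G + e) * g x"
      using n(2) G0 e gx by (simp add: ennreal_plus[symmetric] del: ennreal_plus)
    moreover have "(1 - e) * g x * (G - e) \<le> (1 - e) * g x * GA A1"
      using A1 e gx by (intro mult_left_mono) auto
    \<comment> \<open>The balance is 2 G + e - 2 (1 - e) (G - e) = e (3 + 2 G) - 2 e^2.\<close>
    ultimately have "n \<le> (2 * G + e) * g x - 2 * ((1 - e) * g x * (G - e))" by linarith
    also have "\<dots> = (e * (3 + 2 * G) - 2 * e * e) * g x" by (simp add: algebra_simps)
    also have "\<dots> \<le> e * (3 + 2 * G) * g x" using e gx by (intro mult_right_mono) auto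
    finally have "N {A1..x - A1} \<le> ennreal (e * (3 + 2 * G) * g x)" unfolding n by (rule ennreal_leI)
    then show "(\<integral>\<^sup>+z. indicator {A1..x - A1} z * ennreal (g (x - z) * g z) \<partial>lborel) \<le> ennreal (e * (3 + 2 * G) * g x)"
      unfolding N_def Q_def .
  qed
  then obtain X where X: "\<And>x. X \<le> x \<Longrightarrow> (\<integral>\<^sup>+z. indicator {A1..x - A1} z * ennreal (g (x - z) * g z) \<partial>lborel) \<le>
      ennreal (e * (3 + 2 * G) * g x)" by (auto simp: eventually_at_top_linorder)
  \<comment> \<open>The margin \<open>2 * d\<close> ensures \<open>(y + d) / 2 \<le> y - A1\<close>
    and \<open>3 * d \<le> y\<close> for all \<open>y \<ge> 2 * A - d\<close>.\<close>
  define A0 where "A0 = max (A1 + 2 * d) \<bar>X\<bar>"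
  show ?thesis
  proof (intro exI[of _ A0] allI impI)
    fix A y assume A: "A0 \<le> A" and y: "2 * A - d \<le> y"
    have *: "X \<le> y" "A1 \<le> A" "3 * d \<le> y" "2 * A1 + d \<le> y" "0 < y" using A y A1 d unfolding A0_def by linarith+
    have y\<alpha>: "0 < y powr \<alpha>" using * by simp
    have "(\<integral>\<^sup>+u. indicator {A..(y + d) / 2} u * ennreal (u powr \<alpha> * f u * f (y - u)) \<partial>lborel) \<le>
      (\<integral>\<^sup>+u. ennreal (9 / y powr \<alpha>) * (indicator {A1..y - A1} u * ennreal (g (y - u) * g u)) \<partial>lborel)"
    proof (intro nn_integral_mono)
      fix u
      show "indicator {A..(y + d) / 2} u * ennreal (u powr \<alpha> * f u * f (y - u)) \<le>
        ennreal (9 / y powr \<alpha>) * (indicator {A1..y - A1} u * ennreal (g (y - u) * g u))"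
      proof (cases "A \<le> u \<and> u \<le> (y + d) / 2")
        case True
        have yu: "y / 3 \<le> y - u" using True * by simp
        have "y powr \<alpha> = 3 powr \<alpha> * (y / 3) powr \<alpha>" using * by (simp add: powr_mult[symmetric])
        also have "\<dots> \<le> 3 powr 2 * (y - u) powr \<alpha>" using * yu \<alpha> by (intro mult_mono powr_mono powr_mono2) auto
        finally have "y powr \<alpha> \<le> 9 * (y - u) powr \<alpha>" by simp
        then have "y powr \<alpha> * f (y - u) \<le> 9 * (y - u) powr \<alpha> * f (y - u)" by (intro mult_right_mono f_nonneg)
        then have "f (y - u) \<le> 9 / y powr \<alpha> * g (y - u)" using y\<alpha> by (simp add: g_def field_simps)
        then have "g u * f (y - u) \<le> g u * (9 / y powr \<alpha> * g (y - u))" by (intro mult_left_mono g0)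
        then have "ennreal (g u * f (y - u)) \<le> ennreal (9 / y powr \<alpha> * (g (y - u) * g u))"
          by (intro ennreal_leI) (simp add: mult_ac)
        also have "\<dots> = ennreal (9 / y powr \<alpha>) * ennreal (g (y - u) * g u)"
          using y\<alpha> g0 by (intro ennreal_mult) auto
        finally show ?thesis using True * by (simp add: g_def)
      qed simp
    qed
    also have "\<dots> = ennreal (9 / y powr \<alpha>) * (\<integral>\<^sup>+u. indicator {A1..y - A1} u * ennreal (g (y - u) * g u) \<partial>lborel)"
    proof (rule nn_integral_cmult)
      have "(\<lambda>u. f (y - u) * indicator {1..} (y - u)) \<in> borel_measurable borel"
        by (rule measurable_compose[OF _ f_measurable]) auto
      then have "(\<lambda>u. indicator {A1..y - A1} u * ennreal (((y - u) powr \<alpha> * (f (y - u) * indicator {1..} (y - u))) * (u powr \<alpha> * (f u * indicator {1..} u)))) \<in> borel_measurable borel"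
        using f_measurable[of 1] by measurable
      also have "(\<lambda>u. indicator {A1..y - A1} u * ennreal (((y - u) powr \<alpha> * (f (y - u) * indicator {1..} (y - u))) * (u powr \<alpha> * (f u * indicator {1..} u)))) =
        (\<lambda>u. indicator {A1..y - A1} u * ennreal (g (y - u) * g u))"
        using A1 by (auto simp: indicator_def g_def fun_eq_iff)
      finally show "(\<lambda>u. indicator {A1..y - A1} u * ennreal (g (y - u) * g u)) \<in> borel_measurable lborel" by simp
    qed
    also have "\<dots> \<le> ennreal (9 / y powr \<alpha>) * ennreal (e * (3 + 2 * G) * g y)"
      by (intro mult_left_mono X *) simp
    also have "\<dots> = ennreal (9 * (e * (3 + 2 * G)) * f y)"
      using y\<alpha> e G0 f_nonneg[of y] by (subst ennreal_mult[symmetric]) (auto simp: g_def)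
    also have "\<dots> \<le> ennreal (\<epsilon> * f y)" using e by (intro ennreal_leI mult_right_mono f_nonneg) auto
    finally show "(\<integral>\<^sup>+u. indicator {A..(y + d) / 2} u * ennreal (u powr \<alpha> * f u * f (y - u)) \<partial>lborel) \<le> ennreal (\<epsilon> * f y)" .
  qed
qed

lemma convolution_tail:
  assumes "0 < \<epsilon>"
  shows "\<exists>A0. \<forall>A\<ge>A0. \<forall>y\<ge>2 * A - d.
    (\<integral>\<^sup>+u. indicator {A..(y + d) / 2} u * ennreal (u powr \<alpha> * f u * f (y - u)) \<partial>lborel) \<le> ennreal (\<epsilon> * f y)"
  using f_class convolution_tail_OR[OF _ assms] convolution_tail_Sd[OF _ assms] by auto

section \<open>Uniform local asymptotics\<close>

definition q where "q x = - ln (f x)"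

text \<open>Truncating the jumps at \<open>x / q x\<close> keeps the exponential moment at the rate \<open>8 * q x / x\<close> below
  \<open>1 / f x\<close>, so that Chernoff's bound at \<open>x / 2\<close> gives \<open>f x ^ 3\<close>; truncating at \<open>b x\<close> gives
  exponential moments at the fluctuation scale. The level is still at least of order
  \<open>x powr (1 / \<alpha>)\<close>, because \<open>q x\<close> is at most of order \<open>x powr (1 - 1 / \<alpha>)\<close>.\<close>

definition h where "h x = min (b x) (x / q x)"

lemma q_at_top: "filterlim q at_top at_top"
proof -
  have "filterlim f (at_right 0) at_top"
    unfolding filterlim_at using f_tendsto f_eventually_pos by (auto elim: eventually_mono)
  then have "filterlim (\<lambda>x. ln (f x)) at_bot at_top" by (rule filterlim_compose[OF ln_at_0])
  then show ?thesis unfolding q_def[abs_def] by (simp add: filterlim_uminus_at_top)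
qed

lemma h_lower: "\<exists>c>0. \<forall>\<^sub>F x in at_top. c * x \<le> h x powr \<alpha>"
proof -
  obtain c where c: "0 < c" and bc: "\<forall>\<^sub>F x in at_top. c * x powr (1 / \<alpha>) \<le> b x"
    using b_lower by auto
  obtain C where C: "0 < C" and qC: "\<forall>\<^sub>F x in at_top. - ln (f x) \<le> C * x powr (1 - 1 / \<alpha>)"
    using minus_ln_f_le by auto
  have q1: "\<forall>\<^sub>F x in at_top. 1 \<le> q x" using q_at_top by (simp add: filterlim_at_top)
  define c' where "c' = min c (1 / C)"
  have c': "0 < c'" using c C by (simp add: c'_def)
  have "\<forall>\<^sub>F x in at_top. c' powr \<alpha> * x \<le> h x powr \<alpha>"
    using bc qC q1 eventually_ge_at_top[of "1::real"]
  proof eventually_elim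
    fix x :: real assume b: "c * x powr (1 / \<alpha>) \<le> b x" and qx: "- ln (f x) \<le> C * x powr (1 - 1 / \<alpha>)"
      and q1: "1 \<le> q x" and x: "1 \<le> x"
    have "1 / C * x powr (1 / \<alpha>) * q x \<le> 1 / C * x powr (1 / \<alpha>) * (C * x powr (1 - 1 / \<alpha>))"
      using qx C by (intro mult_left_mono) (auto simp: q_def)
    also have "\<dots> = x" using C x by (simp add: powr_add[symmetric])
    finally have "1 / C * x powr (1 / \<alpha>) \<le> x / q x" using q1 by (simp add: field_simps)
    moreover have "c' * x powr (1 / \<alpha>) \<le> 1 / C * x powr (1 / \<alpha>)" "c' * x powr (1 / \<alpha>) \<le> c * x powr (1 / \<alpha>)"
      unfolding c'_def by (intro mult_right_mono min.cobounded1 min.cobounded2 powr_ge_zero)+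
    ultimately have "c' * x powr (1 / \<alpha>) \<le> h x" using b by (simp add: h_def)
    then have "(c' * x powr (1 / \<alpha>)) powr \<alpha> \<le> h x powr \<alpha>" using c' \<alpha> by (intro powr_mono2) auto
    then show "c' powr \<alpha> * x \<le> h x powr \<alpha>" using c' x \<alpha> by (simp add: powr_mult powr_powr)
  qed
  then show ?thesis using c' by (intro exI[of _ "c' powr \<alpha>"]) auto
qed

lemma h_at_top: "filterlim h at_top at_top"
proof -
  obtain c where c: "0 < c" and hc: "\<forall>\<^sub>F x in at_top. c * x \<le> h x powr \<alpha>"
    using h_lower by auto
  have q1: "\<forall>\<^sub>F x in at_top. 1 \<le> q x" using q_at_top by (simp add: filterlim_at_top)
  show ?thesis unfolding filterlim_at_top
  proof
    fix Z :: real
    show "\<forall>\<^sub>F x in at_top. Z \<le> h x"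
      using hc q1 eventually_ge_at_top[of "max 1 ((max 1 Z) powr \<alpha> / c)"]
    proof eventually_elim
      fix x assume hx: "c * x \<le> h x powr \<alpha>" and q1: "1 \<le> q x" and x: "max 1 ((max 1 Z) powr \<alpha> / c) \<le> x"
      have "max 1 Z powr \<alpha> \<le> c * x" using x c by (simp add: field_simps)
      with hx have le: "max 1 Z powr \<alpha> \<le> h x powr \<alpha>" by linarith
      have "0 < h x" using x q1 b_pos[of x] by (auto simp: h_def)
      then have "max 1 Z \<le> h x" using le \<alpha> by (smt (verit) powr_less_mono2)
      then show "Z \<le> h x" by simp
    qed
  qed
qed

text \<open>Since \<open>s\<close> is at most a multiple of \<open>x\<close>, hence of
  \<open>h x powr \<alpha>\<close>, Markov's inequality with the \<alpha>-th moment gives both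
  bounds with \<open>T (h x)\<close> as the small factor. The second keeps the compensating shift
  below the fluctuation scale.\<close>

lemma large_jumps_negligible:
  assumes \<theta>: "0 < \<theta>" and \<epsilon>: "0 < \<epsilon>"
  shows "\<forall>\<^sub>F x in at_top. \<forall>s. 0 < s \<longrightarrow> s \<le> x / \<theta> \<longrightarrow>
    s * measure \<nu> {h x<..} \<le> \<epsilon> \<and> s * (LINT y|\<nu>. indicator {h x<..} y * y) \<le> \<epsilon> * h x"
proof -
  obtain c where c: "0 < c" and hc: "\<forall>\<^sub>F x in at_top. c * x \<le> h x powr \<alpha>"
    using h_lower by auto
  have h1: "\<forall>\<^sub>F x in at_top. 1 \<le> h x" using h_at_top by (simp add: filterlim_at_top)
  have "((\<lambda>x. T (h x)) \<longlongrightarrow> 0) at_top" by (rule filterlim_compose[OF T_tendsto h_at_top])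
  then have "\<forall>\<^sub>F x in at_top. T (h x) < \<epsilon> * \<theta> * c" using \<epsilon> \<theta> c by (intro order_tendstoD) auto
  then show ?thesis using hc h1 eventually_gt_at_top[of "0::real"]
  proof eventually_elim
    fix x assume Tx: "T (h x) < \<epsilon> * \<theta> * c" and hx: "c * x \<le> h x powr \<alpha>" and h1: "1 \<le> h x" and x: "0 < x"
    show "\<forall>s. 0 < s \<longrightarrow> s \<le> x / \<theta> \<longrightarrow>
      s * measure \<nu> {h x<..} \<le> \<epsilon> \<and> s * (LINT y|\<nu>. indicator {h x<..} y * y) \<le> \<epsilon> * h x"
    proof (intro allI impI)
      fix s assume s: "0 < s" "s \<le> x / \<theta>"
      have hp: "0 < h x powr \<alpha>" using h1 by simp
      have sT: "s * T (h x) \<le> \<epsilon> * h x powr \<alpha>"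
      proof -
        have "s * T (h x) \<le> (x / \<theta>) * (\<epsilon> * \<theta> * c)" using s Tx T_nonneg[of "h x"] x \<theta> by (intro mult_mono) auto
        also have "\<dots> = \<epsilon> * (c * x)" using \<theta> by simp
        also have "\<dots> \<le> \<epsilon> * h x powr \<alpha>" using hx \<epsilon> by (intro mult_left_mono) auto
        finally show ?thesis .
      qed
      have "s * measure \<nu> {h x<..} * h x powr \<alpha> \<le> s * T (h x)"
        using tail_le_T(1)[OF h1] s by (simp add: mult.assoc mult_left_mono)
      then have "s * measure \<nu> {h x<..} * h x powr \<alpha> \<le> \<epsilon> * h x powr \<alpha>" using sT by linarith
      then have A: "s * measure \<nu> {h x<..} \<le> \<epsilon>" using hp by (simp only: mult_le_cancel_right_pos)
      have "s * (LINT y|\<nu>. indicator {h x<..} y * y) * h x powr (\<alpha> - 1) \<le> s * T (h x)"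
        using tail_le_T(2)[OF h1] s by (simp add: mult.assoc mult_left_mono)
      also have "h x powr \<alpha> = h x * h x powr (\<alpha> - 1)" using h1 powr_add[of "h x" 1 "\<alpha> - 1"] by simp
      with sT have "s * T (h x) \<le> \<epsilon> * h x * h x powr (\<alpha> - 1)" by (simp add: mult.assoc)
      finally have "s * (LINT y|\<nu>. indicator {h x<..} y * y) * h x powr (\<alpha> - 1) \<le> \<epsilon> * h x * h x powr (\<alpha> - 1)" .
      moreover have "0 < h x powr (\<alpha> - 1)" using h1 by simp
      ultimately have "s * (LINT y|\<nu>. indicator {h x<..} y * y) \<le> \<epsilon> * h x" by (simp only: mult_le_cancel_right_pos)
      with A show "s * measure \<nu> {h x<..} \<le> \<epsilon> \<and> s * (LINT y|\<nu>. indicator {h x<..} y * y) \<le> \<epsilon> * h x" ..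
    qed
  qed
qed

section \<open>Local mass of the large-jump part and rates for the small-jump part\<close>

definition jumps where
  "jumps x s = compound_poisson (s * measure \<nu> {h x<..}) (jump_tail_law \<nu> (h x))"

text \<open>On \<open>u \<ge> h x - d\<close> the time is at most a multiple of
  \<open>u powr \<alpha>\<close>. So \<open>s\<close> times the bare convolution integral is
  dominated by the weighted integral of \<open>convolution_tail\<close>, in which \<open>s\<close>
  no longer occurs.\<close>

lemma jumps_local_bound:
  assumes \<theta>: "0 < \<theta>" and \<epsilon>: "0 < \<epsilon>" "\<epsilon> < 1"
  shows "\<forall>\<^sub>F x in at_top. \<forall>s. 0 < s \<longrightarrow> s \<le> x / \<theta> \<longrightarrow> (\<forall>y\<ge>0.
    emeasure (jumps x s) {y<..y + d} \<le> (if y < h x - d then 0 else ennreal (s * f y / (1 - \<epsilon>))))"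
proof -
  obtain c where c: "0 < c" and hc: "\<forall>\<^sub>F x in at_top. c * x \<le> h x powr \<alpha>"
    using h_lower by auto
  \<comment> \<open>Makes the ratio \<open>2 * C * \<eta> / d\<close> of the geometric series equal
    to \<epsilon> for \<open>C = 2\<close>, the constant that insensitivity provides within one
    window.\<close>
  define \<eta> where "\<eta> = d * \<epsilon> / 4"
  have \<eta>: "0 < \<eta>" using d \<epsilon> by (simp add: \<eta>_def)
  \<comment> \<open>Compensates the factor \<open>4 / (\<theta> * c)\<close> in the bound
    \<open>sA\<close> on \<open>s\<close>.\<close>
  define \<epsilon>' where "\<epsilon>' = \<eta> * (\<theta> * c / 4)"
  have \<epsilon>': "0 < \<epsilon>'" using \<eta> \<theta> c by (simp add: \<epsilon>'_def)
  obtain A0 where A0: "\<And>A y. A0 \<le> A \<Longrightarrow> 2 * A - d \<le> y \<Longrightarrow>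
    (\<integral>\<^sup>+u. indicator {A..(y + d) / 2} u * ennreal (u powr \<alpha> * f u * f (y - u)) \<partial>lborel) \<le> ennreal (\<epsilon>' * f y)"
    using convolution_tail[OF \<epsilon>'] by blast
  obtain R0 where R0: "\<And>x y. R0 \<le> x \<Longrightarrow> \<bar>y\<bar> \<le> d \<Longrightarrow> f (x - y) \<le> 2 * f x"
    using insens_bounded[of d 1] d unfolding eventually_at_top_linorder
    by (metis less_imp_le one_add_one zero_less_one)
  have "\<forall>\<^sub>F x in at_top. max (2 * d + 1) (max (A0 + d) (R0 + d)) \<le> h x"
    using h_at_top by (simp only: filterlim_at_top)
  then show ?thesis using hc eventually_gt_at_top[of "0::real"]
  proof eventually_elim
    fix x assume hb: "max (2 * d + 1) (max (A0 + d) (R0 + d)) \<le> h x" and hx: "c * x \<le> h x powr \<alpha>" and x: "0 < x"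
    define H where "H = h x"
    have H: "2 * d + 1 \<le> H" "A0 + d \<le> H" "R0 + d \<le> H" "c * x \<le> H powr \<alpha>" using hb hx by (auto simp: H_def)
    have H0: "0 < H" "H / 2 \<le> H - d" "1 \<le> H - d" using H d by auto
    note J = jump_tail_law[OF sets_\<nu> int_\<nu> H0(1) tail_pos[OF H0(1)]]
    show "\<forall>s. 0 < s \<longrightarrow> s \<le> x / \<theta> \<longrightarrow> (\<forall>y\<ge>0.
      emeasure (jumps x s) {y<..y + d} \<le> (if y < h x - d then 0 else ennreal (s * f y / (1 - \<epsilon>))))"
    proof (intro allI impI)
      fix s y :: real assume s: "0 < s" "s \<le> x / \<theta>" and y: "0 \<le> y"
      have q: "2 * 2 * \<eta> / d = \<epsilon>" using d by (simp add: \<eta>_def)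
      have "emeasure (compound_poisson (s * measure \<nu> {H<..}) (jump_tail_law \<nu> H)) {y<..y + d} \<le>
        (if y < H - d then 0 else ennreal (s * f y / (1 - 2 * 2 * \<eta> / d)))"
      proof (rule compound_poisson_local_bound[OF J(1) d _ J(2)])
        show "d \<le> H" using H d by linarith
        show "0 < s * measure \<nu> {H<..}" using s tail_pos[OF H0(1)] by simp
        show "0 < s" "(0::real) \<le> 2" "0 \<le> \<eta>" "0 \<le> y" "2 * 2 * \<eta> / d < 1" using s \<eta> y q \<epsilon> by auto
        show "s * measure \<nu> {H<..} * measure (jump_tail_law \<nu> H) {u<..u + d} \<le> s * f u" if "H - d \<le> u" for u
        proof -
          have "measure \<nu> ({u<..u + d} \<inter> {H<..}) \<le> f u"
            unfolding f_def measure_def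
          proof (intro enn2real_mono emeasure_mono)
            have "emeasure \<nu> {u<..u + d} \<le> emeasure \<nu> {u<..}" by (intro emeasure_mono) auto
            also have "\<dots> < top" using tail_finite[of u] that H0 by simp
            finally show "emeasure \<nu> {u<..u + d} < top" .
          qed auto
          then show ?thesis using J(3)[of "{u<..u + d}"] s by (simp add: mult.assoc mult_left_mono)
        qed
        show "0 \<le> f u" for u by (rule f_nonneg)
        show "(\<lambda>u. f u * indicator {H - d..} u) \<in> borel_measurable borel" by (rule f_measurable[OF H0(3)])
        show "f u \<le> 2 * f v" if "H - d \<le> u" "u \<le> v" "v \<le> u + d" for u v
          using R0[of v "v - u"] that H by auto
        fix y assume y: "2 * H - d \<le> y"
        define A where "A = H - d"
        have A: "A0 \<le> A" "2 * A - d \<le> y" "1 \<le> A" using H y d H0 by (auto simp: A_def)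
        have A\<alpha>: "0 < A powr \<alpha>" using A by simp
        have sA: "s \<le> 4 / (\<theta> * c) * A powr \<alpha>"
        proof -
          \<comment> \<open>\<open>A\<close> is at least half of \<open>H\<close>, and 4 bounds
            2^\<alpha>.\<close>
          have "H powr \<alpha> = 2 powr \<alpha> * (H / 2) powr \<alpha>" using H0 by (simp add: powr_mult[symmetric])
          also have "\<dots> \<le> 2 powr 2 * A powr \<alpha>"
            using H0 \<alpha> by (intro mult_mono powr_mono powr_mono2) (auto simp: A_def)
          finally have "c * x \<le> 4 * A powr \<alpha>" using H by simp
          have "s \<le> (c * x) / (\<theta> * c)" using s c by simp
          also have "\<dots> \<le> (4 * A powr \<alpha>) / (\<theta> * c)"
            using \<open>c * x \<le> 4 * A powr \<alpha>\<close> \<theta> c by (intro divide_right_mono) auto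
          finally show ?thesis by simp
        qed
        have "ennreal s * (\<integral>\<^sup>+u. indicator {H - d..(y + d) / 2} u * ennreal (f u * f (y - u)) \<partial>lborel) =
          ennreal s * (\<integral>\<^sup>+u. indicator {A..(y + d) / 2} u * ennreal (f u * f (y - u)) \<partial>lborel)" by (simp add: A_def)
        also have "\<dots> \<le> ennreal s * (\<integral>\<^sup>+u. ennreal (1 / A powr \<alpha>) * (indicator {A..(y + d) / 2} u * ennreal (u powr \<alpha> * f u * f (y - u))) \<partial>lborel)"
        proof (intro mult_left_mono nn_integral_mono)
          fix u
          show "indicator {A..(y + d) / 2} u * ennreal (f u * f (y - u)) \<le>
            ennreal (1 / A powr \<alpha>) * (indicator {A..(y + d) / 2} u * ennreal (u powr \<alpha> * f u * f (y - u)))"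
          proof (cases "A \<le> u \<and> u \<le> (y + d) / 2")
            case True
            have "A powr \<alpha> \<le> u powr \<alpha>" using True A \<alpha> by (intro powr_mono2) auto
            then have "A powr \<alpha> * (f u * f (y - u)) \<le> u powr \<alpha> * (f u * f (y - u))"
              by (intro mult_right_mono mult_nonneg_nonneg f_nonneg)
            then have "f u * f (y - u) \<le> 1 / A powr \<alpha> * (u powr \<alpha> * f u * f (y - u))"
              using A\<alpha> by (simp add: field_simps)
            then have "ennreal (f u * f (y - u)) \<le> ennreal (1 / A powr \<alpha> * (u powr \<alpha> * f u * f (y - u)))" by (rule ennreal_leI)
            also have "\<dots> = ennreal (1 / A powr \<alpha>) * ennreal (u powr \<alpha> * f u * f (y - u))"
              using A\<alpha> by (intro ennreal_mult mult_nonneg_nonneg f_nonneg) auto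
            finally show ?thesis using True by simp
          qed simp
        qed simp
        also have "(\<integral>\<^sup>+u. ennreal (1 / A powr \<alpha>) * (indicator {A..(y + d) / 2} u * ennreal (u powr \<alpha> * f u * f (y - u))) \<partial>lborel) =
          ennreal (1 / A powr \<alpha>) * (\<integral>\<^sup>+u. indicator {A..(y + d) / 2} u * ennreal (u powr \<alpha> * f u * f (y - u)) \<partial>lborel)"
        proof (rule nn_integral_cmult)
          have "(\<lambda>u. f (y - u) * indicator {A..} (y - u)) \<in> borel_measurable borel"
            by (rule measurable_compose[OF _ f_measurable[OF A(3)]]) measurable
          then have "(\<lambda>u. indicator {A..(y + d) / 2} u * ennreal (u powr \<alpha> * (f u * indicator {A..} u) * (f (y - u) * indicator {A..} (y - u)))) \<in> borel_measurable borel"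
            using f_measurable[OF A(3)] by measurable
          also have "(\<lambda>u. indicator {A..(y + d) / 2} u * ennreal (u powr \<alpha> * (f u * indicator {A..} u) * (f (y - u) * indicator {A..} (y - u)))) =
            (\<lambda>u. indicator {A..(y + d) / 2} u * ennreal (u powr \<alpha> * f u * f (y - u)))"
            using y d by (auto simp: indicator_def A_def fun_eq_iff)
          finally show "(\<lambda>u. indicator {A..(y + d) / 2} u * ennreal (u powr \<alpha> * f u * f (y - u))) \<in> borel_measurable lborel" by simp
        qed
        also have "ennreal s * (ennreal (1 / A powr \<alpha>) * (\<integral>\<^sup>+u. indicator {A..(y + d) / 2} u * ennreal (u powr \<alpha> * f u * f (y - u)) \<partial>lborel))
          \<le> ennreal s * (ennreal (1 / A powr \<alpha>) * ennreal (\<epsilon>' * f y))"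
          by (intro mult_left_mono A0 A) auto
        also have "\<dots> = ennreal (s * (1 / A powr \<alpha>) * \<epsilon>' * f y)"
          using s A\<alpha> \<epsilon>' f_nonneg[of y] by (simp add: ennreal_mult[symmetric] mult.assoc)
        also have "\<dots> \<le> ennreal (\<eta> * f y)"
        proof (intro ennreal_leI mult_right_mono f_nonneg)
          have "s * (1 / A powr \<alpha>) \<le> 4 / (\<theta> * c)" using sA A\<alpha> by (simp add: pos_divide_le_eq)
          then have "s * (1 / A powr \<alpha>) * \<epsilon>' \<le> 4 / (\<theta> * c) * \<epsilon>'" using \<epsilon>' by (intro mult_right_mono) auto
          also have "\<dots> = \<eta>" using \<theta> c by (simp add: \<epsilon>'_def)
          finally show "s * (1 / A powr \<alpha>) * \<epsilon>' \<le> \<eta>" .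
        qed
        finally show "ennreal s * (\<integral>\<^sup>+u. indicator {H - d..(y + d) / 2} u * ennreal (f u * f (y - u)) \<partial>lborel) \<le> ennreal (\<eta> * f y)" .
      qed
      then show "emeasure (jumps x s) {y<..y + d} \<le> (if y < h x - d then 0 else ennreal (s * f y / (1 - \<epsilon>)))"
        unfolding q by (simp add: jumps_def H_def)
    qed
  qed
qed

text \<open>Put r = x / (8 q(x)), which is at least h(x) / 8 and so tends to infinity. The left side
  is s / r times a quantity tending to 0, and s / r is at most s and at most 8 q(x) / \<theta>. The
  bound by \<open>q x\<close> keeps the exponential moment below 1 / f(x); the bound by
  \<open>s\<close> provides a factor \<open>s\<close> at small times.\<close>

lemma chernoff_rate:
  assumes \<theta>: "0 < \<theta>"
  shows "\<forall>\<^sub>F x in at_top. \<forall>s. 0 < s \<longrightarrow> s \<le> x / \<theta> \<longrightarrow>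
    s * exp 8 * trunc_var \<sigma> \<nu> (1 / (8 * q x / x)) \<le> min s (q x)"
proof -
  define \<omega> where "\<omega> r = r * trunc_var \<sigma> \<nu> r" for r
  have r_top: "filterlim (\<lambda>x. 1 / (8 * q x / x)) at_top at_top"
  proof (rule filterlim_at_top_mono)
    show "filterlim (\<lambda>x. 1 / 8 * h x) at_top at_top"
      by (intro filterlim_tendsto_pos_mult_at_top[OF tendsto_const] h_at_top) auto
    show "\<forall>\<^sub>F x in at_top. 1 / 8 * h x \<le> 1 / (8 * q x / x)"
      by (intro always_eventually allI) (simp add: h_def)
  qed
  have "((\<lambda>x. \<omega> (1 / (8 * q x / x))) \<longlongrightarrow> 0) at_top"
    unfolding \<omega>_def by (rule filterlim_compose[OF trunc_var_sublinear[OF sets_\<nu> int_\<nu>] r_top])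
  then have "\<forall>\<^sub>F x in at_top. \<omega> (1 / (8 * q x / x)) < min 1 (\<theta> / 8) / exp 8" using \<theta> by (intro order_tendstoD) auto
  moreover have "\<forall>\<^sub>F x in at_top. 1 \<le> 1 / (8 * q x / x)" using r_top by (simp only: filterlim_at_top)
  moreover have "\<forall>\<^sub>F x in at_top. 1 \<le> q x" using q_at_top by (simp only: filterlim_at_top)
  ultimately show ?thesis using eventually_gt_at_top[of "0::real"]
  proof eventually_elim
    fix x assume w: "\<omega> (1 / (8 * q x / x)) < min 1 (\<theta> / 8) / exp 8" and r1: "1 \<le> 1 / (8 * q x / x)"
      and q1: "1 \<le> q x" and x: "0 < x"
    define r where "r = 1 / (8 * q x / x)"
    have r: "1 \<le> r" using r1 by (simp add: r_def)
    have rx: "x = 8 * q x * r" using q1 x by (simp add: r_def)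
    show "\<forall>s. 0 < s \<longrightarrow> s \<le> x / \<theta> \<longrightarrow> s * exp 8 * trunc_var \<sigma> \<nu> (1 / (8 * q x / x)) \<le> min s (q x)"
    proof (intro allI impI)
      fix s assume s: "0 < s" "s \<le> x / \<theta>"
      have "exp 8 * \<omega> r \<le> min 1 (\<theta> / 8)" using w by (simp add: r_def field_simps)
      then have w1: "exp 8 * \<omega> r \<le> 1" "exp 8 * \<omega> r \<le> \<theta> / 8" by auto
      have e: "s * exp 8 * trunc_var \<sigma> \<nu> r = s / r * (exp 8 * \<omega> r)" using r by (simp add: \<omega>_def)
      have sr: "0 \<le> s / r" "s / r \<le> s" "s / r \<le> 8 * q x / \<theta>"
      proof -
        show "0 \<le> s / r" using s r by simp
        show "s / r \<le> s" using s r by (simp add: divide_le_eq mult_le_cancel_left1)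
        have "s / r \<le> x / \<theta> / r" using s r by (intro divide_right_mono) auto
        also have "x / \<theta> / r = 8 * q x / \<theta>" using r by (subst rx) simp
        finally show "s / r \<le> 8 * q x / \<theta>" .
      qed
      have "s / r * (exp 8 * \<omega> r) \<le> s * 1" using sr w1 trunc_var_nonneg[of \<sigma> \<nu> r] r s by (intro mult_mono) (auto simp: \<omega>_def)
      moreover have "s / r * (exp 8 * \<omega> r) \<le> 8 * q x / \<theta> * (\<theta> / 8)"
        using sr w1 trunc_var_nonneg[of \<sigma> \<nu> r] r s \<theta> q1 by (intro mult_mono) (auto simp: \<omega>_def)
      ultimately show "s * exp 8 * trunc_var \<sigma> \<nu> (1 / (8 * q x / x)) \<le> min s (q x)"
        using \<theta> unfolding r_def[symmetric] e by simp
    qed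
  qed
qed

text \<open>Times of order \<open>x\<close> are admissible because
  \<open>x * trunc_var \<sigma> \<nu> (b x)\<close> is bounded. The rate 2 / b(x) is twice the rate
  in \<open>f_exp_growth\<close>, which leaves an exponential factor to spare.\<close>

lemma scale_rate:
  assumes \<theta>: "0 < \<theta>"
  shows "\<exists>C. \<forall>\<^sub>F x in at_top. \<forall>s. 0 < s \<longrightarrow> s \<le> x / \<theta> \<longrightarrow>
    s * exp 2 * trunc_var \<sigma> \<nu> (1 / (2 / b x)) \<le> C"
proof -
  obtain C where C: "0 < C" and bC: "\<forall>\<^sub>F x in at_top. x * trunc_var \<sigma> \<nu> (b x) \<le> C"
    using trunc_var_at_b by auto
  have "\<forall>\<^sub>F x in at_top. \<forall>s. 0 < s \<longrightarrow> s \<le> x / \<theta> \<longrightarrow>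
    s * exp 2 * trunc_var \<sigma> \<nu> (1 / (2 / b x)) \<le> 4 * exp 2 * C / \<theta>"
    using bC eventually_gt_at_top[of "0::real"]
  proof eventually_elim
    fix x assume bC: "x * trunc_var \<sigma> \<nu> (b x) \<le> C" and x: "0 < x"
    show "\<forall>s. 0 < s \<longrightarrow> s \<le> x / \<theta> \<longrightarrow> s * exp 2 * trunc_var \<sigma> \<nu> (1 / (2 / b x)) \<le> 4 * exp 2 * C / \<theta>"
    proof (intro allI impI)
      fix s assume s: "0 < s" "s \<le> x / \<theta>"
      have "trunc_var \<sigma> \<nu> (b x / 2) \<le> 2\<^sup>2 * trunc_var \<sigma> \<nu> (b x)"
        using b_pos[of x] x by (intro trunc_var_mono_scale sets_\<nu> int_\<nu>) auto
      then have "s * exp 2 * trunc_var \<sigma> \<nu> (b x / 2) \<le> s * exp 2 * (4 * trunc_var \<sigma> \<nu> (b x))"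
        using s by (intro mult_left_mono) auto
      also have "\<dots> = 4 * exp 2 * (s * trunc_var \<sigma> \<nu> (b x))" by simp
      also have "\<dots> \<le> 4 * exp 2 * (x / \<theta> * trunc_var \<sigma> \<nu> (b x))"
        using s by (intro mult_left_mono mult_right_mono trunc_var_nonneg) auto
      also have "\<dots> = 4 * exp 2 * (x * trunc_var \<sigma> \<nu> (b x)) / \<theta>" by simp
      also have "\<dots> \<le> 4 * exp 2 * C / \<theta>" using bC \<theta> by (intro divide_right_mono mult_left_mono) auto
      finally show "s * exp 2 * trunc_var \<sigma> \<nu> (1 / (2 / b x)) \<le> 4 * exp 2 * C / \<theta>" by simp
    qed
  qed
  then show ?thesis by blast
qed


text \<open>All asymptotic information is collected as hypotheses at a single \<open>x\<close> and
  \<open>s\<close>, which reduces the proof to a case distinction over the position of the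
  small-jump part. The constant 8 is generous: the upper bound loses 7 e, the lower bound three
  factors 1 - e.\<close>

lemma local_bounds:
  assumes e: "0 < e" "e \<le> 1 / 2" and x: "0 < x" "0 < f x" "f x \<le> e / 2" "1 \<le> q x" and s: "0 < s"
    and C: "1 \<le> C" and K: "2 \<le> K" "(2 * C + 2 * exp 1) * E \<le> e * (K - 1)" "0 < E"
    and h: "0 < h x" and Kb: "(K + 1) * b x \<le> x / 2"
    and large: "s * measure \<nu> {h x<..} \<le> e" "s * (LINT y|\<nu>. indicator {h x<..} y * y) \<le> e * h x"
    and jl: "\<And>y. 0 \<le> y \<Longrightarrow> emeasure (jumps x s) {y<..y + d} \<le> (if y < h x - d then 0 else ennreal (s * f y / (1 - e)))"
    and ch: "s * exp 8 * trunc_var \<sigma> \<nu> (1 / (8 * q x / x)) \<le> min s (q x)"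
    and sc: "exp (s * exp 2 * trunc_var \<sigma> \<nu> (1 / (2 / b x))) \<le> E"
    and ins: "\<And>y. \<bar>y\<bar> \<le> (K + 1) * b x \<Longrightarrow> (1 - e) * f x \<le> f (x - y) \<and> f (x - y) \<le> (1 + e) * f x"
    and gr: "\<And>z. 0 \<le> z \<Longrightarrow> z \<le> x / 2 \<Longrightarrow> f (x - z) \<le> f x * exp (1 + z / b x)"
    and f1: "\<And>y. h x - d \<le> y \<Longrightarrow> f y \<le> 1" and fC: "\<And>y. x \<le> y \<Longrightarrow> f y \<le> C * f x"
  shows "\<bar>measure (\<mu> s) {x<..x + d} - s * f x\<bar> \<le> 8 * e * (s * f x)"
proof -
  interpret D: real_distribution "\<mu> s" by (rule \<mu>[OF s])
  have b: "0 < b x" by (rule b_pos) (use x in simp)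
  have hb: "h x \<le> b x" "8 * q x / x * h x \<le> 8"
  proof -
    show "h x \<le> b x" by (simp add: h_def)
    have "8 * q x / x * h x \<le> 8 * q x / x * (x / q x)" using x by (intro mult_left_mono) (auto simp: h_def)
    then show "8 * q x / x * h x \<le> 8" using x by simp
  qed
  define a where "a = s * measure \<nu> {h x<..}"
  have a: "0 < a" "a \<le> e" using s tail_pos[OF h] large by (auto simp: a_def)
  define c where "c = s * (LINT y|\<nu>. indicator {h x<..} y * y)"
  have c: "0 \<le> c" "c \<le> b x"
  proof -
    have "0 \<le> (LINT y|\<nu>. indicator {h x<..} y * y)"
      using h by (intro integral_nonneg_AE AE_I2) (auto simp: indicator_def)
    then show "0 \<le> c" using s by (simp add: c_def)
    have "c \<le> e * h x" using large by (simp add: c_def)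
    also have "\<dots> \<le> 1 * b x" using e h hb by (intro mult_mono) auto
    finally show "c \<le> b x" by simp
  qed
  note J = jump_tail_law[OF sets_\<nu> int_\<nu> h tail_pos[OF h]]
  have CP: "real_distribution (jumps x s)"
    unfolding jumps_def by (rule real_distribution_compound_poisson[OF J(1)])
  interpret CP: real_distribution "jumps x s" by (rule CP)
  interpret J: real_distribution "jump_tail_law \<nu> (h x)" by (rule J)
  obtain Z where Z: "real_distribution Z"
    and eq: "\<And>\<phi>. \<phi> \<in> borel_measurable borel \<Longrightarrow> (\<integral>\<^sup>+x. \<phi> x \<partial>\<mu> s) = (\<integral>\<^sup>+z. \<integral>\<^sup>+w. \<phi> (z - c + w) \<partial>jumps x s \<partial>Z)"
    and Zl: "\<And>l A. 0 < l \<Longrightarrow> l * h x \<le> A \<Longrightarrow> 0 \<le> A \<Longrightarrow>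
      (\<integral>\<^sup>+z. ennreal (exp (l * z) - 1 - l * z) \<partial>Z) \<le> ennreal (exp (s * exp A * trunc_var \<sigma> \<nu> (1 / l)) - 1) \<and>
      (\<integral>\<^sup>+z. ennreal (exp (l * z)) \<partial>Z) \<le> ennreal (exp (s * exp A * trunc_var \<sigma> \<nu> (1 / l))) \<and>
      (\<integral>\<^sup>+z. ennreal \<bar>z\<bar> \<partial>Z) \<le> ennreal (2 / l * exp (s * exp A * trunc_var \<sigma> \<nu> (1 / l)))"
    using levy_split[OF sets_\<nu> int_\<nu> h s tail_pos[OF h] \<mu>[OF s] char_\<mu>[OF s]]
    unfolding c_def jumps_def by blast
  interpret Z: real_distribution Z by (rule Z)
  have eq_f: "exp (- q x) = f x" using x by (simp add: q_def)
  define l where "l = 8 * q x / x"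
  have l: "0 < l" using x by (simp add: l_def)
  define L where "L = s * exp 8 * trunc_var \<sigma> \<nu> (1 / l)"
  have L: "0 \<le> L" "L \<le> s" "L \<le> q x"
    using ch s trunc_var_nonneg[of \<sigma> \<nu> "1 / l"] by (auto simp: L_def l_def)
  \<comment> \<open>At the rate \<open>l\<close> the threshold \<open>x / 2\<close> contributes
    exp(-4 q), the moment at most exp(q), and f = exp(-q).\<close>
  have PZ1: "emeasure Z {x / 2..} \<le> ennreal (f x ^ 3)"
  proof -
    have "emeasure Z {x / 2..} = (\<integral>\<^sup>+z. indicator {x / 2..} z \<partial>Z)" by simp
    also have "\<dots> \<le> (\<integral>\<^sup>+z. ennreal (exp (- 4 * q x)) * ennreal (exp (l * z)) \<partial>Z)"
    proof (intro nn_integral_mono)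
      fix z
      show "indicator {x / 2..} z \<le> ennreal (exp (- 4 * q x)) * ennreal (exp (l * z))"
      proof (cases "x / 2 \<le> z")
        case True
        then have "l * (x / 2) \<le> l * z" using l by (intro mult_left_mono) auto
        then have "4 * q x \<le> l * z" using x by (simp add: l_def)
        then show ?thesis using True by (simp add: ennreal_mult[symmetric] exp_add[symmetric])
      qed simp
    qed
    also have "\<dots> = ennreal (exp (- 4 * q x)) * (\<integral>\<^sup>+z. ennreal (exp (l * z)) \<partial>Z)" by (rule nn_integral_cmult) simp
    also have "\<dots> \<le> ennreal (exp (- 4 * q x)) * ennreal (exp (q x))"
      using Zl[OF l, of 8] hb L by (intro mult_left_mono order.trans[OF Zl[OF l, of 8, THEN conjunct2, THEN conjunct1]] ennreal_leI)
        (auto simp: L_def l_def)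
    also have "\<dots> = ennreal (exp (- q x) ^ 3)" by (simp add: ennreal_mult[symmetric] exp_add[symmetric] exp_of_nat_mult[symmetric])
    finally show ?thesis by (simp add: eq_f)
  qed
  text \<open>Markov's inequality for \<open>exp v - 1 - v\<close> instead of \<open>exp v\<close> yields a bound proportional to \<open>s\<close>,
    which is needed for small \<open>s\<close>.\<close>
  have PZ2: "emeasure Z {x..} \<le> ennreal (2 * s * f x ^ 7)"
  proof -
    have "emeasure Z {x..} = (\<integral>\<^sup>+z. indicator {x..} z \<partial>Z)" by simp
    also have "\<dots> \<le> (\<integral>\<^sup>+z. ennreal (2 * exp (- 8 * q x)) * ennreal (exp (l * z) - 1 - l * z) \<partial>Z)"
    proof (intro nn_integral_mono)
      fix z
      show "indicator {x..} z \<le> ennreal (2 * exp (- 8 * q x)) * ennreal (exp (l * z) - 1 - l * z)"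
      proof (cases "x \<le> z")
        case True
        define v where "v = l * z"
        have "l * x \<le> l * z" using l True by (intro mult_left_mono) auto
        then have v: "8 * q x \<le> v" "8 \<le> v" using x by (auto simp: l_def v_def)
        \<comment> \<open>For v \<ge> 8 the quadratic Taylor term dominates, so subtracting 1 + v
          costs at most half of exp v.\<close>
        have "v * 8 \<le> v * v" using v by (intro mult_left_mono) auto
        moreover have "1 + v + v\<^sup>2 / 2 \<le> exp v" using v by (intro exp_lower_Taylor_quadratic) auto
        ultimately have "exp v / 2 \<le> exp v - 1 - v" using v unfolding power2_eq_square by linarith
        moreover have "exp (8 * q x) \<le> exp v" using v by simp
        ultimately have "exp (8 * q x) / 2 \<le> exp v - 1 - v" by linarith
        then have "2 * exp (- 8 * q x) * (exp (8 * q x) / 2) \<le> 2 * exp (- 8 * q x) * (exp v - 1 - v)"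
          by (intro mult_left_mono) auto
        then have "1 \<le> 2 * exp (- 8 * q x) * (exp v - 1 - v)" by (simp add: exp_minus field_simps)
        moreover have "0 \<le> exp v - 1 - v" using exp_ge_add_one_self[of v] by linarith
        ultimately show ?thesis using True by (simp add: ennreal_mult[symmetric] v_def)
      qed simp
    qed
    also have "\<dots> = ennreal (2 * exp (- 8 * q x)) * (\<integral>\<^sup>+z. ennreal (exp (l * z) - 1 - l * z) \<partial>Z)" by (rule nn_integral_cmult) simp
    also have "\<dots> \<le> ennreal (2 * exp (- 8 * q x)) * ennreal (s * exp (q x))"
    proof (intro mult_left_mono)
      \<comment> \<open>This leads to exp L - 1 \<le> L exp L. The first \<open>L\<close> is then
        bounded by \<open>s\<close>, the one in the exponent by \<open>q x\<close>.\<close>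
      have "exp L * (1 - L) \<le> exp L * exp (- L)"
        using exp_ge_add_one_self[of "-L"] by (intro mult_left_mono) auto
      then have "exp L - 1 \<le> L * exp L" by (simp add: exp_minus algebra_simps)
      also have "\<dots> \<le> s * exp (q x)" using L s by (intro mult_mono) auto
      finally have "ennreal (exp L - 1) \<le> ennreal (s * exp (q x))" by (rule ennreal_leI)
      moreover have "(\<integral>\<^sup>+z. ennreal (exp (l * z) - 1 - l * z) \<partial>Z) \<le> ennreal (exp L - 1)"
        using Zl[OF l, of 8] hb by (simp add: L_def l_def)
      ultimately show "(\<integral>\<^sup>+z. ennreal (exp (l * z) - 1 - l * z) \<partial>Z) \<le> ennreal (s * exp (q x))" by (rule order.trans[rotated])
    qed simp
    also have "\<dots> = ennreal (2 * s * exp (- q x) ^ 7)"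
    proof -
      have "exp (- 8 * q x) * exp (q x) = exp (- q x) ^ 7" by (simp add: exp_add[symmetric] exp_of_nat_mult[symmetric])
      then have "2 * exp (- 8 * q x) * (s * exp (q x)) = 2 * s * exp (- q x) ^ 7"
        by (metis mult.assoc mult.left_commute)
      then show ?thesis using s by (subst ennreal_mult[symmetric]) auto
    qed
    finally show ?thesis by (simp add: eq_f)
  qed
  define m where "m = 2 / b x"
  have m: "0 < m" "m * h x \<le> 2" using b hb by (auto simp: m_def field_simps)
  have Eb: "(\<integral>\<^sup>+z. ennreal (exp (m * z)) \<partial>Z) \<le> ennreal E" "(\<integral>\<^sup>+z. ennreal \<bar>z\<bar> \<partial>Z) \<le> ennreal (b x * E)"
  proof -
    show "(\<integral>\<^sup>+z. ennreal (exp (m * z)) \<partial>Z) \<le> ennreal E"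
      using Zl[OF m] sc by (auto simp: m_def intro: order.trans ennreal_leI)
    have "(\<integral>\<^sup>+z. ennreal \<bar>z\<bar> \<partial>Z) \<le> ennreal (2 / m * exp (s * exp 2 * trunc_var \<sigma> \<nu> (1 / m)))"
      using Zl[OF m] by simp
    also have "\<dots> \<le> ennreal (b x * E)"
      using sc b by (intro ennreal_leI mult_mono) (auto simp: m_def)
    finally show "(\<integral>\<^sup>+z. ennreal \<bar>z\<bar> \<partial>Z) \<le> ennreal (b x * E)" .
  qed
  have PZ3: "emeasure Z {z. k * b x \<le> \<bar>z\<bar>} \<le> ennreal (E / k)" if k: "0 < k" for k
  proof -
    have "emeasure Z {z. k * b x \<le> \<bar>z\<bar>} = (\<integral>\<^sup>+z. indicator {z. k * b x \<le> \<bar>z\<bar>} z \<partial>Z)" by simp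
    also have "\<dots> \<le> (\<integral>\<^sup>+z. ennreal (1 / (k * b x)) * ennreal \<bar>z\<bar> \<partial>Z)"
      using k b by (intro nn_integral_mono) (auto simp: indicator_def ennreal_mult[symmetric] field_simps)
    also have "\<dots> = ennreal (1 / (k * b x)) * (\<integral>\<^sup>+z. ennreal \<bar>z\<bar> \<partial>Z)" by (rule nn_integral_cmult) simp
    also have "\<dots> \<le> ennreal (1 / (k * b x)) * ennreal (b x * E)" by (intro mult_left_mono Eb) simp
    also have "\<dots> = ennreal (E / k)" using k b K by (simp add: ennreal_mult[symmetric])
    finally show ?thesis .
  qed
  \<comment> \<open>The growth factor of \<open>f\<close> has rate 1 / b(x), the available moment
    rate 2 / b(x); beyond \<open>K * b x\<close> the surplus is worth a factor exp(-K).\<close>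
  have PZ4: "(\<integral>\<^sup>+z. indicator {K * b x..} z * ennreal (exp (1 + z / b x)) \<partial>Z) \<le> ennreal (exp 1 * E / (K - 1))"
  proof -
    have "(\<integral>\<^sup>+z. indicator {K * b x..} z * ennreal (exp (1 + z / b x)) \<partial>Z) \<le>
      (\<integral>\<^sup>+z. ennreal (exp (1 - K)) * ennreal (exp (m * z)) \<partial>Z)"
    proof (intro nn_integral_mono)
      fix z
      show "indicator {K * b x..} z * ennreal (exp (1 + z / b x)) \<le> ennreal (exp (1 - K)) * ennreal (exp (m * z))"
      proof (cases "K * b x \<le> z")
        case True
        then have "K \<le> z / b x" using b by (simp add: field_simps)
        then show ?thesis using True by (simp add: ennreal_mult[symmetric] exp_add[symmetric] m_def)
      qed simp
    qed
    also have "\<dots> = ennreal (exp (1 - K)) * (\<integral>\<^sup>+z. ennreal (exp (m * z)) \<partial>Z)" by (rule nn_integral_cmult) simp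
    also have "\<dots> \<le> ennreal (exp (1 - K)) * ennreal E" by (intro mult_left_mono Eb) simp
    also have "\<dots> = ennreal (exp (1 - K) * E)" using K by (simp add: ennreal_mult[symmetric])
    also have "\<dots> \<le> ennreal (exp 1 * E / (K - 1))"
    proof (rule ennreal_leI)
      have "K - 1 \<le> exp K" using exp_ge_add_one_self[of K] by linarith
      then have "exp (1 - K) \<le> exp 1 / (K - 1)" using K by (simp add: exp_diff frac_le)
      then have "exp (1 - K) * E \<le> exp 1 / (K - 1) * E" using K by (intro mult_right_mono) auto
      then show "exp (1 - K) * E \<le> exp 1 * E / (K - 1)" by simp
    qed
    finally show ?thesis .
  qed
  define B where "B = {x<..x + d}"
  have emu: "emeasure (\<mu> s) B = (\<integral>\<^sup>+z. emeasure (jumps x s) {x - (z - c)<..x - (z - c) + d} \<partial>Z)"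
  proof -
    have "emeasure (\<mu> s) B = (\<integral>\<^sup>+z. \<integral>\<^sup>+w. indicator B (z - c + w) \<partial>jumps x s \<partial>Z)"
      using eq[of "indicator B"] by (simp add: B_def)
    also have "\<dots> = (\<integral>\<^sup>+z. emeasure (jumps x s) {x - (z - c)<..x - (z - c) + d} \<partial>Z)"
    proof (intro nn_integral_cong)
      fix z
      have "(\<integral>\<^sup>+w. indicator B (z - c + w) \<partial>jumps x s) = (\<integral>\<^sup>+w. indicator {x - (z - c)<..x - (z - c) + d} w \<partial>jumps x s)"
        by (intro nn_integral_cong) (auto simp: B_def indicator_def)
      then show "(\<integral>\<^sup>+w. indicator B (z - c + w) \<partial>jumps x s) = emeasure (jumps x s) {x - (z - c)<..x - (z - c) + d}" by simp
    qed
    finally show ?thesis .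
  qed
  have fx0: "0 \<le> s * f x" using s x by simp
  have one_e: "1 / (1 - e) \<le> 2" "0 < 1 - e" using e by (auto simp: field_simps)
  \<comment> \<open>The crude factor 2 bounds 1 / (1 - e) and serves those positions of
    \<open>z\<close> that are improbable.\<close>
  have jump_le: "emeasure (jumps x s) {y<..y + d} \<le> ennreal (2 * s * t)"
    if "0 \<le> y" "h x - d \<le> y \<Longrightarrow> f y \<le> t" "0 \<le> t" for y t
  proof (cases "y < h x - d")
    case True
    then show ?thesis using jl[OF that(1)] by simp
  next
    case False
    have "s * f y / (1 - e) = s * f y * (1 / (1 - e))" by simp
    also have "\<dots> \<le> s * t * 2" using that False one_e s by (intro mult_mono mult_nonneg_nonneg f_nonneg) auto
    finally show ?thesis using jl[OF that(1)] False
      by (simp add: mult_ac) (meson ennreal_leI order_trans)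
  qed
  have upper: "emeasure (\<mu> s) B \<le> ennreal ((1 + 8 * e) * (s * f x))"
  proof -
    \<comment> \<open>One summand for each range of \<open>z - c\<close>: near 0, far to the left,
      from \<open>K * b x\<close> to \<open>x / 2\<close>, from \<open>x / 2\<close> to
      \<open>x\<close>, and beyond \<open>x\<close>. In the last range the jump law is bounded only
      by 1, so the factor \<open>s\<close> has to come from \<open>Z\<close>.\<close>
    define H where "H z = ennreal ((1 + 4 * e) * (s * f x)) + ennreal (2 * C * (s * f x)) * indicator {z. (K - 1) * b x \<le> \<bar>z\<bar>} z
      + ennreal (2 * (s * f x)) * (indicator {K * b x..} z * ennreal (exp (1 + z / b x)))
      + ennreal (2 * s) * indicator {x / 2..} z + indicator {x..} z" for z
    have "emeasure (\<mu> s) B \<le> (\<integral>\<^sup>+z. H z \<partial>Z)"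
      unfolding emu
    proof (intro nn_integral_mono)
      fix z
      define y where "y = x - (z - c)"
      have "emeasure (jumps x s) {y<..y + d} \<le> H z"
      proof -
        consider "x \<le> z - c" | "x / 2 < z - c" "z - c < x" | "K * b x < z - c" "z - c \<le> x / 2"
          | "\<bar>z - c\<bar> \<le> K * b x" | "z - c < - (K * b x)" by linarith
        then show ?thesis
        proof cases
          case 1
          then have "x \<le> z" using c by simp
          then have "emeasure (jumps x s) {y<..y + d} \<le> indicator {x..} z" using CP.emeasure_le_1 by simp
          also have "\<dots> \<le> H z" by (simp add: H_def)
          finally show ?thesis .
        next
          case 2
          then have "x / 2 \<le> z" using c by simp
          have "emeasure (jumps x s) {y<..y + d} \<le> ennreal (2 * s * 1)"
            using 2 f1 by (intro jump_le) (auto simp: y_def)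
          then have "emeasure (jumps x s) {y<..y + d} \<le> ennreal (2 * s) * indicator {x / 2..} z"
            using \<open>x / 2 \<le> z\<close> by simp
          also have "\<dots> \<le> H z" unfolding H_def by (simp add: add_increasing add_increasing2)
          finally show ?thesis .
        next
          case 3
          have Kb0: "0 \<le> K * b x" using K b by simp
          have "f y \<le> f x * exp (1 + (z - c) / b x)"
            unfolding y_def using 3 Kb0 by (intro gr) auto
          also have "\<dots> \<le> f x * exp (1 + z / b x)" using x b c by (intro mult_left_mono) (auto simp: divide_right_mono)
          finally have fy: "f y \<le> f x * exp (1 + z / b x)" .
          have "emeasure (jumps x s) {y<..y + d} \<le> ennreal (2 * s * (f x * exp (1 + z / b x)))"
            using 3 x fy by (intro jump_le) (auto simp: y_def)
          also have "\<dots> = ennreal (2 * (s * f x)) * (indicator {K * b x..} z * ennreal (exp (1 + z / b x)))"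
            using 3 c fx0 by (simp add: ennreal_mult[symmetric] mult_ac)
          also have "\<dots> \<le> H z" unfolding H_def by (simp add: add_increasing add_increasing2)
          finally show ?thesis .
        next
          case 4
          have "\<bar>z - c\<bar> \<le> (K + 1) * b x" using 4 b by (simp add: distrib_right)
          then have fy: "f y \<le> (1 + e) * f x" "\<bar>z - c\<bar> \<le> x / 2" using ins[of "z - c"] Kb by (auto simp: y_def)
          have y0: "0 \<le> y" using fy(2) x unfolding y_def by linarith
          have "emeasure (jumps x s) {y<..y + d} \<le> ennreal (s * f y / (1 - e))"
            using jl[OF y0] by (auto split: if_splits)
          also have "\<dots> \<le> ennreal ((1 + 4 * e) * (s * f x))"
          proof (rule ennreal_leI)
            \<comment> \<open>Equivalent to 4 e^2 \<le> 2 e, that is, to e \<le> 1 / 2.\<close>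
            have "(1 + e) / (1 - e) \<le> 1 + 4 * e"
              using e by (simp add: pos_divide_le_eq algebra_simps power2_eq_square[symmetric])
            then have "(1 + e) / (1 - e) * (s * f x) \<le> (1 + 4 * e) * (s * f x)" using fx0 by (rule mult_right_mono)
            moreover have "s * f y / (1 - e) \<le> s * ((1 + e) * f x) / (1 - e)"
              using fy s one_e by (intro divide_right_mono mult_left_mono) auto
            ultimately show "s * f y / (1 - e) \<le> (1 + 4 * e) * (s * f x)" by (simp add: mult_ac)
          qed
          also have "\<dots> \<le> H z" unfolding H_def by (simp add: add_increasing2)
          finally show ?thesis .
        next
          case 5
          have Kb0: "0 \<le> K * b x" using K b by simp
          have xy: "x \<le> y" using 5 Kb0 by (simp add: y_def)
          have z: "(K - 1) * b x \<le> \<bar>z\<bar>" using 5 c by (simp add: left_diff_distrib)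
          have "emeasure (jumps x s) {y<..y + d} \<le> ennreal (2 * s * (C * f x))"
            using xy x fC[OF xy] C by (intro jump_le) auto
          also have "\<dots> = ennreal (2 * C * (s * f x)) * indicator {z. (K - 1) * b x \<le> \<bar>z\<bar>} z"
            using z by (simp add: mult_ac)
          also have "\<dots> \<le> H z" unfolding H_def by (simp add: add_increasing add_increasing2)
          finally show ?thesis .
        qed
      qed
      then show "emeasure (jumps x s) {x - (z - c)<..x - (z - c) + d} \<le> H z" by (simp add: y_def)
    qed
    also have "\<dots> = ennreal ((1 + 4 * e) * (s * f x)) + ennreal (2 * C * (s * f x)) * emeasure Z {z. (K - 1) * b x \<le> \<bar>z\<bar>}
      + ennreal (2 * (s * f x)) * (\<integral>\<^sup>+z. indicator {K * b x..} z * ennreal (exp (1 + z / b x)) \<partial>Z)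
      + ennreal (2 * s) * emeasure Z {x / 2..} + emeasure Z {x..}"
      unfolding H_def
      by (simp add: nn_integral_add nn_integral_cmult nn_integral_cmult_indicator Z.emeasure_space_1[simplified])
    also have "\<dots> \<le> ennreal ((1 + 4 * e) * (s * f x)) + ennreal (2 * C * (s * f x)) * ennreal (E / (K - 1))
      + ennreal (2 * (s * f x)) * ennreal (exp 1 * E / (K - 1))
      + ennreal (2 * s) * ennreal (f x ^ 3) + ennreal (2 * s * f x ^ 7)"
      using K by (intro add_mono mult_left_mono PZ1 PZ2 PZ3 PZ4 order_refl) auto
    also have "\<dots> = ennreal ((1 + 4 * e) * (s * f x) + 2 * C * (s * f x) * (E / (K - 1)) +
      2 * (s * f x) * (exp 1 * E / (K - 1)) + 2 * s * f x ^ 3 + 2 * s * f x ^ 7)"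
      using K C e fx0 s x by (simp add: ennreal_mult[symmetric] ennreal_plus[symmetric] del: ennreal_plus)
    also have "\<dots> \<le> ennreal ((1 + 8 * e) * (s * f x))"
    proof (rule ennreal_leI)
      have "2 * C * (s * f x) * (E / (K - 1)) + 2 * (s * f x) * (exp 1 * E / (K - 1)) =
        ((2 * C + 2 * exp 1) * E / (K - 1)) * (s * f x)"
        by (simp add: divide_inverse algebra_simps)
      also have "\<dots> \<le> e * (s * f x)"
        using K by (intro mult_right_mono fx0) (simp add: pos_divide_le_eq)
      finally have 1: "2 * C * (s * f x) * (E / (K - 1)) + 2 * (s * f x) * (exp 1 * E / (K - 1)) \<le> e * (s * f x)" .
      have f01: "f x \<le> 1" using x e by linarith
      have p: "2 * s * f x ^ Suc (Suc n) \<le> e * (s * f x)" for n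
      proof -
        have "f x ^ n \<le> 1" using f01 x by (intro power_le_one) auto
        then have "2 * f x * f x ^ n \<le> 2 * f x * 1" using x by (intro mult_left_mono) auto
        then have "2 * f x * f x ^ n \<le> e" using x by linarith
        then have "2 * f x * f x ^ n * (s * f x) \<le> e * (s * f x)" by (rule mult_right_mono[OF _ fx0])
        then show ?thesis by (simp add: mult_ac)
      qed
      have "2 * s * f x ^ 3 \<le> e * (s * f x)" "2 * s * f x ^ 7 \<le> e * (s * f x)"
        using p[of 1] p[of 5] by (simp_all add: eval_nat_numeral)
      with 1 have "(1 + 4 * e) * (s * f x) + 2 * C * (s * f x) * (E / (K - 1)) +
        2 * (s * f x) * (exp 1 * E / (K - 1)) + 2 * s * f x ^ 3 + 2 * s * f x ^ 7 \<le> (1 + 4 * e) * (s * f x) + 3 * (e * (s * f x))"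
        by linarith
      also have "\<dots> = (1 + 7 * e) * (s * f x)" by (simp add: algebra_simps)
      also have "\<dots> \<le> (1 + 8 * e) * (s * f x)" using e fx0 by (intro mult_right_mono) auto
      finally show "(1 + 4 * e) * (s * f x) + 2 * C * (s * f x) * (E / (K - 1)) +
        2 * (s * f x) * (exp 1 * E / (K - 1)) + 2 * s * f x ^ 3 + 2 * s * f x ^ 7 \<le> (1 + 8 * e) * (s * f x)" .
    qed
    finally show ?thesis .
  qed
  \<comment> \<open>One large jump together with a small-jump part within \<open>K * b x\<close>.
    The three factors 1 - e come from the mass of \<open>Z\<close> there, from exp(-a) and from
    insensitivity.\<close>
  have lower: "ennreal ((1 - 8 * e) * (s * f x)) \<le> emeasure (\<mu> s) B"
  proof -
    have EK: "E / K \<le> e"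
    proof -
      have "1 * E \<le> (2 * C + 2 * exp 1) * E" using K C exp_ge_add_one_self[of 1] by (intro mult_right_mono) auto
      also have "\<dots> \<le> e * (K - 1)" by (rule K)
      also have "\<dots> \<le> e * K" using e by simp
      finally show ?thesis using K by (simp add: pos_divide_le_eq)
    qed
    have PK: "1 - e \<le> measure Z (UNIV - {z. K * b x \<le> \<bar>z\<bar>})"
    proof -
      have "measure Z {z. K * b x \<le> \<bar>z\<bar>} \<le> E / K"
        using PZ3[of K] K by (simp add: Z.emeasure_eq_measure)
      moreover have "measure Z (UNIV - {z. K * b x \<le> \<bar>z\<bar>}) = 1 - measure Z {z. K * b x \<le> \<bar>z\<bar>}"
        using Z.prob_compl[of "{z. K * b x \<le> \<bar>z\<bar>}"] by simp
      ultimately show ?thesis using EK by linarith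
    qed
    have "ennreal ((1 - e) * ((1 - e) * (s * f x))) * emeasure Z (UNIV - {z. K * b x \<le> \<bar>z\<bar>}) =
      (\<integral>\<^sup>+z. ennreal ((1 - e) * ((1 - e) * (s * f x))) * indicator (UNIV - {z. K * b x \<le> \<bar>z\<bar>}) z \<partial>Z)"
      by (rule nn_integral_cmult_indicator[symmetric]) simp
    also have "\<dots> \<le> emeasure (\<mu> s) B" unfolding emu
    proof (intro nn_integral_mono)
      fix z
      show "ennreal ((1 - e) * ((1 - e) * (s * f x))) * indicator (UNIV - {z. K * b x \<le> \<bar>z\<bar>}) z \<le>
        emeasure (jumps x s) {x - (z - c)<..x - (z - c) + d}"
      proof (cases "\<bar>z\<bar> < K * b x")
        case True
        define y where "y = x - (z - c)"
        have zc: "\<bar>z - c\<bar> \<le> (K + 1) * b x" using True c by (simp add: distrib_right)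
        then have fy: "(1 - e) * f x \<le> f y" using ins[of "z - c"] by (simp add: y_def)
        have "1 * b x \<le> (K + 1) * b x" using K b by (intro mult_right_mono) auto
        then have hy: "h x \<le> y" using hb zc Kb by (auto simp: y_def abs_le_iff)
        have "measure \<nu> {h x<..} * measure (jump_tail_law \<nu> (h x)) {y<..y + d} = measure \<nu> ({y<..y + d} \<inter> {h x<..})"
          by (rule J(3)) simp
        also have "{y<..y + d} \<inter> {h x<..} = {y<..y + d}" using hy by auto
        finally have Jy: "a * measure (jump_tail_law \<nu> (h x)) {y<..y + d} = s * f y" by (simp add: a_def f_def[of y] mult.assoc)
        have "(1 - e) * ((1 - e) * (s * f x)) = (1 - e) * (s * ((1 - e) * f x))" by simp
        also have "\<dots> \<le> (1 - e) * (s * f y)" using fy s one_e by (intro mult_left_mono) auto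
        also have "\<dots> \<le> exp (- a) * (s * f y)"
          using exp_ge_add_one_self[of "-a"] a s f_nonneg[of y] by (intro mult_right_mono) auto
        also have "\<dots> = a * exp (- a) * measure (jump_tail_law \<nu> (h x)) {y<..y + d}" using Jy by (simp add: mult_ac)
        finally have "ennreal ((1 - e) * ((1 - e) * (s * f x))) \<le>
            ennreal (a * exp (- a)) * emeasure (jump_tail_law \<nu> (h x)) {y<..y + d}"
          using a by (simp add: J.emeasure_eq_measure ennreal_mult[symmetric] ennreal_leI)
        also have "\<dots> = ennreal (a * exp (- a)) * (\<integral>\<^sup>+w. indicator {y<..y + d} w \<partial>jump_tail_law \<nu> (h x))" by simp
        also have "\<dots> \<le> (\<integral>\<^sup>+w. indicator {y<..y + d} w \<partial>jumps x s)"
          unfolding jumps_def a_def[symmetric]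
          by (rule compound_poisson_lower_bound[OF a(1) J(1)]) simp
        also have "\<dots> = emeasure (jumps x s) {y<..y + d}" by simp
        finally show ?thesis using True by (simp add: y_def)
      qed simp
    qed
    finally have "ennreal ((1 - e) * ((1 - e) * (s * f x))) * ennreal (measure Z (UNIV - {z. K * b x \<le> \<bar>z\<bar>})) \<le> emeasure (\<mu> s) B"
      by (simp add: Z.emeasure_eq_measure)
    then have "ennreal ((1 - e) * ((1 - e) * (s * f x)) * measure Z (UNIV - {z. K * b x \<le> \<bar>z\<bar>})) \<le> emeasure (\<mu> s) B"
      using one_e fx0 by (simp add: ennreal_mult[symmetric])
    moreover have "(1 - 8 * e) * (s * f x) \<le> (1 - e) * ((1 - e) * (s * f x)) * measure Z (UNIV - {z. K * b x \<le> \<bar>z\<bar>})"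
    proof -
      have "1 - 8 * e \<le> (1 - e) * ((1 - e) * (1 - e))"
      proof -
        have "e * e * e \<le> e * e * 1" using e by (intro mult_left_mono) auto
        then have "e * e * e \<le> e * e" by simp
        moreover have "0 \<le> e * e" by simp
        moreover have "(1 - e) * ((1 - e) * (1 - e)) = 1 - 3 * e + 3 * (e * e) - e * e * e" by (simp add: algebra_simps)
        ultimately show ?thesis using e by linarith
      qed
      then have "(1 - 8 * e) * (s * f x) \<le> (1 - e) * ((1 - e) * (1 - e)) * (s * f x)" by (rule mult_right_mono[OF _ fx0])
      also have "\<dots> = (1 - e) * ((1 - e) * (s * f x)) * (1 - e)" by (simp add: mult_ac)
      also have "\<dots> \<le> (1 - e) * ((1 - e) * (s * f x)) * measure Z (UNIV - {z. K * b x \<le> \<bar>z\<bar>})"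
        using PK one_e fx0 by (intro mult_left_mono) auto
      finally show ?thesis .
    qed
    ultimately show ?thesis by (meson ennreal_leI order_trans)
  qed
  have "measure (\<mu> s) B \<le> (1 + 8 * e) * (s * f x)"
    using upper e fx0 by (simp add: D.emeasure_eq_measure)
  \<comment> \<open>For e > 1 / 8 the bound is negative and trivial, whereas \<open>ennreal\<close>
    truncates it to 0; hence the case distinction.\<close>
  moreover have "(1 - 8 * e) * (s * f x) \<le> measure (\<mu> s) B"
    using lower by (cases "0 \<le> (1 - 8 * e) * (s * f x)") (auto simp: D.emeasure_eq_measure intro: order_trans)
  ultimately show ?thesis unfolding B_def by (simp add: abs_le_iff algebra_simps)
qed

theorem local_asymptotics:
  assumes \<theta>: "0 < \<theta>" and \<epsilon>: "0 < \<epsilon>"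
  shows "\<forall>\<^sub>F x in at_top. \<forall>s. 0 < s \<longrightarrow> s \<le> x / \<theta> \<longrightarrow>
    \<bar>measure (\<mu> s) {x<..x + d} - s * f x\<bar> \<le> \<epsilon> * (s * f x)"
proof -
  define e where "e = min (1 / 2) (\<epsilon> / 8)"
  have e: "0 < e" "e \<le> 1 / 2" "8 * e \<le> \<epsilon>"
    unfolding e_def using \<epsilon> min.cobounded1[of "1 / 2" "\<epsilon> / 8"] min.cobounded2[of "1 / 2" "\<epsilon> / 8"]
    by (simp, blast, linarith)
  obtain C R where C: "1 \<le> C" "1 \<le> R" and fpos: "\<And>x. R \<le> x \<Longrightarrow> 0 < f x"
    and fup: "\<And>x y. R \<le> x \<Longrightarrow> x \<le> y \<Longrightarrow> f y \<le> C * f x"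
    using f_upper by blast
  obtain C5 where C5: "\<forall>\<^sub>F x in at_top. \<forall>s. 0 < s \<longrightarrow> s \<le> x / \<theta> \<longrightarrow>
    s * exp 2 * trunc_var \<sigma> \<nu> (1 / (2 / b x)) \<le> C5"
    using scale_rate[OF \<theta>] by blast
  define E where "E = exp C5"
  have E: "0 < E" by (simp add: E_def)
  \<comment> \<open>\<open>E\<close> comes from the rate at the scale \<open>b x\<close> alone and
    does not depend on \<open>K\<close>, so \<open>K\<close> may be chosen after it.\<close>
  define K where "K = 2 + (2 * C + 2 * exp 1) * E / e"
  have K: "2 \<le> K" "(2 * C + 2 * exp 1) * E \<le> e * (K - 1)"
  proof -
    have "0 \<le> (2 * C + 2 * exp 1) * E / e" using C E e by simp
    then show "2 \<le> K" by (simp add: K_def)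
    have "e * (K - 1) = e + (2 * C + 2 * exp 1) * E" using e by (simp add: K_def distrib_left)
    then show "(2 * C + 2 * exp 1) * E \<le> e * (K - 1)" using e by simp
  qed
  have "\<forall>\<^sub>F x in at_top. f x < min 1 (e / 2)" using e by (intro order_tendstoD(2)[OF f_tendsto]) auto
  then have fe: "\<forall>\<^sub>F x in at_top. f x \<le> e / 2" by (auto elim: eventually_mono)
  obtain R1 where R1: "\<And>x. R1 \<le> x \<Longrightarrow> f x \<le> 1"
    using order_tendstoD(2)[OF f_tendsto, of 1] by (auto simp: eventually_at_top_linorder intro: less_imp_le)
  have hR: "\<forall>\<^sub>F x in at_top. max 1 (R1 + d) \<le> h x" using h_at_top by (simp only: filterlim_at_top)
  have q1: "\<forall>\<^sub>F x in at_top. 1 \<le> q x" using q_at_top by (simp only: filterlim_at_top)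
  have K1: "0 \<le> K + 1" and e1: "e < 1" using K e by simp_all
  have "\<forall>\<^sub>F x in at_top. b x / x < 1 / (2 * (K + 1))" using K by (intro order_tendstoD(2)[OF b_sublinear]) auto
  then show ?thesis
    using large_jumps_negligible[OF \<theta> e(1)] jumps_local_bound[OF \<theta> e(1) e1] chernoff_rate[OF \<theta>] C5
      insens_factor[OF K1 e(1)] f_exp_growth fe hR q1 eventually_ge_at_top[of R]
  proof eventually_elim
    case (elim x)
    have x: "0 < x" "0 < f x" using elim(11) C fpos[of x] by auto
    show ?case
    proof (intro allI impI)
      fix s assume s: "0 < s" "s \<le> x / \<theta>"
      have "\<bar>measure (\<mu> s) {x<..x + d} - s * f x\<bar> \<le> 8 * e * (s * f x)"
      proof (rule local_bounds[OF e(1,2) x elim(8) elim(10) s(1) C(1) K E])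
        show "0 < h x" using elim(9) by simp
        show "(K + 1) * b x \<le> x / 2" using elim(1) x K by (simp add: field_simps)
        show "exp (s * exp 2 * trunc_var \<sigma> \<nu> (1 / (2 / b x))) \<le> E"
          unfolding E_def using elim(5) s by simp
        show "f y \<le> 1" if "h x - d \<le> y" for y using elim(9) that by (intro R1) auto
        show "f y \<le> C * f x" if "x \<le> y" for y using elim(11) that by (intro fup) auto
      qed (use elim s e in auto)
      also have "\<dots> \<le> \<epsilon> * (s * f x)" using e s x by (intro mult_right_mono) auto
      finally show "\<bar>measure (\<mu> s) {x<..x + d} - s * f x\<bar> \<le> \<epsilon> * (s * f x)" .
    qed
  qed
qed

end


section \<open>From the standing condition to the analytic hypotheses\<close>

lemma Limsup_zero_imp_tendsto:
  fixes g :: "real \<Rightarrow> real"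
  assumes L: "Limsup at_top (\<lambda>x. ereal (g x)) = 0" and g: "\<forall>\<^sub>F x in at_top. 0 \<le> g x"
  shows "(g \<longlongrightarrow> 0) at_top"
proof (rule order_tendstoI)
  fix a :: real assume "a < 0"
  then show "\<forall>\<^sub>F x in at_top. a < g x" using g by (auto elim: eventually_mono)
next
  fix a :: real assume "0 < a"
  then have "Limsup at_top (\<lambda>x. ereal (g x)) < ereal a" using L by simp
  from Limsup_lessD[OF this] show "\<forall>\<^sub>F x in at_top. g x < a" by simp
qed

lemma O_regularly_varying_half:
  assumes OR: "b \<in> O_regularly_varying"
  shows "\<exists>C>0. \<forall>\<^sub>F x in at_top. b x \<le> C * b (x / 2)"
proof -
  have "Limsup at_top (\<lambda>x. ereal (b (2 * x) / b x)) < \<infinity>"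
    using OR unfolding O_regularly_varying_def mem_Collect_eq by (metis one_le_numeral)
  then obtain c where c: "Limsup at_top (\<lambda>x. ereal (b (2 * x) / b x)) < ereal c"
    using ereal_dense2 by blast
  from Limsup_lessD[OF c] have "\<forall>\<^sub>F x in at_top. b (2 * x) / b x < c" by simp
  moreover have "\<forall>\<^sub>F x in at_top. 0 < b x" using OR by (simp add: O_regularly_varying_def)
  ultimately have "\<forall>\<^sub>F x in at_top. b (2 * x) \<le> max 1 c * b x"
  proof eventually_elim
    case (elim x)
    then have "b (2 * x) \<le> c * b x" by (simp add: field_simps)
    also have "\<dots> \<le> max 1 c * b x" using elim by (intro mult_right_mono) auto
    finally show ?case .
  qed
  moreover have "filterlim (\<lambda>x::real. x / 2) at_top at_top"
    using filterlim_tendsto_pos_mult_at_top[OF tendsto_const[of "1 / 2 :: real"] _ filterlim_ident] by simp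
  ultimately have "\<forall>\<^sub>F x in at_top. b (2 * (x / 2)) \<le> max 1 c * b (x / 2)"
    by (rule eventually_compose_filterlim)
  then show ?thesis by (intro exI[of _ "max 1 c"]) auto
qed

lemma local_big_jump_of_standing_condition:
  fixes X :: "real \<Rightarrow> 'a \<Rightarrow> real"
  assumes L: "levy_process M X" and Z: "zero_mean M X" and T: "has_levy_triplet M X \<gamma> \<sigma> \<nu>"
    and int: "integrable \<nu> (\<lambda>y. min \<bar>y\<bar> (\<bar>y\<bar>\<^sup>2))" and \<alpha>: "1 < \<alpha>" "\<alpha> \<le> 2"
    and S: "standing_condition M X \<nu> \<alpha> b" and d: "0 < d"
  shows "local_big_jump \<nu> \<sigma> \<alpha> d b (\<lambda>s. distr M borel (X s)) (\<lambda>x. measure \<nu> {x<..x + d})"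
proof -
  interpret levy_process M X by fact
  have X[measurable]: "0 \<le> t \<Longrightarrow> X t \<in> borel_measurable M" for t by (rule rv)
  have fl: "fluctuation_scale M X \<alpha> b" and lh: "local_heavy_tail \<nu> \<alpha> b" and om: "one_sided_moment M X \<alpha>"
    using S by (auto simp: standing_condition_def)
  have int': "integrable \<nu> (\<lambda>y. min \<bar>y\<bar> (y\<^sup>2))" using int by simp
  have b_pos: "0 < b t" if "0 \<le> t" for t using fl that by (simp add: fluctuation_scale_def)
  have lhd: "(\<lambda>x. measure \<nu> {x<..x + d}) \<in> almost_decreasing"
    "(\<lambda>x. x powr \<alpha> * measure \<nu> {x<..x + d}) \<in> subexponential \<union> O_regularly_varying"
    "\<And>K. 0 \<le> K \<Longrightarrow> Limsup at_top (\<lambda>x. SUP y\<in>{y. \<bar>y\<bar> \<le> K * b x}.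
        ereal \<bar>measure \<nu> {x - y<..x - y + d} / measure \<nu> {x<..x + d} - 1\<bar>) = 0"
    using lh d unfolding local_heavy_tail_def shifted_Delta_ereal by auto
  show ?thesis
  proof (rule local_big_jump.intro)
    show "sets \<nu> = sets borel" using T by (simp add: has_levy_triplet_def levy_measure_def)
    show "integrable \<nu> (\<lambda>y. min \<bar>y\<bar> (y\<^sup>2))" by (rule int')
    show "1 < \<alpha>" "\<alpha> \<le> 2" "0 < d" by fact+
    show "real_distribution (distr M borel (X s))" if "0 < s" for s
      using that by (intro real_distribution_distr X) simp
    show "char (distr M borel (X s)) u = exp (of_real s * levy_exponent \<sigma> \<nu> u)" if "0 < s" for s u
      using that by (intro zero_mean_char[OF L Z T int']) simp
    show "integrable (distr M borel (X 1)) (\<lambda>x. max x 0 powr \<alpha>)"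
      using om X[of 1] unfolding one_sided_moment_def by (subst integrable_distr_eq) auto
    show "0 < b t" if "0 \<le> t" for t by (rule b_pos[OF that])
    show "\<exists>t0. mono_on {t0..} b" using fl by (simp add: fluctuation_scale_def)
    show "\<exists>C>0. \<forall>\<^sub>F x in at_top. b x \<le> C * b (x / 2)"
      using fl by (intro O_regularly_varying_half) (simp add: fluctuation_scale_def)
    show "\<exists>c>0. \<forall>\<^sub>F x in at_top. c * x powr (1 / \<alpha>) \<le> b x"
    proof -
      have "0 < Liminf at_top (\<lambda>t. ereal (b t / t powr (1 / \<alpha>)))" using fl by (simp add: fluctuation_scale_def)
      then obtain c where c: "0 < ereal c" "ereal c < Liminf at_top (\<lambda>t. ereal (b t / t powr (1 / \<alpha>)))"
        using ereal_dense2 by blast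
      have "\<forall>\<^sub>F t in at_top. c < b t / t powr (1 / \<alpha>)" using less_LiminfD[OF c(2)] by simp
      then have "\<forall>\<^sub>F x in at_top. c * x powr (1 / \<alpha>) \<le> b x"
        using eventually_gt_at_top[of "0::real"]
        by eventually_elim (simp add: pos_less_divide_eq less_imp_le)
      with c(1) show ?thesis by auto
    qed
    show "((\<lambda>t. b t / t) \<longlongrightarrow> 0) at_top"
    proof (rule Limsup_zero_imp_tendsto)
      show "Limsup at_top (\<lambda>t. ereal (b t / t)) = 0" using fl by (simp add: fluctuation_scale_def)
      show "\<forall>\<^sub>F x in at_top. 0 \<le> b x / x"
        using eventually_gt_at_top[of "0::real"] by eventually_elim (simp add: b_pos less_imp_le)
    qed
    show "\<exists>K>0. \<forall>\<^sub>F t in at_top. measure (distr M borel (X t)) {x. K * b t \<le> \<bar>x\<bar>} \<le> \<epsilon>" if \<epsilon>: "0 < \<epsilon>" for \<epsilon>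
    proof -
      have "Limsup at_top (\<lambda>K::real. Limsup at_top
         (\<lambda>t. ereal (measure M {\<omega> \<in> space M. K * b t \<le> \<bar>X t \<omega>\<bar>}))) < ereal \<epsilon>"
        using fl \<epsilon> by (simp add: fluctuation_scale_def)
      from Limsup_lessD[OF this] eventually_gt_at_top[of "0::real"]
      have "\<forall>\<^sub>F K in at_top. Limsup at_top (\<lambda>t. ereal (measure M {\<omega> \<in> space M. K * b t \<le> \<bar>X t \<omega>\<bar>})) < ereal \<epsilon> \<and> 0 < K"
        by (rule eventually_conj)
      then obtain K where K: "Limsup at_top (\<lambda>t. ereal (measure M {\<omega> \<in> space M. K * b t \<le> \<bar>X t \<omega>\<bar>})) < ereal \<epsilon>" "0 < K"
        by (auto simp: eventually_at_top_linorder)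
      have "\<forall>\<^sub>F t in at_top. measure (distr M borel (X t)) {x. K * b t \<le> \<bar>x\<bar>} \<le> \<epsilon>"
        using Limsup_lessD[OF K(1)] eventually_ge_at_top[of "0::real"]
      proof eventually_elim
        case (elim t)
        then show ?case
          by (subst measure_distr) (auto simp: vimage_def Int_def conj_commute)
      qed
      with K(2) show ?thesis by blast
    qed
    show "\<exists>c>0. \<exists>x0>0. \<forall>x y. x0 \<le> x \<longrightarrow> x \<le> y \<longrightarrow> c * measure \<nu> {y<..y + d} \<le> measure \<nu> {x<..x + d}"
      using lhd(1) by (simp add: almost_decreasing_def)
    show "(\<lambda>x. x powr \<alpha> * measure \<nu> {x<..x + d}) \<in> subexponential \<union> O_regularly_varying" by (rule lhd)
    show "\<forall>\<^sub>F x in at_top. \<forall>y. \<bar>y\<bar> \<le> K * b x \<longrightarrow>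
        \<bar>measure \<nu> {x - y<..x - y + d} / measure \<nu> {x<..x + d} - 1\<bar> \<le> \<epsilon>" if K: "0 \<le> K" and \<epsilon>: "0 < \<epsilon>" for K \<epsilon>
    proof -
      have "Limsup at_top (\<lambda>x. SUP y\<in>{y. \<bar>y\<bar> \<le> K * b x}.
        ereal \<bar>measure \<nu> {x - y<..x - y + d} / measure \<nu> {x<..x + d} - 1\<bar>) < ereal \<epsilon>"
        using lhd(3)[OF K] \<epsilon> by simp
      from Limsup_lessD[OF this] show ?thesis
      proof eventually_elim
        case (elim x)
        show ?case
        proof (intro allI impI)
          fix y assume y: "\<bar>y\<bar> \<le> K * b x"
          have "ereal \<bar>measure \<nu> {x - y<..x - y + d} / measure \<nu> {x<..x + d} - 1\<bar> \<le>
            (SUP y\<in>{y. \<bar>y\<bar> \<le> K * b x}. ereal \<bar>measure \<nu> {x - y<..x - y + d} / measure \<nu> {x<..x + d} - 1\<bar>)"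
            using y by (intro SUP_upper) simp
          with elim have "ereal \<bar>measure \<nu> {x - y<..x - y + d} / measure \<nu> {x<..x + d} - 1\<bar> < ereal \<epsilon>" by (rule le_less_trans[rotated])
          then show "\<bar>measure \<nu> {x - y<..x - y + d} / measure \<nu> {x<..x + d} - 1\<bar> \<le> \<epsilon>" by simp
        qed
      qed
    qed
  qed simp
qed

lemma measure_Ioc_blocks:
  fixes N :: "real measure"
  assumes sets: "sets N = sets borel" and fin: "emeasure N {x<..} < \<infinity>" and d: "0 < d"
  shows "measure N {x<..x + real k * d} = (\<Sum>j<k. measure N {x + real j * d<..x + real j * d + d})"
proof (induction k)
  case (Suc k)
  have kd: "0 \<le> real k * d" using d by simp
  have f: "emeasure N B \<noteq> \<infinity>" if "B \<subseteq> {x<..}" "B \<in> sets borel" for B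
  proof -
    have "emeasure N B \<le> emeasure N {x<..}" using that by (intro emeasure_mono) (auto simp: sets)
    then show ?thesis using fin by auto
  qed
  define w where "w = x + real k * d"
  have w: "x \<le> w" using kd by (simp add: w_def)
  have end_k: "x + real (Suc k) * d = w + d" by (simp add: w_def distrib_right)
  have "{x<..x + real (Suc k) * d} = {x<..w} \<union> {w<..w + d}"
    unfolding end_k using w d by auto
  moreover have "measure N ({x<..w} \<union> {w<..w + d}) = measure N {x<..w} + measure N {w<..w + d}"
    using w by (intro measure_Union f) (auto simp: sets)
  ultimately show ?case using Suc.IH by (simp add: w_def)
qed simp

section \<open>Shifted windows and long intervals\<close>

context local_big_jump
begin

text \<open>The unshifted estimate is applied at \<open>x - y \<ge> x / 2\<close>, with \<theta> / 2
  so that the same times remain admissible, and insensitivity replaces \<open>f (x - y)\<close> by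
  \<open>f x\<close>. The errors e (1 + e) and e add up to at most 3 e.\<close>

lemma local_asymptotics_shifted:
  assumes \<theta>: "0 < \<theta>" and \<epsilon>: "0 < \<epsilon>" and K: "0 \<le> K"
  shows "\<forall>\<^sub>F x in at_top. \<forall>y s. \<bar>y\<bar> \<le> K * b x \<longrightarrow> 0 < s \<longrightarrow> s \<le> x / \<theta> \<longrightarrow>
    \<bar>measure (\<mu> s) {x - y<..x - y + d} - s * f x\<bar> \<le> \<epsilon> * (s * f x)"
proof -
  define e where "e = min 1 (\<epsilon> / 3)"
  have e: "0 < e" "e \<le> 1" "3 * e \<le> \<epsilon>" using \<epsilon> by (auto simp: e_def)
  have \<theta>2: "0 < \<theta> / 2" using \<theta> by simp
  obtain X where X: "\<And>x s. X \<le> x \<Longrightarrow> 0 < s \<Longrightarrow> s \<le> x / (\<theta> / 2) \<Longrightarrow>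
      \<bar>measure (\<mu> s) {x<..x + d} - s * f x\<bar> \<le> e * (s * f x)"
    using local_asymptotics[OF \<theta>2 e(1)] unfolding eventually_at_top_linorder by blast
  have "\<forall>\<^sub>F x in at_top. b x / x < 1 / (2 * (K + 1))" using K by (intro order_tendstoD(2)[OF b_sublinear]) auto
  then show ?thesis
    using insens_factor[OF K e(1)] eventually_ge_at_top[of "max 1 (2 * X)"]
  proof eventually_elim
    case (elim x)
    then have x: "0 < x" "2 * X \<le> x" by auto
    have "(K + 1) * b x \<le> x / 2" using elim(1) x K by (simp add: field_simps)
    then have Kb: "K * b x \<le> x / 2" using b_pos[of x] x by (simp add: distrib_right)
    show ?case
    proof (intro allI impI)
      fix y s assume y: "\<bar>y\<bar> \<le> K * b x" and s: "0 < s" "s \<le> x / \<theta>"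
      define x' where "x' = x - y"
      have x': "x / 2 \<le> x'" using y Kb by (simp add: x'_def abs_le_iff)
      have "x / \<theta> \<le> x' / (\<theta> / 2)" using x' \<theta> by (simp add: field_simps)
      then have 1: "\<bar>measure (\<mu> s) {x'<..x' + d} - s * f x'\<bar> \<le> e * (s * f x')"
        using x' x s by (intro X) auto
      have fx': "(1 - e) * f x \<le> f x'" "f x' \<le> (1 + e) * f x" using elim(2) y by (auto simp: x'_def)
      have "s * f x' \<le> s * ((1 + e) * f x)" "s * ((1 - e) * f x) \<le> s * f x'" using fx' s by (auto intro!: mult_left_mono)
      then have 2: "s * f x' \<le> s * f x + e * (s * f x)" "s * f x - e * (s * f x) \<le> s * f x'" by (simp_all add: algebra_simps)
      have "e * (s * f x') \<le> e * (s * f x + e * (s * f x))" using 2 e by (intro mult_left_mono) auto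
      also have "\<dots> \<le> e * (s * f x + 1 * (s * f x))"
        using e s f_nonneg[of x] by (intro mult_left_mono add_left_mono mult_right_mono) auto
      finally have 3: "e * (s * f x') \<le> 2 * (e * (s * f x))" by simp
      have "3 * e * (s * f x) \<le> \<epsilon> * (s * f x)" using e s f_nonneg[of x] by (intro mult_right_mono) auto
      then show "\<bar>measure (\<mu> s) {x - y<..x - y + d} - s * f x\<bar> \<le> \<epsilon> * (s * f x)"
        using 1 2 3 unfolding x'_def by linarith
    qed
  qed
qed

text \<open>An interval of length at least \<open>m * d\<close> consists of at least \<open>m\<close> blocks of length \<open>d\<close>, up to one
  incomplete block, and the mass of a single block is at most a fraction \<open>2 / m\<close> of the total.\<close>

lemma block_asymptotics:
  assumes \<theta>: "0 < \<theta>" and \<epsilon>: "0 < \<epsilon>" "\<epsilon> \<le> 1" and K: "0 \<le> K" and m: "4 \<le> \<epsilon> * real m"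
  shows "\<forall>\<^sub>F x in at_top. 0 < f x \<and> (\<forall>y s r. \<bar>y\<bar> \<le> K * b x \<longrightarrow> 0 < s \<longrightarrow> s \<le> x / \<theta> \<longrightarrow> real m * d \<le> r \<longrightarrow>
    \<bar>measure (\<mu> s) {x - y<..x - y + r} - s * measure \<nu> {x<..x + r}\<bar> \<le> 3 * \<epsilon> * (s * measure \<nu> {x<..x + r}))"
proof -
  have m0: "0 < real m" using m \<epsilon> by (smt (verit) mult_nonneg_nonpos)
  obtain X1 where X1: "\<And>x y s. X1 \<le> x \<Longrightarrow> \<bar>y\<bar> \<le> K * b x \<Longrightarrow> 0 < s \<Longrightarrow> s \<le> x / \<theta> \<Longrightarrow>
    \<bar>measure (\<mu> s) {x - y<..x - y + d} - s * f x\<bar> \<le> \<epsilon> * (s * f x)"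
    using local_asymptotics_shifted[OF \<theta> \<epsilon>(1) K] unfolding eventually_at_top_linorder by blast
  have md: "0 \<le> real m * d" using d by simp
  obtain X2 where X2: "\<And>x y. X2 \<le> x \<Longrightarrow> \<bar>y\<bar> \<le> real m * d \<Longrightarrow> f (x - y) \<le> 2 * f x"
    using insens_bounded[OF md, of 1] unfolding eventually_at_top_linorder
    by (metis one_add_one zero_less_one)
  obtain t0 where t0: "mono_on {t0..} b" using b_mono by auto
  show ?thesis
    using f_eventually_pos eventually_ge_at_top[of "max (max 1 t0) (max X1 X2)"]
  proof (eventually_elim, intro conjI allI impI)
    fix x y s r assume fx: "0 < f x" and x: "max (max 1 t0) (max X1 X2) \<le> x" and y: "\<bar>y\<bar> \<le> K * b x"
      and s: "0 < s" "s \<le> x / \<theta>" and r: "real m * d \<le> r"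
    interpret D: real_distribution "\<mu> s" by (rule \<mu>[OF s(1)])
    define k where "k = nat \<lfloor>r / d\<rfloor>"
    have rd: "real m \<le> r / d" using r d by (simp add: field_simps)
    then have mk: "m \<le> k" unfolding k_def by linarith
    have "real k \<le> r / d" "r / d < real k + 1" using rd m0 unfolding k_def by linarith+
    then have k: "real k * d \<le> r" "r \<le> real (Suc k) * d" using d by (auto simp: field_simps)
    define P where "P j = measure (\<mu> s) {x - y + real j * d<..x - y + real j * d + d}" for j
    define F where "F j = f (x + real j * d)" for j
    have F0: "0 \<le> F j" for j by (simp add: F_def f_nonneg)
    have PF: "\<bar>P j - s * F j\<bar> \<le> \<epsilon> * (s * F j)" for j
    proof -
      have jd: "0 \<le> real j * d" using d by simp
      \<comment> \<open>Monotonicity of \<open>b\<close> keeps the shift \<open>y\<close> admissible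
        for all later blocks, and the admissible time range grows with the position of the
        block.\<close>
      have "b x \<le> b (x + real j * d)" using x jd by (intro mono_onD[OF t0]) auto
      then have "\<bar>y\<bar> \<le> K * b (x + real j * d)" using y K by (meson mult_left_mono order_trans)
      moreover have "x / \<theta> \<le> (x + real j * d) / \<theta>" using jd \<theta> by (intro divide_right_mono) auto
      ultimately have "\<bar>measure (\<mu> s) {x + real j * d - y<..x + real j * d - y + d} - s * f (x + real j * d)\<bar> \<le> \<epsilon> * (s * f (x + real j * d))"
        using x jd s by (intro X1) auto
      then show ?thesis by (simp add: P_def F_def algebra_simps)
    qed
    have muB: "measure (\<mu> s) {x - y<..x - y + real n * d} = (\<Sum>j<n. P j)" for n
      unfolding P_def by (rule measure_Ioc_blocks) (use d in \<open>auto simp: D.emeasure_eq_measure\<close>)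
    have nuB: "measure \<nu> {x<..x + real n * d} = (\<Sum>j<n. F j)" for n
      unfolding F_def f_def by (rule measure_Ioc_blocks) (use d tail_finite[of x] x in auto)
    have sums: "(\<Sum>j<n. P j) \<le> (1 + \<epsilon>) * (s * (\<Sum>j<n. F j))" "(1 - \<epsilon>) * (s * (\<Sum>j<n. F j)) \<le> (\<Sum>j<n. P j)" for n
    proof -
      have "P j \<le> (1 + \<epsilon>) * (s * F j)" "(1 - \<epsilon>) * (s * F j) \<le> P j" for j
        using PF[of j] by (auto simp: abs_le_iff algebra_simps)
      then show "(\<Sum>j<n. P j) \<le> (1 + \<epsilon>) * (s * (\<Sum>j<n. F j))" "(1 - \<epsilon>) * (s * (\<Sum>j<n. F j)) \<le> (\<Sum>j<n. P j)"
        unfolding sum_distrib_left by (auto intro!: sum_mono)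
    qed
    define \<Sigma> where "\<Sigma> = (\<Sum>j<k. F j)"
    have \<Sigma>0: "0 \<le> \<Sigma>" unfolding \<Sigma>_def by (intro sum_nonneg F0)
    have last: "F k \<le> \<epsilon> / 2 * \<Sigma>"
    proof -
      \<comment> \<open>Each of the \<open>m\<close> blocks before the incomplete one weighs at
        least half of block \<open>k\<close>, as all lie within the fixed distance
        \<open>m * d\<close> of it.\<close>
      have "real m * F k = (\<Sum>j\<in>{k - m..<k}. F k)" using mk by simp
      also have "\<dots> \<le> (\<Sum>j\<in>{k - m..<k}. 2 * F j)"
      proof (intro sum_mono)
        fix j assume j: "j \<in> {k - m..<k}"
        then have "k - j \<le> m" "j \<le> k" by auto
        then have "real (k - j) * d \<le> real m * d" using d by (intro mult_right_mono) auto
        then have "(real k - real j) * d \<le> real m * d" using \<open>j \<le> k\<close> by (simp add: of_nat_diff)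
        moreover have "0 \<le> (real k - real j) * d" using \<open>j \<le> k\<close> d by simp
        ultimately have "f (x + real j * d - (- ((real k - real j) * d))) \<le> 2 * f (x + real j * d)"
          using x d by (intro X2) (auto simp: add_increasing2)
        then show "F k \<le> 2 * F j" by (simp add: F_def algebra_simps)
      qed
      also have "\<dots> = 2 * (\<Sum>j\<in>{k - m..<k}. F j)" by (simp add: sum_distrib_left)
      also have "\<dots> \<le> 2 * \<Sigma>" unfolding \<Sigma>_def by (intro mult_left_mono sum_mono2) (auto simp: F0)
      finally have "real m * F k \<le> 2 * \<Sigma>" .
      then have "\<epsilon> * (real m * F k) \<le> \<epsilon> * (2 * \<Sigma>)" using \<epsilon> by (intro mult_left_mono) auto
      moreover have "4 * F k \<le> \<epsilon> * real m * F k" using m by (intro mult_right_mono F0)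
      ultimately show ?thesis by (simp add: mult.assoc)
    qed
    define V where "V = measure \<nu> {x<..x + r}"
    have fin: "emeasure \<nu> {x<..x + t} < top" for t
    proof -
      have "emeasure \<nu> {x<..x + t} \<le> emeasure \<nu> {x<..}" by (intro emeasure_mono) auto
      also have "\<dots> < top" using tail_finite[of x] x by simp
      finally show ?thesis .
    qed
    have V: "\<Sigma> \<le> V" "V \<le> \<Sigma> + F k"
    proof -
      have "measure \<nu> {x<..x + real k * d} \<le> V"
        unfolding V_def measure_def using k fin by (intro enn2real_mono emeasure_mono) auto
      then show "\<Sigma> \<le> V" by (simp add: nuB \<Sigma>_def)
      have "V \<le> measure \<nu> {x<..x + real (Suc k) * d}"
        unfolding V_def measure_def using k fin by (intro enn2real_mono emeasure_mono) auto
      also have "\<dots> = \<Sigma> + F k" by (subst nuB) (simp add: \<Sigma>_def)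
      finally show "V \<le> \<Sigma> + F k" .
    qed
    define Q where "Q = measure (\<mu> s) {x - y<..x - y + r}"
    have Q: "(1 - \<epsilon>) * (s * \<Sigma>) \<le> Q" "Q \<le> (1 + \<epsilon>) * (s * (\<Sigma> + F k))"
    proof -
      have "(\<Sum>j<k. P j) \<le> Q" unfolding muB[symmetric] Q_def using k by (intro D.finite_measure_mono) auto
      then show "(1 - \<epsilon>) * (s * \<Sigma>) \<le> Q" using sums(2)[of k] by (simp add: \<Sigma>_def)
      have "Q \<le> (\<Sum>j<Suc k. P j)" unfolding muB[symmetric] Q_def using k by (intro D.finite_measure_mono) auto
      then show "Q \<le> (1 + \<epsilon>) * (s * (\<Sigma> + F k))" using sums(1)[of "Suc k"] by (simp add: \<Sigma>_def)
    qed
    have V0: "0 \<le> V" using V \<Sigma>0 by linarith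
    have FkV: "F k \<le> \<epsilon> / 2 * V"
    proof -
      have "\<epsilon> / 2 * \<Sigma> \<le> \<epsilon> / 2 * V" using V \<epsilon> by (intro mult_left_mono) auto
      with last show ?thesis by linarith
    qed
    have up: "Q \<le> (1 + 3 * \<epsilon>) * (s * V)"
    proof -
      have "\<Sigma> + F k \<le> (1 + \<epsilon> / 2) * V" using V FkV by (simp add: algebra_simps)
      then have "(1 + \<epsilon>) * (s * (\<Sigma> + F k)) \<le> (1 + \<epsilon>) * (s * ((1 + \<epsilon> / 2) * V))"
        using s \<epsilon> by (intro mult_left_mono) auto
      also have "\<dots> = ((1 + \<epsilon>) * (1 + \<epsilon> / 2)) * (s * V)" by simp
      also have "\<dots> \<le> (1 + 3 * \<epsilon>) * (s * V)"
      proof (intro mult_right_mono)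
        have "\<epsilon> * \<epsilon> \<le> \<epsilon> * 1" using \<epsilon> by (intro mult_left_mono) auto
        then show "(1 + \<epsilon>) * (1 + \<epsilon> / 2) \<le> 1 + 3 * \<epsilon>" using \<epsilon> by (simp add: algebra_simps)
      qed (use s V0 in simp)
      finally show ?thesis using Q by linarith
    qed
    have low: "(1 - 3 * \<epsilon>) * (s * V) \<le> Q"
    proof -
      have "(1 - \<epsilon> / 2) * V \<le> \<Sigma>" using V FkV by (simp add: algebra_simps)
      then have "(1 - \<epsilon>) * (s * ((1 - \<epsilon> / 2) * V)) \<le> (1 - \<epsilon>) * (s * \<Sigma>)"
        using s \<epsilon> by (intro mult_left_mono) auto
      moreover have "(1 - 3 * \<epsilon>) * (s * V) \<le> ((1 - \<epsilon>) * (1 - \<epsilon> / 2)) * (s * V)"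
        using \<epsilon> s V0 by (intro mult_right_mono) (auto simp: algebra_simps)
      ultimately show ?thesis using Q by (simp add: mult_ac)
    qed
    show "\<bar>measure (\<mu> s) {x - y<..x - y + r} - s * measure \<nu> {x<..x + r}\<bar> \<le> 3 * \<epsilon> * (s * measure \<nu> {x<..x + r})"
      using up low unfolding Q_def V_def by (simp add: abs_le_iff algebra_simps)
  qed
qed

text \<open>The error is relative and uniform in the length, so the half-line follows from intervals
  of integer length by continuity of both measures. Every mass in a denominator is at least
  \<open>f x\<close>, hence positive.\<close>

lemma uniform_asymptotics:
  assumes \<theta>: "0 < \<theta>" and \<epsilon>: "0 < \<epsilon>" "\<epsilon> \<le> 1" and K: "0 \<le> K" and m: "4 \<le> \<epsilon> * real m"
  shows "\<forall>\<^sub>F x in at_top. \<forall>y s \<delta>. \<bar>y\<bar> \<le> K * b x \<longrightarrow> 0 < s \<longrightarrow> s \<le> x / \<theta> \<longrightarrow> ereal (real m * d) \<le> \<delta> \<longrightarrow>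
    \<bar>measure (\<mu> s) (shifted_Delta (x - y) \<delta>) / (s * measure \<nu> (shifted_Delta x \<delta>)) - 1\<bar> \<le> 3 * \<epsilon>"
  using block_asymptotics[OF assms] eventually_ge_at_top[of 1]
proof (eventually_elim, intro allI impI)
  fix x y s :: real and \<delta> :: ereal
  assume A: "0 < f x \<and> (\<forall>y s r. \<bar>y\<bar> \<le> K * b x \<longrightarrow> 0 < s \<longrightarrow> s \<le> x / \<theta> \<longrightarrow> real m * d \<le> r \<longrightarrow>
    \<bar>measure (\<mu> s) {x - y<..x - y + r} - s * measure \<nu> {x<..x + r}\<bar> \<le> 3 * \<epsilon> * (s * measure \<nu> {x<..x + r}))"
    and x: "1 \<le> x" and y: "\<bar>y\<bar> \<le> K * b x" and s: "0 < s" "s \<le> x / \<theta>" and \<delta>: "ereal (real m * d) \<le> \<delta>"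
  interpret D: real_distribution "\<mu> s" by (rule \<mu>[OF s(1)])
  have m1: "1 \<le> m" using m \<epsilon> by (cases m) auto
  have md: "d \<le> real m * d" using m1 d by simp
  have fin: "emeasure \<nu> {x<..} < top" using tail_finite[of x] x by simp
  have main: "\<bar>measure (\<mu> s) {x - y<..x - y + r} - s * measure \<nu> {x<..x + r}\<bar> \<le> 3 * \<epsilon> * (s * measure \<nu> {x<..x + r})"
    if "real m * d \<le> r" for r using A y s that by blast
  have ratio: "\<bar>p / (s * v) - 1\<bar> \<le> 3 * \<epsilon>" if "\<bar>p - s * v\<bar> \<le> 3 * \<epsilon> * (s * v)" "f x \<le> v" for p v
  proof -
    have "0 < s * v" using that A s by auto
    moreover have "p / (s * v) - 1 = (p - s * v) / (s * v)" using \<open>0 < s * v\<close> by (auto simp: diff_divide_distrib)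
    ultimately show ?thesis using that(1) by (simp only: abs_divide abs_of_pos pos_divide_le_eq)
  qed
  show "\<bar>measure (\<mu> s) (shifted_Delta (x - y) \<delta>) / (s * measure \<nu> (shifted_Delta x \<delta>)) - 1\<bar> \<le> 3 * \<epsilon>"
  proof (cases \<delta>)
    case (real r)
    then have r: "real m * d \<le> r" using \<delta> by simp
    then have dr: "d \<le> r" using md by linarith
    have "emeasure \<nu> {x<..x + r} \<le> emeasure \<nu> {x<..}" by (intro emeasure_mono) auto
    then have "f x \<le> measure \<nu> {x<..x + r}"
      unfolding f_def measure_def using dr fin by (intro enn2real_mono emeasure_mono) auto
    then show ?thesis unfolding real shifted_Delta_ereal by (intro ratio main r)
  next
    case PInf
    have lim_nu: "(\<lambda>n. measure \<nu> {x<..x + real n}) \<longlonglongrightarrow> measure \<nu> {x<..}"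
    proof -
      have "(\<lambda>n. measure \<nu> {x<..x + real n}) \<longlonglongrightarrow> measure \<nu> (\<Union>n. {x<..x + real n})"
      proof (rule Lim_measure_incseq)
        have "emeasure \<nu> (\<Union>n. {x<..x + real n}) \<le> emeasure \<nu> {x<..}" by (intro emeasure_mono) auto
        then show "emeasure \<nu> (\<Union>n. {x<..x + real n}) \<noteq> \<infinity>" using fin by auto
      qed (auto simp: incseq_def)
      moreover have "(\<Union>n. {x<..x + real n}) = {x<..}"
      proof -
        have "\<exists>n. z \<le> x + real n" for z using real_arch_simple[of "z - x"] by (auto simp: algebra_simps)
        then show ?thesis by auto
      qed
      ultimately show ?thesis by simp
    qed
    have lim_mu: "(\<lambda>n. measure (\<mu> s) {x - y<..x - y + real n}) \<longlonglongrightarrow> measure (\<mu> s) {x - y<..}"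
    proof -
      have "(\<lambda>n. measure (\<mu> s) {x - y<..x - y + real n}) \<longlonglongrightarrow> measure (\<mu> s) (\<Union>n. {x - y<..x - y + real n})"
        by (rule D.finite_Lim_measure_incseq) (auto simp: incseq_def)
      moreover have "(\<Union>n. {x - y<..x - y + real n}) = {x - y<..}"
      proof -
        have "\<exists>n. z \<le> x - y + real n" for z using real_arch_simple[of "z - (x - y)"] by (auto simp: algebra_simps)
        then show ?thesis by auto
      qed
      ultimately show ?thesis by simp
    qed
    obtain n0 where n0: "real m * d \<le> real n0" using real_arch_simple by blast
    have "\<bar>measure (\<mu> s) {x - y<..} - s * measure \<nu> {x<..}\<bar> \<le> 3 * \<epsilon> * (s * measure \<nu> {x<..})"
    proof (rule LIMSEQ_le)
      show "(\<lambda>n. \<bar>measure (\<mu> s) {x - y<..x - y + real n} - s * measure \<nu> {x<..x + real n}\<bar>)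
        \<longlonglongrightarrow> \<bar>measure (\<mu> s) {x - y<..} - s * measure \<nu> {x<..}\<bar>"
        by (intro tendsto_intros lim_nu lim_mu)
      show "(\<lambda>n. 3 * \<epsilon> * (s * measure \<nu> {x<..x + real n})) \<longlonglongrightarrow> 3 * \<epsilon> * (s * measure \<nu> {x<..})"
        by (intro tendsto_intros lim_nu)
      show "\<exists>N. \<forall>n\<ge>N. \<bar>measure (\<mu> s) {x - y<..x - y + real n} - s * measure \<nu> {x<..x + real n}\<bar>
        \<le> 3 * \<epsilon> * (s * measure \<nu> {x<..x + real n})"
      proof (intro exI[of _ n0] allI impI main)
        fix n assume "n0 \<le> n"
        then have "real n0 \<le> real n" by simp
        with n0 show "real m * d \<le> real n" by linarith
      qed
    qed
    then show ?thesis unfolding PInf shifted_Delta_infinity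
      using x by (intro ratio f_le_tail) auto
  qed (use \<delta> in auto)
qed

end

theorem theorem1p2:
  fixes M :: "'a measure" and X :: "real \<Rightarrow> 'a \<Rightarrow> real" and \<nu> :: "real measure"
    and \<gamma> \<sigma> \<alpha> \<theta> \<delta>0 K :: real and b :: "real \<Rightarrow> real"
  assumes "levy_process M X"
    and "zero_mean M X"
    and "has_levy_triplet M X \<gamma> \<sigma> \<nu>"
    and "integrable \<nu> (\<lambda>y. min \<bar>y\<bar> (\<bar>y\<bar>\<^sup>2))"
    and "1 < \<alpha>" and "\<alpha> \<le> 2"
    and "standing_condition M X \<nu> \<alpha> b"
    and "0 < \<theta>" and "0 < \<delta>0" and "0 \<le> K"
  shows "((\<lambda>t::real. SUP x\<in>{\<theta> * t..}. SUP y\<in>{y. \<bar>y\<bar> \<le> K * b x}.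
            SUP \<delta>\<in>{ereal \<delta>0..\<infinity>}. SUP s\<in>{0<..t}.
              ereal \<bar>measure M {\<omega> \<in> space M. X s \<omega> \<in> shifted_Delta (x - y) \<delta>}
                     / (s * measure \<nu> (shifted_Delta x \<delta>)) - 1\<bar>)
          \<longlongrightarrow> 0) at_top"
proof -
  interpret levy_process M X by fact
  define \<mu> where "\<mu> s = distr M borel (X s)" for s
  define F where "F t = (SUP x\<in>{\<theta> * t..}. SUP y\<in>{y. \<bar>y\<bar> \<le> K * b x}.
            SUP \<delta>\<in>{ereal \<delta>0..\<infinity>}. SUP s\<in>{0<..t}.
              ereal \<bar>measure M {\<omega> \<in> space M. X s \<omega> \<in> shifted_Delta (x - y) \<delta>}
                     / (s * measure \<nu> (shifted_Delta x \<delta>)) - 1\<bar>)" for t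
  have b_pos: "0 < b t" if "0 \<le> t" for t
    using assms(7) that by (simp add: standing_condition_def fluctuation_scale_def)
  \<comment> \<open>In \<open>ereal\<close> the supremum over an empty set is -\<infinity>; the
    witnesses \<open>x = \<theta> * t\<close>, \<open>y = 0\<close>,
    \<open>\<delta> = \<infinity>\<close> and \<open>s = t\<close> show that no index set is
    empty.\<close>
  have F_nonneg: "0 \<le> F t" if t: "0 < t" for t
  proof -
    have "0 \<le> K * b (\<theta> * t)" using b_pos[of "\<theta> * t"] t assms by simp
    then show ?thesis
      unfolding F_def using t
      by (intro SUP_upper2[of "\<theta> * t"] SUP_upper2[of 0] SUP_upper2[of \<infinity>] SUP_upper2[of t]) auto
  qed
  have shift_borel: "shifted_Delta x \<delta> \<in> sets borel" if "ereal \<delta>0 \<le> \<delta>" for x \<delta>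
    using that by (cases \<delta>) (auto simp: shifted_Delta_ereal shifted_Delta_infinity)
  have F_le: "\<forall>\<^sub>F t in at_top. F t \<le> ereal (3 * \<epsilon>)" if \<epsilon>: "0 < \<epsilon>" "\<epsilon> \<le> 1" for \<epsilon>
  proof -
    \<comment> \<open>The number of blocks is dictated by \<epsilon>, so the block length
      \<open>\<delta>0 / real m\<close> varies with \<epsilon>, and the locale is interpreted anew
      for each; the local condition is needed for arbitrarily short windows.\<close>
    obtain m :: nat where m: "4 / \<epsilon> \<le> real m" using real_arch_simple by blast
    then have m4: "4 \<le> \<epsilon> * real m" using \<epsilon> by (simp add: field_simps)
    have m0: "0 < real m" using m \<epsilon> by (smt (verit) divide_pos_pos)
    define d where "d = \<delta>0 / real m"
    have d: "0 < d" "real m * d = \<delta>0" using m0 assms by (auto simp: d_def)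
    interpret B: local_big_jump \<nu> \<sigma> \<alpha> d b \<mu> "\<lambda>x. measure \<nu> {x<..x + d}"
      unfolding \<mu>_def[abs_def]
      by (rule local_big_jump_of_standing_condition[OF assms(1-7) d(1)])
    obtain x0 where x0: "\<And>x y s \<delta>. x0 \<le> x \<Longrightarrow> \<bar>y\<bar> \<le> K * b x \<Longrightarrow> 0 < s \<Longrightarrow> s \<le> x / \<theta> \<Longrightarrow> ereal \<delta>0 \<le> \<delta> \<Longrightarrow>
      \<bar>measure (\<mu> s) (shifted_Delta (x - y) \<delta>) / (s * measure \<nu> (shifted_Delta x \<delta>)) - 1\<bar> \<le> 3 * \<epsilon>"
      using B.uniform_asymptotics[OF assms(8) \<epsilon> assms(10) m4] unfolding d(2) eventually_at_top_linorder by blast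
    show ?thesis
      \<comment> \<open>For such \<open>t\<close>, every \<open>x \<ge> \<theta> * t\<close> is at
        least \<open>x0\<close>, and every \<open>s \<le> t\<close> is at most
        \<open>x / \<theta>\<close>.\<close>
      using eventually_ge_at_top[of "x0 / \<theta>"]
    proof eventually_elim
      fix t assume t: "x0 / \<theta> \<le> t"
      show "F t \<le> ereal (3 * \<epsilon>)"
        unfolding F_def
      proof (intro SUP_least)
        fix x y :: real and \<delta> :: ereal and s :: real
        assume x: "x \<in> {\<theta> * t..}" and y: "y \<in> {y. \<bar>y\<bar> \<le> K * b x}" and \<delta>: "\<delta> \<in> {ereal \<delta>0..\<infinity>}" and s: "s \<in> {0<..t}"
        have "x0 \<le> x" "t \<le> x / \<theta>" using x t assms(8) by (auto simp: field_simps)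
        then have "\<bar>measure (\<mu> s) (shifted_Delta (x - y) \<delta>) / (s * measure \<nu> (shifted_Delta x \<delta>)) - 1\<bar> \<le> 3 * \<epsilon>"
          using y \<delta> s by (intro x0) auto
        moreover have "measure (\<mu> s) (shifted_Delta (x - y) \<delta>) = measure M {\<omega> \<in> space M. X s \<omega> \<in> shifted_Delta (x - y) \<delta>}"
          unfolding \<mu>_def using s \<delta> rv[of s] shift_borel
          by (subst measure_distr) (auto simp: vimage_def Int_def conj_commute)
        ultimately show "ereal \<bar>measure M {\<omega> \<in> space M. X s \<omega> \<in> shifted_Delta (x - y) \<delta>}
                     / (s * measure \<nu> (shifted_Delta x \<delta>)) - 1\<bar> \<le> ereal (3 * \<epsilon>)" by simp
      qed
    qed
  qed
  have "(F \<longlongrightarrow> 0) at_top"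
  proof (rule order_tendstoI)
    fix a :: ereal assume "a < 0"
    then show "\<forall>\<^sub>F t in at_top. a < F t"
      by (intro eventually_mono[OF eventually_gt_at_top[of "0::real"]] less_le_trans[OF _ F_nonneg])
  next
    fix a :: ereal assume "0 < a"
    then obtain c where c: "0 < ereal c" "ereal c < a" using ereal_dense2 by blast
    define \<epsilon> where "\<epsilon> = min 1 (c / 3)"
    have \<epsilon>: "0 < \<epsilon>" "\<epsilon> \<le> 1" "3 * \<epsilon> \<le> c" using c(1) by (auto simp: \<epsilon>_def)
    from F_le[OF \<epsilon>(1,2)] show "\<forall>\<^sub>F t in at_top. F t < a"
    proof eventually_elim
      fix t assume "F t \<le> ereal (3 * \<epsilon>)"
      also have "\<dots> \<le> ereal c" using \<epsilon> by simp
      also note c(2)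
      finally show "F t < a" .
    qed
  qed
  then show ?thesis by (simp add: F_def[abs_def])
qed

end
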